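(* For each $n\ge 1$ let $x_1,\dots,x_n$ be the random points in $\frac1n\mathbb Z$ with joint probability mass function proportional to $$\prod_{1\le i<j\le n}\big(\mu_n(x_i)-\mu_n(x_j)\big)^2\prod_{j=1}^n w_n(nx_j),$$ with associated recurrence coefficients $a_{j,n},b_{j,n}$. Suppose there exist real-valued continuous functions $a,b$ on $[0,1]$, with $a\ge0$ and $a\not\equiv0$, such that $\lim_{j/n\to\xi}a_{j,n}=a(\xi)$ and $\lim_{j/n\to\xi}b_{j,n}=b(\xi)$ for every $\xi\in[0,1]$. Assume further that there exist a function $\mu$ on $\mathbb R$, a bounded set $K\subset\mathbb R$ with $\mu(K)$ compact, and $\epsilon>0$ such that: (1) for all $k\in\mathbb N$, $\mathbb E\big[X_n(|\mu_n|^k\chi_{K^c})\big]=O(n^{-\epsilon})$ as $n\to\infty$; (2) $\mu_n$ has the uniform limit $\mu$, i.e. $\lim_{n\to\infty}\sup_{x\in\frac1n\mathbb Z\cap K}|\mu_n(x)-\mu(x)|=0$, and $\mu$ is strictly monotone on $K$. Then for any $f$ such that $f\circ\mu^{-1}$ is continuous with at most polynomial growth at infinity, we have $$\frac1nX_n(f)\to\frac1\pi\int_0^1\int_{\mu^{-1}(b(\xi)-2a(\xi))}^{\mu^{-1}(b(\xi)+2a(\xi))}f(x)\frac{d\mu(x)\,d\xi}{\sqrt{4a(\xi)^2-(\mu(x)-b(\xi))^2}}+\int_{a^{-1}(\{0\})}f\circ\mu^{-1}(b(\xi))\,d\xi$$ as $n\to\infty$ almost surely.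
   Context: For each $n$, $\nu_n:\mathbb Z\to\mathbb R$ is strictly monotone and $w_n:\mathbb Z\to[0,\infty)$ satisfies $\sum_{y\in\mathbb Z}|\nu_n(y)|^kw_n(y)<\infty$ for all $k\in\mathbb N$ and has at least $n$ points in its support. Put $\mu_n(x)=\nu_n(nx)$ for $x\in\frac1n\mathbb Z$. For a function $f:\mathbb R\to\mathbb R$, $X_n(f)=\sum_{j=1}^nf(x_j)$. $\chi_{K^c}$ is the indicator function of the complement of $K$. The point processes for different $n$ are regarded as defined on a common probability space. Recurrence coefficients: $p_{k,n}$ is the polynomial of degree $k$ with positive leading coefficient such that $\sum_{y\in\mathbb Z}p_{k,n}(\nu_n(y))p_{l,n}(\nu_n(y))w_n(y)=\delta_{k,l}$, and $r_{k,n}(y)=p_{k,n}(\nu_n(y))$. They satisfy $\nu_n(y)r_{j,n}(y)=a_{j,n}r_{j+1,n}(y)+b_{j,n}r_{j,n}(y)+a_{j-1,n}r_{j-1,n}(y)$ for $j\ge0$, with $a_{j,n}>0$, $b_{j,n}\in\mathbb R$, $a_{-1,n}=0$. The limit $\lim_{j/n\to\xi}$ means that $n\to\infty$ with $j/n\to\xi$ simultaneously. $\mu^{-1}$ is the inverse function of $\mu$. The inner integral against $d\mu(x)$ is understood via the substitution $u=\mu(x)$, i.e. as $\int_{b(\xi)-2a(\xi)}^{b(\xi)+2a(\xi)}f(\mu^{-1}(u))\,(4a(\xi)^2-(u-b(\xi))^2)^{-1/2}du$ (and as $0$ when $a(\xi)=0$).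
   Formalization: The polynomial growth of f∘μ^{-1} is replaced by |f(x)| ≤ C(1+|μ_n(x)|^m) for x in (1/n)Z outside K and all large n, because μ is unrelated to μ_n outside K and the claim fails when growth is measured by μ. *)

theory Defs
  imports "HOL-Probability.Probability" "HOL-Computational_Algebra.Polynomial"
begin

definition lattice_pts :: "nat \<Rightarrow> real set" where
  "lattice_pts n = range (\<lambda>y::int. real_of_int y / real n)"

text \<open>
  A function on the integers, transported to the lattice \<open>(1/n)\<int>\<close>: \<open>x \<mapsto> g (n x)\<close>.
  The floor only serves to read the integer \<open>n x\<close> as an element of type \<^typ>\<open>int\<close>; values
  off \<^term>\<open>lattice_pts n\<close> are never used.
\<close>

definition rescale :: "nat \<Rightarrow> (int \<Rightarrow> real) \<Rightarrow> real \<Rightarrow> real" where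
  "rescale n g x = g \<lfloor>real n * x\<rfloor>"

lemma rescale_lattice: "n > 0 \<Longrightarrow> rescale n g (real_of_int y / real n) = g y"
  by (simp add: rescale_def)

definition strictly_monotone_on :: "'a::linorder set \<Rightarrow> ('a \<Rightarrow> real) \<Rightarrow> bool" where
  "strictly_monotone_on A g \<longleftrightarrow> strict_mono_on A g \<or> strict_antimono_on A g"

definition weight_supp :: "(int \<Rightarrow> real) \<Rightarrow> int set" where
  "weight_supp w = {y. w y \<noteq> 0}"

text \<open>
  The ensemble of size \<open>n\<close>. Outcomes are ordered tuples; \<open>x j\<close> is the \<open>j\<close>-th point for
  \<open>j \<in> {1..n}\<close>. Since the events for the different tuples partition the sample space, the
  proportionality constant is forced to be the normalising one.
\<close>

definition joint_weight :: "(int \<Rightarrow> real) \<Rightarrow> (int \<Rightarrow> real) \<Rightarrow> nat \<Rightarrow> (nat \<Rightarrow> real) \<Rightarrow> real" where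
  "joint_weight \<nu> w n z =
     (\<Prod>(i, j)\<in>{(i, j). 1 \<le> i \<and> i < j \<and> j \<le> n}. (rescale n \<nu> (z i) - rescale n \<nu> (z j))\<^sup>2) *
     (\<Prod>j\<in>{1..n}. rescale n w (z j))"

definition polynomial_ensemble ::
    "'s measure \<Rightarrow> (int \<Rightarrow> real) \<Rightarrow> (int \<Rightarrow> real) \<Rightarrow> nat \<Rightarrow> (nat \<Rightarrow> 's \<Rightarrow> real) \<Rightarrow> bool" where
  "polynomial_ensemble M \<nu> w n x \<longleftrightarrow>
     (\<forall>j\<in>{1..n}. x j \<in> M \<rightarrow>\<^sub>M count_space (lattice_pts n)) \<and>
     (\<exists>c. \<forall>z. (\<forall>j\<in>{1..n}. z j \<in> lattice_pts n) \<longrightarrow>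
        measure M {\<omega> \<in> space M. \<forall>j\<in>{1..n}. x j \<omega> = z j} = c * joint_weight \<nu> w n z)"

definition lin_stat :: "nat \<Rightarrow> (nat \<Rightarrow> 's \<Rightarrow> real) \<Rightarrow> (real \<Rightarrow> real) \<Rightarrow> 's \<Rightarrow> real" where
  "lin_stat n x f \<omega> = (\<Sum>j\<in>{1..n}. f (x j \<omega>))"

text \<open>
  The orthonormal polynomial of degree \<open>k\<close> exists iff the weight has more than \<open>k\<close> support points,
  so for a weight with exactly \<open>N\<close> support points there are \<open>p 0, \<dots>, p (N - 1)\<close> only.
\<close>

definition poly_index :: "(int \<Rightarrow> real) \<Rightarrow> nat \<Rightarrow> bool" where
  "poly_index w k \<longleftrightarrow> infinite (weight_supp w) \<or> k < card (weight_supp w)"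

definition orthonormal_polys ::
    "(int \<Rightarrow> real) \<Rightarrow> (int \<Rightarrow> real) \<Rightarrow> (nat \<Rightarrow> real poly) \<Rightarrow> bool" where
  "orthonormal_polys \<nu> w p \<longleftrightarrow>
     (\<forall>k. poly_index w k \<longrightarrow> degree (p k) = k \<and> lead_coeff (p k) > 0) \<and>
     (\<forall>k l. poly_index w k \<longrightarrow> poly_index w l \<longrightarrow>
        ((\<lambda>y. poly (p k) (\<nu> y) * poly (p l) (\<nu> y) * w y) has_sum (if k = l then 1 else 0)) UNIV)"

text \<open>
  The three-term recurrence, with \<open>a (-1) = 0\<close>. If the weight has exactly \<open>N\<close> support points, the
  relation for \<open>j = N - 1\<close> (which determines \<open>b (N - 1)\<close>) holds on the support, without the term
  in \<open>p N\<close>; there is no coefficient \<open>a (N - 1)\<close>.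
\<close>

definition recurrence_coeffs ::
    "(int \<Rightarrow> real) \<Rightarrow> (int \<Rightarrow> real) \<Rightarrow> (nat \<Rightarrow> real poly) \<Rightarrow> (nat \<Rightarrow> real) \<Rightarrow> (nat \<Rightarrow> real) \<Rightarrow> bool"
  where
  "recurrence_coeffs \<nu> w p a b \<longleftrightarrow>
     (let r = (\<lambda>k y. poly (p k) (\<nu> y));
          lower = (\<lambda>j y. if j = 0 then 0 else a (j - 1) * r (j - 1) y)
      in (\<forall>j. poly_index w (Suc j) \<longrightarrow> a j > 0 \<and>
            (\<forall>y. \<nu> y * r j y = a j * r (Suc j) y + b j * r j y + lower j y)) \<and>
         (\<forall>j. poly_index w j \<and> \<not> poly_index w (Suc j) \<longrightarrow>
            (\<forall>y\<in>weight_supp w. \<nu> y * r j y = b j * r j y + lower j y)))"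

text \<open>The filter on pairs \<open>(j, n)\<close> describing \<open>n \<rightarrow> \<infinity>\<close> and \<open>j / n \<rightarrow> \<xi>\<close> simultaneously.\<close>

definition ratio_at :: "real \<Rightarrow> (nat \<times> nat) filter" where
  "ratio_at \<xi> = inf (filtercomap snd sequentially)
                    (filtercomap (\<lambda>(j, n). real j / real n) (nhds \<xi>))"

text \<open>
  Polynomial growth of a test function. The points off \<open>K\<close> are seen only through the
  functions \<open>\<mu>\<^sub>n\<close>, \<open>\<mu>\<close> being unrelated to \<open>\<mu>\<^sub>n\<close> there, so
  growth at infinity is measured in the coordinate \<open>\<mu>\<^sub>n\<close>, uniformly in \<open>n\<close>.
  A bound by powers of \<open>\<bar>\<mu>\<bar>\<close> would not control the contribution of these points:
  \<open>\<mu>\<^sub>n\<close> may stay bounded at lattice points where \<open>\<mu>\<close> tends to infinity arbitrarily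
  fast. On \<open>K\<close> no bound is needed, as \<open>f \<circ> \<mu>\<^sup>-\<^sup>1\<close> is continuous on the compact set \<open>\<mu>(K)\<close>.
\<close>

definition poly_growth :: "(nat \<Rightarrow> int \<Rightarrow> real) \<Rightarrow> real set \<Rightarrow> (real \<Rightarrow> real) \<Rightarrow> bool" where
  "poly_growth \<nu> K f \<longleftrightarrow>
     (\<exists>C m. \<forall>\<^sub>F n in sequentially. \<forall>x\<in>lattice_pts n - K. \<bar>f x\<bar> \<le> C * (1 + \<bar>rescale n (\<nu> n) x\<bar> ^ m))"

text \<open>
  The limit functional; \<open>g\<close> stands for \<open>f \<circ> \<mu>\<^sup>-\<^sup>1\<close>. For \<open>a \<xi> = 0\<close> the inner integral is over
  a single point, hence \<open>0\<close>.
\<close>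

definition limit_functional :: "(real \<Rightarrow> real) \<Rightarrow> (real \<Rightarrow> real) \<Rightarrow> (real \<Rightarrow> real) \<Rightarrow> real" where
  "limit_functional a b g =
     1 / pi * (LINT \<xi>:{0..1}|lborel.
        (LINT u:{b \<xi> - 2 * a \<xi>..b \<xi> + 2 * a \<xi>}|lborel. g u / sqrt (4 * (a \<xi>)\<^sup>2 - (u - b \<xi>)\<^sup>2))) +
     (LINT \<xi>:{\<xi>\<in>{0..1}. a \<xi> = 0}|lborel. g (b \<xi>))"

end

theory Submission
  imports Defs "Jordan_Normal_Form.Determinant"
begin

text \<open>
  Writing \<open>u = \<mu>\<^sub>n(x)\<close>, the squared Vandermonde product is up to a constant the square of the determinant
  \<open>det (p\<^sub>i(u\<^sub>j))\<close>, and Andreief's identity expresses the first two moments of \<open>\<Sum>\<^sub>j u\<^sub>j\<^sup>m\<close> by entries of the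
  \<open>m\<close>-th power of the Jacobi matrix of the recurrence coefficients. The mean is the trace of the leading
  \<open>n \<times> n\<close> block, which divided by \<open>n\<close> is a Riemann sum for the moments of the limit measure. The variance
  involves only boundedly many entries near the corner and stays bounded, so Borel-Cantelli gives almost sure
  convergence for all powers. The points outside \<open>K\<close> are negligible by (1), on \<open>K\<close> one may replace \<open>\<mu>\<^sub>n\<close> by
  \<open>\<mu>\<close>, and Weierstrass approximation passes from polynomials to continuous functions.
\<close>

section \<open>Determinantal structure and Andreief's identity\<close>

text \<open>Nothing is known about the joint law of the ensembles for different n, so almost sure
  convergence has to come from summable estimates. A variance bounded in n makes the squared error
  of the averages O(n^-2) in mean; this is why the exact cancellation in the variance matters. The
  rate in (1) serves the same end: after division by n it gives the summable n^(-1-\<epsilon>).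
  Probability stops at countably many limits, one per power and one per moment outside
  \<open>K\<close>; all later steps treat a fixed outcome. The Riemann sum works because a matrix
  power is local: around row k with k/n near \<xi>, the entries of the m-th power are fixed
  polynomials in coefficients that are almost constant. The diagonal entry therefore tends to the
  constant term of (A z + B + A/z)^m with A = a \<xi>, B = b \<xi>, which is the m-th moment of the
  arcsine law on [B - 2A, B + 2A]. Two obstacles shape the rest. A weight with finite support has
  only finitely many polynomials, while the variance looks beyond index n. And f composed with the
  inverse of \<mu> is meaningful only on \<mu>(K), so the limit measure must be shown to be carried
  by \<mu>(K).\<close>

lemma det_polys_vandermonde:
  fixes p :: "nat \<Rightarrow> real poly" and u :: "nat \<Rightarrow> real"
  assumes "\<And>k. k < n \<Longrightarrow> degree (p k) = k"
  shows "det (mat n n (\<lambda>(i, j). poly (p j) (u i))) =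
    (\<Prod>j<n. lead_coeff (p j)) * (\<Prod>j<n. \<Prod>i<j. u j - u i)"
  using assms
proof (induction n)
  case 0
  then show ?case by simp
next
  case (Suc n)
  \<comment> \<open>The last row is evaluated at a free variable \<open>t\<close> and the others do
    not see \<open>t\<close>. Laplace expansion along this row turns the determinant into a
    polynomial \<open>Q\<close> in \<open>t\<close>, whose top coefficient comes from the smaller
    determinant.\<close>
  define B where "B = (\<lambda>t. mat (Suc n) (Suc n) (\<lambda>(i, j). poly (p j) (if i < n then u i else t)))"
  define V where "V = (\<Prod>j<n. lead_coeff (p j)) * (\<Prod>j<n. \<Prod>i<j. u j - u i)"
  have B: "B t \<in> carrier_mat (Suc n) (Suc n)" for t by (simp add: B_def)
  define cof where "cof = (\<lambda>j. cofactor (B 0) n j)"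
  have del: "mat_delete (B t) n j = mat_delete (B 0) n j" if "j < Suc n" for t j
    by (rule eq_matI) (auto simp: mat_delete_def B_def)
  have cof: "cofactor (B t) n j = cof j" if "j < Suc n" for t j
    unfolding cof_def cofactor_def by (subst del[OF that]) (rule refl)
  have "mat_delete (B 0) n n = mat n n (\<lambda>(i, j). poly (p j) (u i))"
    by (rule eq_matI) (auto simp: mat_delete_def B_def)
  then have cofn: "cof n = V"
    unfolding cof_def cofactor_def V_def using Suc by (simp flip: power_add mult_2)
  define Q where "Q = (\<Sum>j<Suc n. Polynomial.smult (cof j) (p j))"
  have detB: "det (B t) = poly Q t" for t
  proof -
    have "det (B t) = (\<Sum>j<Suc n. B t $$ (n, j) * cofactor (B t) n j)"
      by (rule laplace_expansion_row[OF B]) simp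
    also have "\<dots> = (\<Sum>j<Suc n. poly (Polynomial.smult (cof j) (p j)) t)"
      by (intro sum.cong refl) (use cof in \<open>auto simp: B_def\<close>)
    finally show ?thesis by (simp add: Q_def poly_sum)
  qed
  have eq: "mat (Suc n) (Suc n) (\<lambda>(i, j). poly (p j) (u i)) = B (u n)"
    unfolding B_def by (rule eq_matI) (auto simp: less_Suc_eq)
  \<comment> \<open>If two of the first \<open>n\<close> nodes coincide, both sides vanish;
    otherwise the nodes are distinct and roots can be counted.\<close>
  show ?case
  proof (cases "inj_on u {..<n}")
    case False
    then obtain i j where ij: "i < n" "j < n" "i \<noteq> j" "u i = u j"
      by (auto simp: inj_on_def)
    have "det (B (u n)) = 0"
    proof (rule det_identical_rows[OF B \<open>i \<noteq> j\<close>])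
      show "row (B (u n)) i = row (B (u n)) j"
        using ij by (intro eq_vecI) (auto simp: B_def)
    qed (use ij in auto)
    moreover have "(\<Prod>j<n. \<Prod>i<j. u j - u i) = 0"
    proof -
      from ij obtain i' j' where "i' < j'" "j' < n" "u i' = u j'"
        by (metis linorder_neqE_nat)
      then have "\<exists>i\<in>{..<j'}. u j' - u i = 0"
        by (intro bexI[of _ i']) auto
      then have "(\<Prod>i<j'. u j' - u i) = 0"
        by (intro prod_zero) auto
      with \<open>j' < n\<close> show ?thesis
        using prod_zero[where f="\<lambda>j. \<Prod>i<j. u j - u i" and A="{..<n}"] by blast
    qed
    ultimately show ?thesis by (simp add: eq)
  next
    case True
    define R where "R = (\<Prod>i<n. [:- u i, 1:])"
    have degR: "degree R = n" unfolding R_def by (simp add: degree_prod_eq_sum_degree)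
    have leadR: "lead_coeff R = 1" unfolding R_def lead_coeff_prod by simp
    have cR: "coeff R n = 1" using leadR unfolding degR .
    have "degree (Polynomial.smult (cof j) (p j)) \<le> n" if "j < Suc n" for j
      using that Suc.prems[OF that] degree_smult_le[of "cof j" "p j"] by linarith
    then have degQ: "degree Q \<le> n"
      unfolding Q_def by (intro degree_sum_le) auto
    have cQ: "coeff Q n = V * lead_coeff (p n)"
    proof -
      have "coeff Q n = (\<Sum>j<n. cof j * coeff (p j) n) + cof n * coeff (p n) n"
        by (simp add: Q_def coeff_sum)
      also have "(\<Sum>j<n. cof j * coeff (p j) n) = 0"
        using Suc.prems by (intro sum.neutral) (auto simp: coeff_eq_0)
      finally show ?thesis using cofn Suc.prems by simp
    qed
    \<comment> \<open>Subtracting the multiple of \<open>R\<close> with the same top coefficient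
      leaves degree below \<open>n\<close>, yet \<open>n\<close> distinct roots remain; so the
      difference is zero.\<close>
    define D where "D = Q - Polynomial.smult (coeff Q n) R"
    have "D = 0"
    proof (rule ccontr)
      assume "D \<noteq> 0"
      have "degree D \<le> n" unfolding D_def
        using degQ degR by (metis degree_diff_le degree_smult_le)
      moreover have "coeff D n = 0" by (simp add: D_def cR)
      ultimately have "degree D < n \<or> n = 0 \<and> D = 0"
        using \<open>D \<noteq> 0\<close> by (metis leading_coeff_0_iff le_neq_implies_less)
      with \<open>D \<noteq> 0\<close> have "degree D < n" by simp
      moreover have "u ` {..<n} \<subseteq> {t. poly D t = 0}"
      proof clarsimp
        fix i assume i: "i < n"
        have "poly Q (u i) = 0"
          unfolding detB[symmetric]
        proof (rule det_identical_rows[OF B])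
          show "row (B (u i)) i = row (B (u i)) n"
            using i by (intro eq_vecI) (auto simp: B_def)
        qed (use i in auto)
        moreover have "poly R (u i) = 0"
          unfolding R_def poly_prod using i by auto
        ultimately show "poly D (u i) = 0" by (simp add: D_def)
      qed
      then have "card (u ` {..<n}) \<le> card {t. poly D t = 0}"
        using \<open>D \<noteq> 0\<close> by (intro card_mono poly_roots_finite)
      moreover have "card (u ` {..<n}) = n" using True by (simp add: card_image)
      ultimately show False
        using card_poly_roots_bound[OF \<open>D \<noteq> 0\<close>] by linarith
    qed
    then have "poly Q (u n) = V * lead_coeff (p n) * (\<Prod>i<n. u n - u i)"
      using cQ by (simp add: D_def R_def poly_prod)
    then show ?thesis
      by (simp add: eq detB V_def)
  qed
qed

text \<open>The Leibniz expansion of a Slater determinant: \<open>i\<close> runs over points and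
  \<sigma> distributes the functions. It is kept as a sum because Andreief's identity expands its
  square over pairs of permutations.\<close>

definition slater :: "(nat \<Rightarrow> 'y \<Rightarrow> real) \<Rightarrow> nat \<Rightarrow> (nat \<Rightarrow> 'y) \<Rightarrow> real" where
  "slater \<phi> n g = (\<Sum>\<sigma> | \<sigma> permutes {0..<n}. of_int (sign \<sigma>) * (\<Prod>i=0..<n. \<phi> (\<sigma> i) (g i)))"

lemma slater_det: "slater \<phi> n g = det (mat n n (\<lambda>(i, j). \<phi> j (g i)))"
  unfolding slater_def by (subst det_def'[of _ n]) (auto intro!: sum.cong prod.cong simp: permutes_in_image)

lemma slater_polys_square:
  fixes p :: "nat \<Rightarrow> real poly" and u :: "nat \<Rightarrow> real"
  assumes "\<And>k. k < n \<Longrightarrow> degree (p k) = k"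
  shows "(slater (\<lambda>k y. poly (p k) y) n u)\<^sup>2 =
    (\<Prod>j<n. lead_coeff (p j))\<^sup>2 * (\<Prod>j<n. \<Prod>i<j. (u i - u j)\<^sup>2)"
proof -
  have "slater (\<lambda>k y. poly (p k) y) n u =
      (\<Prod>j<n. lead_coeff (p j)) * (\<Prod>j<n. \<Prod>i<j. u j - u i)"
    unfolding slater_det using assms by (rule det_polys_vandermonde)
  then show ?thesis
    by (simp add: power_mult_distrib prod_power_distrib power2_commute)
qed

abbreviation abs_convergent :: "('a \<Rightarrow> real) \<Rightarrow> 'a set \<Rightarrow> bool" where
  "abs_convergent f A \<equiv> Infinite_Set_Sum.abs_summable_on f A"

text \<open>Expanding both determinants gives finitely many terms, each a product of functions of
  single coordinates, so the sum over the product space factorises. The factor \<open>h i\<close>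
  may differ between coordinates, as the second moment requires; hence the right-hand side stays a
  double sum and is not collapsed to one determinant.\<close>

lemma andreief:
  fixes \<phi> :: "nat \<Rightarrow> 'y::countable \<Rightarrow> real" and w :: "'y \<Rightarrow> real"
  defines "ip \<equiv> \<lambda>h k l. infsetsum (\<lambda>y. \<phi> k y * \<phi> l y * (h y * w y)) UNIV"
  assumes sm: "\<And>i k l. i < n \<Longrightarrow> k < n \<Longrightarrow> l < n \<Longrightarrow>
     abs_convergent (\<lambda>y. \<phi> k y * \<phi> l y * (h i y * w y)) UNIV"
  shows "abs_convergent (\<lambda>g. (slater \<phi> n g)\<^sup>2 * (\<Prod>i=0..<n. h i (g i) * w (g i)))
      (PiE {0..<n} (\<lambda>_. UNIV))" (is ?A)
    and "infsetsum (\<lambda>g. (slater \<phi> n g)\<^sup>2 * (\<Prod>i=0..<n. h i (g i) * w (g i))) (PiE {0..<n} (\<lambda>_. UNIV)) =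
      (\<Sum>\<sigma> | \<sigma> permutes {0..<n}. \<Sum>\<tau> | \<tau> permutes {0..<n}.
        of_int (sign \<sigma>) * of_int (sign \<tau>) * (\<Prod>i=0..<n. ip (h i) (\<sigma> i) (\<tau> i)))" (is ?B)
proof -
  define S where "S = {\<sigma>. \<sigma> permutes {0..<n}}"
  define P where "P = PiE {0..<n} (\<lambda>_. UNIV :: 'y set)"
  have fin: "finite S" unfolding S_def by (simp add: finite_permutations)
  define t where "t = (\<lambda>\<sigma> \<tau> g. of_int (sign \<sigma>) * of_int (sign \<tau>) *
     (\<Prod>i=0..<n. \<phi> (\<sigma> i) (g i) * \<phi> (\<tau> i) (g i) * (h i (g i) * w (g i))))"
  have eq: "(slater \<phi> n g)\<^sup>2 * (\<Prod>i=0..<n. h i (g i) * w (g i)) = (\<Sum>\<sigma>\<in>S. \<Sum>\<tau>\<in>S. t \<sigma> \<tau> g)" for g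
    unfolding slater_def power2_eq_square S_def[symmetric] sum_product t_def
    unfolding sum_distrib_right prod.distrib
    by (intro sum.cong refl) (simp add: algebra_simps)
  have lt: "\<sigma> i < n" if "\<sigma> \<in> S" "i < n" for \<sigma> i
    using that permutes_in_image[of \<sigma> "{0..<n}" i] by (auto simp: S_def)
  have s: "abs_convergent (t \<sigma> \<tau>) P" if "\<sigma> \<in> S" "\<tau> \<in> S" for \<sigma> \<tau>
    unfolding t_def P_def
    by (intro abs_summable_on_cmult_right abs_summable_on_prod_PiE) (use that lt sm in auto)
  show ?A
    unfolding eq P_def[symmetric] by (intro abs_summable_sum s)
  have v: "infsetsum (t \<sigma> \<tau>) P = of_int (sign \<sigma>) * of_int (sign \<tau>) * (\<Prod>i=0..<n. ip (h i) (\<sigma> i) (\<tau> i))"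
    if "\<sigma> \<in> S" "\<tau> \<in> S" for \<sigma> \<tau>
  proof -
    have "infsetsum (t \<sigma> \<tau>) P = of_int (sign \<sigma>) * of_int (sign \<tau>) * infsetsum (\<lambda>g.
       (\<Prod>i=0..<n. \<phi> (\<sigma> i) (g i) * \<phi> (\<tau> i) (g i) * (h i (g i) * w (g i)))) P"
      unfolding t_def P_def
      by (intro infsetsum_cmult_right abs_summable_on_prod_PiE) (use that lt sm in auto)
    also have "infsetsum (\<lambda>g. (\<Prod>i=0..<n. \<phi> (\<sigma> i) (g i) * \<phi> (\<tau> i) (g i) * (h i (g i) * w (g i)))) P
       = (\<Prod>i=0..<n. ip (h i) (\<sigma> i) (\<tau> i))"
      unfolding P_def ip_def by (intro infsetsum_prod_PiE) (use that lt sm in auto)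
    finally show ?thesis .
  qed
  show ?B
    unfolding eq P_def[symmetric] S_def[symmetric]
    by (subst sum_infsetsum[symmetric], intro abs_summable_sum s, assumption+, intro sum.cong refl,
        subst sum_infsetsum[symmetric], intro s, assumption+, intro sum.cong refl v)
qed

text \<open>The inverse of \<sigma> composed with \<tau> fixes everything off \<open>{s, t}\<close>,
  so it is the identity or the transposition. The case \<open>s = t\<close> is allowed and then
  forces \<tau> = \<sigma>.\<close>

lemma permutes_eq_off_pair:
  assumes \<sigma>: "\<sigma> permutes A" and \<tau>: "\<tau> permutes A" and s: "s \<in> A" and t: "t \<in> A"
    and eq: "\<And>i. i \<in> A \<Longrightarrow> i \<noteq> s \<Longrightarrow> i \<noteq> t \<Longrightarrow> \<sigma> i = \<tau> i"
  shows "\<tau> = \<sigma> \<or> \<tau> = \<sigma> \<circ> Transposition.transpose s t"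
proof -
  have c: "\<sigma> \<circ> (inv_into UNIV \<sigma> \<circ> \<tau>) = \<tau>"
    by (simp add: o_assoc permutes_inv_o[OF \<sigma>])
  have "inv_into UNIV \<sigma> \<circ> \<tau> permutes A" using \<sigma> \<tau> by (simp add: permutes_compose permutes_inv)
  moreover have "(inv_into UNIV \<sigma> \<circ> \<tau>) i = i" if "i \<in> A - {s, t}" for i
    using that eq[of i, symmetric] permutes_inverses(2)[OF \<sigma>, of i] by simp
  ultimately have "inv_into UNIV \<sigma> \<circ> \<tau> permutes {s, t}"
    by (rule permutes_superset)
  with c show ?thesis unfolding permutes_doubleton_iff by (metis comp_id)
qed

text \<open>\<open>c i\<close> is the Gram matrix for the weight at coordinate \<open>i\<close>, and
  it is the identity except at \<open>s\<close> and \<open>t\<close>. A nonzero term needs \<tau> to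
  agree with \<sigma> off \<open>{s, t}\<close>, which leaves \<tau> = \<sigma> with sign plus and
  \<tau> = \<sigma> after the transposition with sign minus.\<close>

lemma permutation_double_sum_two:
  fixes c :: "nat \<Rightarrow> nat \<Rightarrow> nat \<Rightarrow> real"
  assumes st: "s < n" "t < n" "s \<noteq> t"
    and c: "\<And>i k l. i < n \<Longrightarrow> i \<noteq> s \<Longrightarrow> i \<noteq> t \<Longrightarrow> k < n \<Longrightarrow> l < n \<Longrightarrow> c i k l = (if k = l then 1 else 0)"
  shows "(\<Sum>\<sigma> | \<sigma> permutes {0..<n}. \<Sum>\<tau> | \<tau> permutes {0..<n}.
        of_int (sign \<sigma>) * of_int (sign \<tau>) * (\<Prod>i=0..<n. c i (\<sigma> i) (\<tau> i))) =
    (\<Sum>\<sigma> | \<sigma> permutes {0..<n}. c s (\<sigma> s) (\<sigma> s) * c t (\<sigma> t) (\<sigma> t) - c s (\<sigma> s) (\<sigma> t) * c t (\<sigma> t) (\<sigma> s))"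
proof (intro sum.cong refl)
  fix \<sigma> assume "\<sigma> \<in> {\<sigma>. \<sigma> permutes {0..<n}}"
  then have \<sigma>: "\<sigma> permutes {0..<n}" by simp
  define F where "F = (\<lambda>\<tau>. of_int (sign \<sigma>) * of_int (sign \<tau>) * (\<Prod>i=0..<n. c i (\<sigma> i) (\<tau> i)))"
  define \<rho> where "\<rho> = \<sigma> \<circ> Transposition.transpose s t"
  have lt: "\<tau> i < n" if "\<tau> permutes {0..<n}" "i < n" for \<tau> i
    using that permutes_in_image[of \<tau> "{0..<n}" i] by auto
  have \<rho>: "\<rho> permutes {0..<n}"
    unfolding \<rho>_def using st by (intro permutes_compose[OF _ \<sigma>] permutes_swap_id) auto
  have ne: "\<rho> \<noteq> \<sigma>"
  proof -
    have "\<rho> s = \<sigma> t" by (simp add: \<rho>_def)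
    moreover have "\<sigma> t \<noteq> \<sigma> s" using st permutes_inj[OF \<sigma>] by (auto dest: injD)
    ultimately show ?thesis by metis
  qed
  have zero: "F \<tau> = 0" if "\<tau> permutes {0..<n}" "\<tau> \<noteq> \<sigma>" "\<tau> \<noteq> \<rho>" for \<tau>
  proof -
    from that permutes_eq_off_pair[OF \<sigma> that(1), of s t] st
    obtain i where i: "i < n" "i \<noteq> s" "i \<noteq> t" "\<sigma> i \<noteq> \<tau> i" unfolding \<rho>_def by auto
    then have "c i (\<sigma> i) (\<tau> i) = 0" using c[OF i(1-3)] lt[OF \<sigma>] lt[OF that(1)] by simp
    then have "\<exists>i\<in>{0..<n}. c i (\<sigma> i) (\<tau> i) = 0" using i(1) by auto
    then show ?thesis unfolding F_def by (auto intro: prod_zero)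
  qed
  have split: "(\<Prod>i=0..<n. G i) = G s * G t * (\<Prod>i\<in>{0..<n} - {s, t}. G i)" for G :: "nat \<Rightarrow> real"
  proof -
    have "(\<Prod>i=0..<n. G i) = (\<Prod>i\<in>{s, t}. G i) * (\<Prod>i\<in>{0..<n} - {s, t}. G i)"
      using st by (subst prod.subset_diff[of "{s, t}"]) auto
    then show ?thesis using st by simp
  qed
  have one: "(\<Prod>i\<in>{0..<n} - {s, t}. c i (\<sigma> i) (\<tau> i)) = 1" if "\<tau> = \<sigma> \<or> \<tau> = \<rho>" for \<tau>
  proof (rule prod.neutral, rule ballI)
    fix i assume i: "i \<in> {0..<n} - {s, t}"
    then have "\<tau> i = \<sigma> i" using that by (auto simp: \<rho>_def)
    with i show "c i (\<sigma> i) (\<tau> i) = 1" using c[of i "\<sigma> i" "\<sigma> i"] lt[OF \<sigma>] by simp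
  qed
  have perm: "permutation \<sigma>" "permutation (Transposition.transpose s t)"
    using \<sigma> permutation_permutes by (auto simp: permutation_swap_id)
  have sg: "sign \<rho> = - sign \<sigma>"
    unfolding \<rho>_def sign_compose[OF perm] sign_swap_id using st by simp
  have sq: "of_int (sign \<sigma>) * of_int (sign \<sigma>) = (1::real)"
    by (metis of_int_1 of_int_mult sign_idempotent)
  have "sum F {\<tau>. \<tau> permutes {0..<n}} = sum F {\<sigma>, \<rho>}"
    using \<sigma> \<rho> zero by (intro sum.mono_neutral_right) (auto simp: finite_permutations)
  also have "\<dots> = F \<sigma> + F \<rho>" using ne by simp
  also have "F \<sigma> = c s (\<sigma> s) (\<sigma> s) * c t (\<sigma> t) (\<sigma> t)"
    unfolding F_def split using one[of \<sigma>] sq by simp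
  also have "F \<rho> = - (c s (\<sigma> s) (\<sigma> t) * c t (\<sigma> t) (\<sigma> s))"
  proof -
    have "F \<rho> = - ((of_int (sign \<sigma>) * of_int (sign \<sigma>)) * (c s (\<sigma> s) (\<rho> s) * c t (\<sigma> t) (\<rho> t)))"
      unfolding F_def split using one[of \<rho>] sg by simp
    then show ?thesis using sq by (simp add: \<rho>_def)
  qed
  finally show "sum F {\<tau>. \<tau> permutes {0..<n}} =
    c s (\<sigma> s) (\<sigma> s) * c t (\<sigma> t) (\<sigma> t) - c s (\<sigma> s) (\<sigma> t) * c t (\<sigma> t) (\<sigma> s)" by simp
qed

text \<open>With a single exceptional coordinate, agreement elsewhere already forces \<tau> =
  \<sigma>.\<close>

lemma permutation_double_sum_one:
  fixes c :: "nat \<Rightarrow> nat \<Rightarrow> nat \<Rightarrow> real"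
  assumes s: "s < n"
    and c: "\<And>i k l. i < n \<Longrightarrow> i \<noteq> s \<Longrightarrow> k < n \<Longrightarrow> l < n \<Longrightarrow> c i k l = (if k = l then 1 else 0)"
  shows "(\<Sum>\<sigma> | \<sigma> permutes {0..<n}. \<Sum>\<tau> | \<tau> permutes {0..<n}.
        of_int (sign \<sigma>) * of_int (sign \<tau>) * (\<Prod>i=0..<n. c i (\<sigma> i) (\<tau> i))) =
    (\<Sum>\<sigma> | \<sigma> permutes {0..<n}. c s (\<sigma> s) (\<sigma> s))"
proof (intro sum.cong refl)
  fix \<sigma> assume "\<sigma> \<in> {\<sigma>. \<sigma> permutes {0..<n}}"
  then have \<sigma>: "\<sigma> permutes {0..<n}" by simp
  define F where "F = (\<lambda>\<tau>. of_int (sign \<sigma>) * of_int (sign \<tau>) * (\<Prod>i=0..<n. c i (\<sigma> i) (\<tau> i)))"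
  have lt: "\<tau> i < n" if "\<tau> permutes {0..<n}" "i < n" for \<tau> i
    using that permutes_in_image[of \<tau> "{0..<n}" i] by auto
  have zero: "F \<tau> = 0" if "\<tau> permutes {0..<n}" "\<tau> \<noteq> \<sigma>" for \<tau>
  proof -
    from that permutes_eq_off_pair[OF \<sigma> that(1), of s s] s
    obtain i where i: "i < n" "i \<noteq> s" "\<sigma> i \<noteq> \<tau> i" by auto
    then have "c i (\<sigma> i) (\<tau> i) = 0" using c[OF i(1,2)] lt[OF \<sigma>] lt[OF that(1)] by simp
    then have "\<exists>i\<in>{0..<n}. c i (\<sigma> i) (\<tau> i) = 0" using i(1) by auto
    then show ?thesis unfolding F_def by (auto intro: prod_zero)
  qed
  have sq: "of_int (sign \<sigma>) * of_int (sign \<sigma>) = (1::real)"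
    by (metis of_int_1 of_int_mult sign_idempotent)
  have "sum F {\<tau>. \<tau> permutes {0..<n}} = sum F {\<sigma>}"
    using \<sigma> zero by (intro sum.mono_neutral_right) (auto simp: finite_permutations)
  also have "\<dots> = (\<Prod>i=0..<n. c i (\<sigma> i) (\<sigma> i))"
    using sq by (simp add: F_def)
  also have "\<dots> = c s (\<sigma> s) (\<sigma> s) * (\<Prod>i\<in>{0..<n} - {s}. c i (\<sigma> i) (\<sigma> i))"
    using s by (intro prod.remove) auto
  also have "(\<Prod>i\<in>{0..<n} - {s}. c i (\<sigma> i) (\<sigma> i)) = 1"
    using c lt[OF \<sigma>] by (intro prod.neutral) auto
  finally show "sum F {\<tau>. \<tau> permutes {0..<n}} = c s (\<sigma> s) (\<sigma> s)" by simp
qed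

lemma sum_permutations_point:
  fixes F :: "nat \<Rightarrow> real"
  shows "(\<Sum>s<n. \<Sum>\<sigma> | \<sigma> permutes {0..<n}. F (\<sigma> s)) = fact n * (\<Sum>k<n. F k)"
proof -
  have "(\<Sum>s<n. F (\<sigma> s)) = (\<Sum>k<n. F k)" if "\<sigma> permutes {0..<n}" for \<sigma>
    using permutes_imp_bij[OF that] by (intro sum.reindex_bij_betw) (simp add: lessThan_atLeast0)
  then have "(\<Sum>\<sigma> | \<sigma> permutes {0..<n}. \<Sum>s<n. F (\<sigma> s)) = (\<Sum>\<sigma> | \<sigma> permutes {0..<n}. \<Sum>k<n. F k)"
    by (rule sum.cong[OF refl]) blast
  then show ?thesis
    by (subst sum.swap) (simp add: card_permutations)
qed

lemma sum_permutations_pair: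
  fixes F :: "nat \<Rightarrow> nat \<Rightarrow> real"
  shows "(\<Sum>s<n. \<Sum>t\<in>{..<n} - {s}. \<Sum>\<sigma> | \<sigma> permutes {0..<n}. F (\<sigma> s) (\<sigma> t)) =
    fact n * (\<Sum>k<n. \<Sum>l\<in>{..<n} - {k}. F k l)"
proof -
  have "(\<Sum>s<n. \<Sum>t\<in>{..<n} - {s}. F (\<sigma> s) (\<sigma> t)) = (\<Sum>k<n. \<Sum>l\<in>{..<n} - {k}. F k l)"
    if "\<sigma> permutes {0..<n}" for \<sigma>
  proof -
    have b: "bij_betw \<sigma> {..<n} {..<n}"
      using permutes_imp_bij[OF that] by (simp add: lessThan_atLeast0)
    have "(\<Sum>t\<in>{..<n} - {s}. F (\<sigma> s) (\<sigma> t)) = (\<Sum>l\<in>{..<n} - {\<sigma> s}. F (\<sigma> s) l)" if "s < n" for s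
      using that b by (intro sum.reindex_bij_betw bij_betw_DiffI[OF b]) (auto simp: bij_betw_def)
    then have "(\<Sum>s<n. \<Sum>t\<in>{..<n} - {s}. F (\<sigma> s) (\<sigma> t)) = (\<Sum>s<n. \<Sum>l\<in>{..<n} - {\<sigma> s}. F (\<sigma> s) l)"
      by (rule sum.cong[OF refl]) blast
    also have "\<dots> = (\<Sum>k<n. \<Sum>l\<in>{..<n} - {k}. F k l)"
      using b by (rule sum.reindex_bij_betw)
    finally show ?thesis .
  qed
  then have "(\<Sum>\<sigma> | \<sigma> permutes {0..<n}. \<Sum>s<n. \<Sum>t\<in>{..<n} - {s}. F (\<sigma> s) (\<sigma> t)) =
     (\<Sum>\<sigma> | \<sigma> permutes {0..<n}. \<Sum>k<n. \<Sum>l\<in>{..<n} - {k}. F k l)"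
    by (rule sum.cong[OF refl]) blast
  moreover have "(\<Sum>s<n. \<Sum>t\<in>{..<n} - {s}. \<Sum>\<sigma> | \<sigma> permutes {0..<n}. F (\<sigma> s) (\<sigma> t)) =
     (\<Sum>\<sigma> | \<sigma> permutes {0..<n}. \<Sum>s<n. \<Sum>t\<in>{..<n} - {s}. F (\<sigma> s) (\<sigma> t))"
  proof -
    have "(\<Sum>s<n. \<Sum>t\<in>{..<n} - {s}. \<Sum>\<sigma> | \<sigma> permutes {0..<n}. F (\<sigma> s) (\<sigma> t)) =
       (\<Sum>s<n. \<Sum>\<sigma> | \<sigma> permutes {0..<n}. \<Sum>t\<in>{..<n} - {s}. F (\<sigma> s) (\<sigma> t))"
      by (rule sum.cong[OF refl], rule sum.swap)
    also have "\<dots> = (\<Sum>\<sigma> | \<sigma> permutes {0..<n}. \<Sum>s<n. \<Sum>t\<in>{..<n} - {s}. F (\<sigma> s) (\<sigma> t))"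
      by (rule sum.swap)
    finally show ?thesis .
  qed
  ultimately show ?thesis
    by (simp add: card_permutations)
qed

text \<open>Each moment is a sum of instances of \<open>andreief\<close> with \<open>h\<close> or
  its square at one coordinate, or \<open>h\<close> at two coordinates, and \<open>1\<close> at all
  others. The square of the sum is split into its diagonal and its pairs
  \<open>s \<noteq> t\<close>; summing over \<sigma> makes the coordinates run through all indices,
  which produces the factor \<open>fact n\<close>.\<close>

lemma slater_moments:
  fixes \<phi> :: "nat \<Rightarrow> 'y::countable \<Rightarrow> real" and w h :: "'y \<Rightarrow> real" and n :: nat
  defines "ip \<equiv> \<lambda>f k l. infsetsum (\<lambda>y. \<phi> k y * \<phi> l y * (f y * w y)) UNIV"
    and "W \<equiv> \<lambda>g. (slater \<phi> n g)\<^sup>2 * (\<Prod>i=0..<n. w (g i))"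
    and "P \<equiv> PiE {0..<n} (\<lambda>_. UNIV :: 'y set)"
  assumes sm0: "\<And>k l. k < n \<Longrightarrow> l < n \<Longrightarrow> abs_convergent (\<lambda>y. \<phi> k y * \<phi> l y * w y) UNIV"
    and on: "\<And>k l. k < n \<Longrightarrow> l < n \<Longrightarrow> infsetsum (\<lambda>y. \<phi> k y * \<phi> l y * w y) UNIV = (if k = l then 1 else 0)"
    and sm1: "\<And>k l. k < n \<Longrightarrow> l < n \<Longrightarrow> abs_convergent (\<lambda>y. \<phi> k y * \<phi> l y * (h y * w y)) UNIV"
    and sm2: "\<And>k l. k < n \<Longrightarrow> l < n \<Longrightarrow> abs_convergent (\<lambda>y. \<phi> k y * \<phi> l y * ((h y)\<^sup>2 * w y)) UNIV"
  shows "abs_convergent W P" and "infsetsum W P = fact n"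
    and "abs_convergent (\<lambda>g. W g * (\<Sum>s<n. h (g s))) P"
    and "infsetsum (\<lambda>g. W g * (\<Sum>s<n. h (g s))) P = fact n * (\<Sum>k<n. ip h k k)"
    and "abs_convergent (\<lambda>g. W g * (\<Sum>s<n. h (g s))\<^sup>2) P"
    and "infsetsum (\<lambda>g. W g * (\<Sum>s<n. h (g s))\<^sup>2) P =
      fact n * ((\<Sum>k<n. ip (\<lambda>y. (h y)\<^sup>2) k k) + (\<Sum>k<n. ip h k k)\<^sup>2 - (\<Sum>k<n. \<Sum>l<n. (ip h k l)\<^sup>2))"
proof -
  define S where "S = {\<sigma>. \<sigma> permutes {0..<n}}"
  have ip1: "ip (\<lambda>_. 1) k l = (if k = l then 1 else 0)" if "k < n" "l < n" for k l
    using on[OF that] by (simp add: ip_def)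
  have lt: "\<sigma> i < n" if "\<sigma> \<in> S" "i < n" for \<sigma> i
    using that permutes_in_image[of \<sigma> "{0..<n}" i] by (auto simp: S_def)
  define ds where "ds = (\<lambda>H. \<Sum>\<sigma>\<in>S. \<Sum>\<tau>\<in>S. of_int (sign \<sigma>) * of_int (sign \<tau>) * (\<Prod>i=0..<n. ip (H i) (\<sigma> i) (\<tau> i)))"
  have an: "abs_convergent (\<lambda>g. W g * (\<Prod>i=0..<n. H i (g i))) P"
    "infsetsum (\<lambda>g. W g * (\<Prod>i=0..<n. H i (g i))) P = ds H"
    if H: "\<And>i. i < n \<Longrightarrow> H i = (\<lambda>_. 1) \<or> H i = h \<or> H i = (\<lambda>y. (h y)\<^sup>2)" for H
  proof -
    have eq: "W g * (\<Prod>i=0..<n. H i (g i)) = (slater \<phi> n g)\<^sup>2 * (\<Prod>i=0..<n. H i (g i) * w (g i))" for g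
      by (simp add: W_def prod.distrib mult_ac)
    have sm: "abs_convergent (\<lambda>y. \<phi> k y * \<phi> l y * (H i y * w y)) UNIV"
      if "i < n" "k < n" "l < n" for i k l
      using H[OF that(1)] sm0[OF that(2,3)] sm1[OF that(2,3)] sm2[OF that(2,3)] by auto
    note A = andreief[of n \<phi> H w, OF sm]
    show "abs_convergent (\<lambda>g. W g * (\<Prod>i=0..<n. H i (g i))) P"
      unfolding eq P_def by (rule A(1))
    show "infsetsum (\<lambda>g. W g * (\<Prod>i=0..<n. H i (g i))) P = ds H"
      unfolding eq P_def ds_def ip_def S_def by (rule A(2))
  qed
  have pone: "(\<Prod>i=0..<n. (if i = s then f else (\<lambda>_. 1)) (g i)) = f (g s)" if "s < n" for f :: "'y \<Rightarrow> real" and s g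
  proof -
    have "(\<Prod>i=0..<n. (if i = s then f else (\<lambda>_. 1)) (g i)) = (\<Prod>i=0..<n. if s = i then f (g i) else 1)"
      by (intro prod.cong) auto
    then show ?thesis using that by (simp add: prod.delta)
  qed
  have one: "abs_convergent (\<lambda>g. W g * f (g s)) P"
    "infsetsum (\<lambda>g. W g * f (g s)) P = (\<Sum>\<sigma>\<in>S. ip f (\<sigma> s) (\<sigma> s))"
    if s: "s < n" and f: "f = h \<or> f = (\<lambda>y. (h y)\<^sup>2)" for s f
  proof -
    define H where "H = (\<lambda>i. if i = s then f else (\<lambda>_. 1))"
    have H: "H i = (\<lambda>_. 1) \<or> H i = h \<or> H i = (\<lambda>y. (h y)\<^sup>2)" for i
      using f by (auto simp: H_def)
    have p: "(\<Prod>i=0..<n. H i (g i)) = f (g s)" for g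
      unfolding H_def using s by (rule pone)
    show "abs_convergent (\<lambda>g. W g * f (g s)) P" using an(1)[of H, OF H] unfolding p .
    have "ds H = (\<Sum>\<sigma>\<in>S. ip (H s) (\<sigma> s) (\<sigma> s))"
      unfolding ds_def S_def
      by (rule permutation_double_sum_one[OF s]) (simp add: H_def ip1)
    then show "infsetsum (\<lambda>g. W g * f (g s)) P = (\<Sum>\<sigma>\<in>S. ip f (\<sigma> s) (\<sigma> s))"
      using an(2)[of H, OF H] unfolding p by (simp add: H_def)
  qed
  have two: "abs_convergent (\<lambda>g. W g * (h (g s) * h (g t))) P"
    "infsetsum (\<lambda>g. W g * (h (g s) * h (g t))) P =
      (\<Sum>\<sigma>\<in>S. ip h (\<sigma> s) (\<sigma> s) * ip h (\<sigma> t) (\<sigma> t) - (ip h (\<sigma> s) (\<sigma> t))\<^sup>2)"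
    if s: "s < n" and t: "t < n" and st: "s \<noteq> t" for s t
  proof -
    define H where "H = (\<lambda>i. if i = s \<or> i = t then h else (\<lambda>_. 1))"
    have H: "H i = (\<lambda>_. 1) \<or> H i = h \<or> H i = (\<lambda>y. (h y)\<^sup>2)" for i
      by (auto simp: H_def)
    have p: "(\<Prod>i=0..<n. H i (g i)) = h (g s) * h (g t)" for g
    proof -
      have "(\<Prod>i=0..<n. H i (g i)) = (\<Prod>i=0..<n. (if i = s then h else (\<lambda>_. 1)) (g i) * (if i = t then h else (\<lambda>_. 1)) (g i))"
        using st by (intro prod.cong) (auto simp: H_def)
      then show ?thesis using pone[OF s] pone[OF t] by (simp add: prod.distrib)
    qed
    show "abs_convergent (\<lambda>g. W g * (h (g s) * h (g t))) P" using an(1)[of H, OF H] unfolding p .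
    have sym: "ip h l k = ip h k l" for k l
      unfolding ip_def by (simp add: mult_ac)
    have "ds H = (\<Sum>\<sigma>\<in>S. ip (H s) (\<sigma> s) (\<sigma> s) * ip (H t) (\<sigma> t) (\<sigma> t) - ip (H s) (\<sigma> s) (\<sigma> t) * ip (H t) (\<sigma> t) (\<sigma> s))"
      unfolding ds_def S_def
      by (rule permutation_double_sum_two[OF s t st]) (simp add: H_def ip1)
    also have "\<dots> = (\<Sum>\<sigma>\<in>S. ip h (\<sigma> s) (\<sigma> s) * ip h (\<sigma> t) (\<sigma> t) - (ip h (\<sigma> s) (\<sigma> t))\<^sup>2)"
      by (intro sum.cong refl) (simp add: H_def power2_eq_square sym[of "_ s" "_ t"])
    finally show "infsetsum (\<lambda>g. W g * (h (g s) * h (g t))) P =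
      (\<Sum>\<sigma>\<in>S. ip h (\<sigma> s) (\<sigma> s) * ip h (\<sigma> t) (\<sigma> t) - (ip h (\<sigma> s) (\<sigma> t))\<^sup>2)"
      using an(2)[of H, OF H] unfolding p by simp
  qed
  show "abs_convergent W P"
    using an(1)[of "\<lambda>_ _. 1"] by simp
  show "infsetsum W P = fact n"
  proof -
    have "ds (\<lambda>_ _. 1) = fact n"
    proof (cases "n = 0")
      case True
      then show ?thesis by (simp add: ds_def S_def)
    next
      case False
      then have "ds (\<lambda>_ _. 1) = (\<Sum>\<sigma>\<in>S. ip (\<lambda>_. 1) (\<sigma> 0) (\<sigma> 0))"
        unfolding ds_def S_def by (intro permutation_double_sum_one) (auto simp: ip1)
      also have "\<dots> = (\<Sum>\<sigma>\<in>S. 1)"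
        using lt False by (intro sum.cong) (auto simp: ip1)
      finally show ?thesis by (simp add: S_def card_permutations)
    qed
    then show ?thesis using an(2)[of "\<lambda>_ _. 1"] by simp
  qed
  have e1: "W g * (\<Sum>s<n. h (g s)) = (\<Sum>s<n. W g * h (g s))" for g
    by (simp add: sum_distrib_left)
  show "abs_convergent (\<lambda>g. W g * (\<Sum>s<n. h (g s))) P"
    unfolding e1 by (intro abs_summable_sum one) auto
  have "infsetsum (\<lambda>g. W g * (\<Sum>s<n. h (g s))) P = (\<Sum>s<n. \<Sum>\<sigma>\<in>S. ip h (\<sigma> s) (\<sigma> s))"
    unfolding e1 by (subst sum_infsetsum[symmetric]) (auto simp: one)
  also have "\<dots> = fact n * (\<Sum>k<n. ip h k k)"
    unfolding S_def by (rule sum_permutations_point)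
  finally show "infsetsum (\<lambda>g. W g * (\<Sum>s<n. h (g s))) P = fact n * (\<Sum>k<n. ip h k k)" .
  have e2: "W g * (\<Sum>s<n. h (g s))\<^sup>2 =
     (\<Sum>s<n. W g * (h (g s))\<^sup>2) + (\<Sum>s<n. \<Sum>t\<in>{..<n} - {s}. W g * (h (g s) * h (g t)))" for g
  proof -
    have "(\<Sum>s<n. h (g s))\<^sup>2 = (\<Sum>s<n. \<Sum>t<n. h (g s) * h (g t))"
      by (simp add: power2_eq_square sum_product)
    also have "\<dots> = (\<Sum>s<n. (h (g s))\<^sup>2 + (\<Sum>t\<in>{..<n} - {s}. h (g s) * h (g t)))"
      by (rule sum.cong[OF refl], subst sum.remove) (auto simp: power2_eq_square)
    finally show ?thesis
      by (simp add: sum.distrib sum_distrib_left distrib_left)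
  qed
  have A: "abs_convergent (\<lambda>g. \<Sum>s<n. W g * (h (g s))\<^sup>2) P"
    using one(1)[of _ "\<lambda>y. (h y)\<^sup>2"] by (intro abs_summable_sum) auto
  have B: "abs_convergent (\<lambda>g. \<Sum>s<n. \<Sum>t\<in>{..<n} - {s}. W g * (h (g s) * h (g t))) P"
    by (intro abs_summable_sum two) auto
  show "abs_convergent (\<lambda>g. W g * (\<Sum>s<n. h (g s))\<^sup>2) P"
    unfolding e2 by (intro abs_summable_on_add A B)
  have A': "infsetsum (\<lambda>g. \<Sum>s<n. W g * (h (g s))\<^sup>2) P = fact n * (\<Sum>k<n. ip (\<lambda>y. (h y)\<^sup>2) k k)"
  proof -
    have "infsetsum (\<lambda>g. \<Sum>s<n. W g * (h (g s))\<^sup>2) P = (\<Sum>s<n. \<Sum>\<sigma>\<in>S. ip (\<lambda>y. (h y)\<^sup>2) (\<sigma> s) (\<sigma> s))"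
      using one[of _ "\<lambda>y. (h y)\<^sup>2"] by (subst sum_infsetsum[symmetric]) auto
    also have "\<dots> = fact n * (\<Sum>k<n. ip (\<lambda>y. (h y)\<^sup>2) k k)"
      unfolding S_def by (rule sum_permutations_point)
    finally show ?thesis .
  qed
  have "infsetsum (\<lambda>g. \<Sum>s<n. \<Sum>t\<in>{..<n} - {s}. W g * (h (g s) * h (g t))) P
      = (\<Sum>s<n. infsetsum (\<lambda>g. \<Sum>t\<in>{..<n} - {s}. W g * (h (g s) * h (g t))) P)"
    by (subst sum_infsetsum) (auto intro!: abs_summable_sum two)
  also have "\<dots> = (\<Sum>s<n. \<Sum>t\<in>{..<n} - {s}. infsetsum (\<lambda>g. W g * (h (g s) * h (g t))) P)"
    by (rule sum.cong[OF refl], subst sum_infsetsum) (auto intro!: two)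
  also have "\<dots> = (\<Sum>s<n. \<Sum>t\<in>{..<n} - {s}. \<Sum>\<sigma>\<in>S. ip h (\<sigma> s) (\<sigma> s) * ip h (\<sigma> t) (\<sigma> t) - (ip h (\<sigma> s) (\<sigma> t))\<^sup>2)"
    by (rule sum.cong[OF refl], rule sum.cong[OF refl], rule two(2)) auto
  also have "\<dots> = fact n * (\<Sum>k<n. \<Sum>l\<in>{..<n} - {k}. ip h k k * ip h l l - (ip h k l)\<^sup>2)"
    unfolding S_def by (rule sum_permutations_pair)
  \<comment> \<open>The terms \<open>l = k\<close> are zero, so the full square of the trace can be
    completed.\<close>
  also have "(\<Sum>k<n. \<Sum>l\<in>{..<n} - {k}. ip h k k * ip h l l - (ip h k l)\<^sup>2) =
     (\<Sum>k<n. \<Sum>l<n. ip h k k * ip h l l - (ip h k l)\<^sup>2)"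
    by (rule sum.cong[OF refl], subst (2) sum.remove) (auto simp: power2_eq_square)
  also have "\<dots> = (\<Sum>k<n. ip h k k)\<^sup>2 - (\<Sum>k<n. \<Sum>l<n. (ip h k l)\<^sup>2)"
    by (simp add: sum_subtractf power2_eq_square sum_product)
  finally have B': "infsetsum (\<lambda>g. \<Sum>s<n. \<Sum>t\<in>{..<n} - {s}. W g * (h (g s) * h (g t))) P =
     fact n * ((\<Sum>k<n. ip h k k)\<^sup>2 - (\<Sum>k<n. \<Sum>l<n. (ip h k l)\<^sup>2))" .
  show "infsetsum (\<lambda>g. W g * (\<Sum>s<n. h (g s))\<^sup>2) P =
      fact n * ((\<Sum>k<n. ip (\<lambda>y. (h y)\<^sup>2) k k) + (\<Sum>k<n. ip h k k)\<^sup>2 - (\<Sum>k<n. \<Sum>l<n. (ip h k l)\<^sup>2))"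
    unfolding e2 by (subst infsetsum_add[OF A B], subst A', subst B') (simp add: algebra_simps)
qed

section \<open>Moments of the linear statistics\<close>

text \<open>The law of \<open>Y\<close> has density \<open>q\<close> with respect to counting
  measure on \<open>S\<close>. This is the passage from expectations to the unordered sums of the
  determinantal computation.\<close>

lemma expectation_countable_range:
  fixes F :: "'a \<Rightarrow> real"
  assumes M: "prob_space M" and S: "countable S" and Y: "Y \<in> M \<rightarrow>\<^sub>M count_space S"
    and q: "\<And>g. g \<in> S \<Longrightarrow> measure M {\<omega> \<in> space M. Y \<omega> = g} = q g"
    and F: "abs_convergent (\<lambda>g. q g * F g) S"
  shows "integrable M (\<lambda>\<omega>. F (Y \<omega>))"
    and "(LINT \<omega>|M. F (Y \<omega>)) = infsetsum (\<lambda>g. q g * F g) S"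
proof -
  interpret prob_space M by fact
  have q0: "0 \<le> q g" if "g \<in> S" for g using q[OF that] measure_nonneg by metis
  have D: "distr M (count_space S) Y = density (count_space S) (\<lambda>g. ennreal (q g))"
  proof (rule measure_eqI_countable[OF _ _ S])
    fix g assume g: "g \<in> S"
    have "emeasure (distr M (count_space S) Y) {g} = emeasure M (Y -` {g} \<inter> space M)"
      using Y g by (simp add: emeasure_distr)
    also have "Y -` {g} \<inter> space M = {\<omega> \<in> space M. Y \<omega> = g}" by auto
    finally have *: "emeasure (distr M (count_space S) Y) {g} = ennreal (q g)"
      using q[OF g] by (simp add: emeasure_eq_measure)
    have "emeasure (density (count_space S) (\<lambda>g. ennreal (q g))) {g} =
       (\<integral>\<^sup>+ x. ennreal (q x) * indicator {g} x \<partial>count_space S)"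
      using g by (subst emeasure_density) auto
    also have "\<dots> = ennreal (q g)"
      using g by (subst nn_integral_indicator_singleton) auto
    finally show "emeasure (distr M (count_space S) Y) {g} =
       emeasure (density (count_space S) (\<lambda>g. ennreal (q g))) {g}" using * by simp
  qed auto
  have "integrable (distr M (count_space S) Y) F"
    unfolding D using q0 F
    by (subst integrable_density) (auto simp: abs_summable_on_def AE_count_space)
  then show "integrable M (\<lambda>\<omega>. F (Y \<omega>))"
    using Y by (subst (asm) integrable_distr_eq) auto
  have "(LINT \<omega>|M. F (Y \<omega>)) = (LINT g|distr M (count_space S) Y. F g)"
    using Y by (subst integral_distr) auto
  also have "\<dots> = infsetsum (\<lambda>g. q g * F g) S"
    unfolding D using q0
    by (subst integral_density) (auto simp: infsetsum_def AE_count_space)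
  finally show "(LINT \<omega>|M. F (Y \<omega>)) = infsetsum (\<lambda>g. q g * F g) S" .
qed

text \<open>The points are numbered from \<open>1\<close> but the coordinates of
  \<open>slater\<close> from \<open>0\<close>, hence \<open>g (j - 1)\<close>. The leading
  coefficients appear because the \<open>p k\<close> are normalised, not monic.\<close>

lemma joint_weight_slater:
  fixes p :: "nat \<Rightarrow> real poly"
  assumes n: "n \<ge> 1" and deg: "\<And>k. k < n \<Longrightarrow> degree (p k) = k"
    and lead: "\<And>k. k < n \<Longrightarrow> lead_coeff (p k) > 0"
  shows "joint_weight \<nu> w n (\<lambda>j. real_of_int (g (j - 1)) / real n) =
    (slater (\<lambda>k y. poly (p k) (\<nu> y)) n g)\<^sup>2 * (\<Prod>i=0..<n. w (g i)) / (\<Prod>k<n. lead_coeff (p k))\<^sup>2"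
proof -
  define u where "u = (\<lambda>i. \<nu> (g i))"
  have s: "slater (\<lambda>k y. poly (p k) (\<nu> y)) n g = slater (\<lambda>k y. poly (p k) y) n u"
    by (simp add: slater_def u_def)
  have "(\<Prod>k<n. lead_coeff (p k)) \<noteq> 0"
    using prod_pos[of "{..<n}" "\<lambda>k. lead_coeff (p k)"] lead by force
  then have V: "(\<Prod>j<n. \<Prod>i<j. (u i - u j)\<^sup>2) =
     (slater (\<lambda>k y. poly (p k) (\<nu> y)) n g)\<^sup>2 / (\<Prod>k<n. lead_coeff (p k))\<^sup>2"
    unfolding s by (subst slater_polys_square[OF deg]) auto
  have "(\<Prod>(i, j)\<in>{(i, j). 1 \<le> i \<and> i < j \<and> j \<le> n}.
      (rescale n \<nu> (real_of_int (g (i - 1)) / real n) - rescale n \<nu> (real_of_int (g (j - 1)) / real n))\<^sup>2) =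
    (\<Prod>(j, i)\<in>(SIGMA j:{..<n}. {..<j}). (u i - u j)\<^sup>2)"
    by (rule prod.reindex_bij_witness[of _ "\<lambda>(j, i). (Suc i, Suc j)" "\<lambda>(i, j). (j - 1, i - 1)"])
      (use n in \<open>auto simp: u_def rescale_lattice\<close>)
  also have "\<dots> = (\<Prod>j<n. \<Prod>i<j. (u i - u j)\<^sup>2)"
    by (subst prod.Sigma) auto
  finally have 1: "(\<Prod>(i, j)\<in>{(i, j). 1 \<le> i \<and> i < j \<and> j \<le> n}.
      (rescale n \<nu> (real_of_int (g (i - 1)) / real n) - rescale n \<nu> (real_of_int (g (j - 1)) / real n))\<^sup>2) =
      (\<Prod>j<n. \<Prod>i<j. (u i - u j)\<^sup>2)" .
  have 2: "(\<Prod>j\<in>{1..n}. rescale n w (real_of_int (g (j - 1)) / real n)) = (\<Prod>i=0..<n. w (g i))"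
    by (rule prod.reindex_bij_witness[of _ Suc "\<lambda>j. j - 1"]) (use n in \<open>auto simp: rescale_lattice\<close>)
  show ?thesis
    unfolding joint_weight_def 1 2 V by simp
qed

lemma polynomial_ensemble_moments:
  fixes p :: "nat \<Rightarrow> real poly" and h w \<nu> :: "int \<Rightarrow> real"
    and x :: "nat \<Rightarrow> 's \<Rightarrow> real" and n :: nat and M :: "'s measure"
  defines "ip \<equiv> \<lambda>f k l. infsetsum (\<lambda>y. poly (p k) (\<nu> y) * poly (p l) (\<nu> y) * (f y * w y)) UNIV"
    and "X \<equiv> lin_stat n x (rescale n h)"
  assumes M: "prob_space M" and ens: "polynomial_ensemble M \<nu> w n x" and n: "n \<ge> 1"
    and deg: "\<And>k. k < n \<Longrightarrow> degree (p k) = k"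
    and lead: "\<And>k. k < n \<Longrightarrow> lead_coeff (p k) > 0"
    and sm0: "\<And>k l. k < n \<Longrightarrow> l < n \<Longrightarrow>
      abs_convergent (\<lambda>y. poly (p k) (\<nu> y) * poly (p l) (\<nu> y) * w y) UNIV"
    and on: "\<And>k l. k < n \<Longrightarrow> l < n \<Longrightarrow>
      infsetsum (\<lambda>y. poly (p k) (\<nu> y) * poly (p l) (\<nu> y) * w y) UNIV = (if k = l then 1 else 0)"
    and sm1: "\<And>k l. k < n \<Longrightarrow> l < n \<Longrightarrow>
      abs_convergent (\<lambda>y. poly (p k) (\<nu> y) * poly (p l) (\<nu> y) * (h y * w y)) UNIV"
    and sm2: "\<And>k l. k < n \<Longrightarrow> l < n \<Longrightarrow>
      abs_convergent (\<lambda>y. poly (p k) (\<nu> y) * poly (p l) (\<nu> y) * ((h y)\<^sup>2 * w y)) UNIV"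
  shows "integrable M X"
    and "(LINT \<omega>|M. X \<omega>) = (\<Sum>k<n. ip h k k)"
    and "integrable M (\<lambda>\<omega>. (X \<omega>)\<^sup>2)"
    and "(LINT \<omega>|M. (X \<omega>)\<^sup>2) =
      (\<Sum>k<n. ip (\<lambda>y. (h y)\<^sup>2) k k) + (\<Sum>k<n. ip h k k)\<^sup>2 - (\<Sum>k<n. \<Sum>l<n. (ip h k l)\<^sup>2)"
proof -
  interpret prob_space M by fact
  define P where "P = PiE {0..<n} (\<lambda>_. UNIV :: int set)"
  define W where "W = (\<lambda>g. (slater (\<lambda>k y. poly (p k) (\<nu> y)) n g)\<^sup>2 * (\<Prod>i=0..<n. w (g i)))"
  note sl = slater_moments[of n "\<lambda>k y. poly (p k) (\<nu> y)" w h, OF sm0 on sm1 sm2,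
    folded W_def P_def ip_def]
  have cP: "countable P" unfolding P_def by (intro countable_PiE) auto
  obtain c where xm: "\<And>j. j \<in> {1..n} \<Longrightarrow> x j \<in> M \<rightarrow>\<^sub>M count_space (lattice_pts n)"
    and c: "\<And>z. (\<forall>j\<in>{1..n}. z j \<in> lattice_pts n) \<Longrightarrow>
        measure M {\<omega> \<in> space M. \<forall>j\<in>{1..n}. x j \<omega> = z j} = c * joint_weight \<nu> w n z"
    using ens unfolding polynomial_ensemble_def by blast
  have xl: "x j \<omega> \<in> lattice_pts n" if "j \<in> {1..n}" "\<omega> \<in> space M" for j \<omega>
    using measurable_space[OF xm that(2)] that(1) by simp
  \<comment> \<open>The integers behind the lattice points. Restriction to \<open>{0..<n}\<close>
    makes each tuple a unique element of the countable set \<open>P\<close>.\<close>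
  define Y where "Y = (\<lambda>\<omega>. \<lambda>i\<in>{0..<n}. \<lfloor>real n * x (Suc i) \<omega>\<rfloor>)"
  have YP: "Y \<omega> \<in> P" for \<omega> by (auto simp: Y_def P_def)
  have Yeq: "{\<omega> \<in> space M. Y \<omega> = g} =
      {\<omega> \<in> space M. \<forall>j\<in>{1..n}. x j \<omega> = real_of_int (g (j - 1)) / real n}" if g: "g \<in> P" for g
  proof (rule Collect_cong, rule conj_cong[OF refl])
    fix \<omega> assume \<omega>: "\<omega> \<in> space M"
    have pt: "\<lfloor>real n * x (Suc i) \<omega>\<rfloor> = g i \<longleftrightarrow> x (Suc i) \<omega> = real_of_int (g i) / real n" if i: "i < n" for i
    proof -
      obtain y where "x (Suc i) \<omega> = real_of_int y / real n"
        using xl[of "Suc i" \<omega>] i \<omega> by (auto simp: lattice_pts_def)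
      then show ?thesis using n by (auto simp: field_simps)
    qed
    have "Y \<omega> = g \<longleftrightarrow> (\<forall>i\<in>{0..<n}. Y \<omega> i = g i)"
      using YP[of \<omega>] g unfolding P_def by (metis PiE_ext)
    also have "\<dots> \<longleftrightarrow> (\<forall>i<n. x (Suc i) \<omega> = real_of_int (g i) / real n)"
      using pt by (auto simp: Y_def)
    also have "\<dots> \<longleftrightarrow> (\<forall>j\<in>{1..n}. x j \<omega> = real_of_int (g (j - 1)) / real n)"
    proof -
      have "{1..n} = Suc ` {..<n}" by (simp add: image_Suc_lessThan)
      then show ?thesis by (simp add: lessThan_def)
    qed
    finally show "Y \<omega> = g \<longleftrightarrow> (\<forall>j\<in>{1..n}. x j \<omega> = real_of_int (g (j - 1)) / real n)" .
  qed
  define C where "C = c / (\<Prod>k<n. lead_coeff (p k))\<^sup>2"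
  have q: "measure M {\<omega> \<in> space M. Y \<omega> = g} = C * W g" if "g \<in> P" for g
  proof -
    have "measure M {\<omega> \<in> space M. Y \<omega> = g} = c * joint_weight \<nu> w n (\<lambda>j. real_of_int (g (j - 1)) / real n)"
      unfolding Yeq[OF that] by (rule c) (auto simp: lattice_pts_def)
    also have "joint_weight \<nu> w n (\<lambda>j. real_of_int (g (j - 1)) / real n) =
        (slater (\<lambda>k y. poly (p k) (\<nu> y)) n g)\<^sup>2 * (\<Prod>i=0..<n. w (g i)) / (\<Prod>k<n. lead_coeff (p k))\<^sup>2"
      using n deg lead by (rule joint_weight_slater)
    finally show ?thesis by (simp add: C_def W_def)
  qed
  have Ym: "Y \<in> M \<rightarrow>\<^sub>M count_space P"
  proof (subst measurable_count_space_eq_countable[OF cP], intro conjI ballI)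
    fix g assume g: "g \<in> P"
    have "Y -` {g} \<inter> space M = {\<omega> \<in> space M. Y \<omega> = g}" by auto
    also have "\<dots> = (\<Inter>j\<in>{1..n}. x j -` {real_of_int (g (j - 1)) / real n} \<inter> space M)"
      unfolding Yeq[OF g] using n by auto
    also have "\<dots> \<in> sets M"
      using n by (intro sets.finite_INT measurable_sets[OF xm]) (auto simp: lattice_pts_def)
    finally show "Y -` {g} \<inter> space M \<in> sets M" .
  qed (use YP in auto)
  have ex: "integrable M (\<lambda>\<omega>. F (Y \<omega>))" "(LINT \<omega>|M. F (Y \<omega>)) = infsetsum (\<lambda>g. C * W g * F g) P"
    if "abs_convergent (\<lambda>g. C * W g * F g) P" for F :: "(nat \<Rightarrow> int) \<Rightarrow> real"
    using expectation_countable_range[OF M cP Ym _ that] q by blast+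
  \<comment> \<open>The ensemble provides some proportionality constant only; testing with the
    function \<open>1\<close> determines it, since total mass \<open>1\<close> must equal
    \<open>C * fact n\<close>.\<close>
  have "abs_convergent (\<lambda>g. C * W g * 1) P"
    using abs_summable_on_cmult_right[OF sl(1), of C] by simp
  from ex(2)[OF this] have "1 = C * fact n"
    using sl(2) infsetsum_cmult_right[OF sl(1), of C] by (simp add: prob_space)
  then have C: "C = 1 / fact n" by (simp add: field_simps)
  have XY: "X \<omega> = (\<Sum>s<n. h (Y \<omega> s))" for \<omega>
    unfolding X_def lin_stat_def rescale_def
    by (rule sum.reindex_bij_witness[of _ Suc "\<lambda>j. j - 1"]) (auto simp: Y_def)
  have E: "integrable M (\<lambda>\<omega>. F (\<Sum>s<n. h (Y \<omega> s)))"
      "(LINT \<omega>|M. F (\<Sum>s<n. h (Y \<omega> s))) = infsetsum (\<lambda>g. W g * F (\<Sum>s<n. h (g s))) P / fact n"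
    if "abs_convergent (\<lambda>g. W g * F (\<Sum>s<n. h (g s))) P" for F :: "real \<Rightarrow> real"
  proof -
    have "abs_convergent (\<lambda>g. C * W g * F (\<Sum>s<n. h (g s))) P"
      using abs_summable_on_cmult_right[OF that, of C] by (simp add: mult.assoc)
    note e = ex[OF this]
    show "integrable M (\<lambda>\<omega>. F (\<Sum>s<n. h (Y \<omega> s)))" by (rule e(1))
    show "(LINT \<omega>|M. F (\<Sum>s<n. h (Y \<omega> s))) = infsetsum (\<lambda>g. W g * F (\<Sum>s<n. h (g s))) P / fact n"
      unfolding e(2) using infsetsum_cmult_right[OF that, of C] by (simp add: C mult.assoc)
  qed
  have s1: "abs_convergent (\<lambda>g. W g * (\<Sum>s<n. h (g s))) P"
    using sl(3) by (simp add: W_def)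
  have s2: "infsetsum (\<lambda>g. W g * (\<Sum>s<n. h (g s))) P = fact n * (\<Sum>k<n. ip h k k)"
    using sl(4) by (simp add: W_def ip_def)
  have s3: "abs_convergent (\<lambda>g. W g * (\<Sum>s<n. h (g s))\<^sup>2) P"
    using sl(5) by (simp add: W_def)
  have s4: "infsetsum (\<lambda>g. W g * (\<Sum>s<n. h (g s))\<^sup>2) P = fact n *
      ((\<Sum>k<n. ip (\<lambda>y. (h y)\<^sup>2) k k) + (\<Sum>k<n. ip h k k)\<^sup>2 - (\<Sum>k<n. \<Sum>l<n. (ip h k l)\<^sup>2))"
    using sl(6) by (simp add: W_def ip_def)
  show "integrable M X"
    unfolding XY[abs_def] by (rule E(1)[OF s1])
  show "(LINT \<omega>|M. X \<omega>) = (\<Sum>k<n. ip h k k)"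
    unfolding XY E(2)[OF s1] s2 by simp
  show "integrable M (\<lambda>\<omega>. (X \<omega>)\<^sup>2)"
    unfolding XY by (rule E(1)[OF s3])
  show "(LINT \<omega>|M. (X \<omega>)\<^sup>2) =
      (\<Sum>k<n. ip (\<lambda>y. (h y)\<^sup>2) k k) + (\<Sum>k<n. ip h k k)\<^sup>2 - (\<Sum>k<n. \<Sum>l<n. (ip h k l)\<^sup>2)"
    unfolding XY E(2)[OF s3] s4 by simp
qed

text \<open>
  The \<open>(k, j)\<close> entry of the \<open>m\<close>-th power of the Jacobi matrix with diagonal \<open>b\<close> and off-diagonal \<open>a\<close>.
\<close>

fun jacobi_pow :: "(nat \<Rightarrow> real) \<Rightarrow> (nat \<Rightarrow> real) \<Rightarrow> nat \<Rightarrow> nat \<Rightarrow> nat \<Rightarrow> real" where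
  "jacobi_pow a b 0 k j = (if k = j then 1 else 0)"
| "jacobi_pow a b (Suc m) k j =
    (if j = 0 then 0 else a (j - 1) * jacobi_pow a b m k (j - 1)) +
    b j * jacobi_pow a b m k j + a j * jacobi_pow a b m k (Suc j)"

lemma jacobi_pow_above: "k + m < j \<Longrightarrow> jacobi_pow a b m k j = 0"
  by (induction m arbitrary: j) auto

text \<open>Each step of the recursion adds three terms, each at most \<open>C\<close> times the
  previous bound. Coefficients beyond \<open>k + m\<close> need no control because they multiply
  entries outside the band.\<close>

lemma jacobi_pow_bound:
  assumes "\<And>i. i \<le> k + m \<Longrightarrow> \<bar>a i\<bar> \<le> C" and "\<And>i. i \<le> k + m \<Longrightarrow> \<bar>b i\<bar> \<le> C"
  shows "\<bar>jacobi_pow a b m k j\<bar> \<le> (3 * C) ^ m"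
  using assms
proof (induction m arbitrary: j)
  case 0
  then show ?case by simp
next
  case (Suc m)
  have IH: "\<bar>jacobi_pow a b m k i\<bar> \<le> (3 * C) ^ m" for i
    using Suc by simp
  have C: "C \<ge> 0" using Suc.prems(1)[of 0] by simp
  have trm: "\<bar>c i' * jacobi_pow a b m k i\<bar> \<le> C * (3 * C) ^ m"
    if "c = a \<or> c = b" "i' \<le> i" for c :: "nat \<Rightarrow> real" and i i'
  proof (cases "i \<le> k + m")
    case True
    then have "\<bar>c i'\<bar> \<le> C" using Suc.prems that by auto
    then show ?thesis unfolding abs_mult using IH C by (intro mult_mono) auto
  next
    case False
    then show ?thesis using C by (simp add: jacobi_pow_above)
  qed
  have "\<bar>if j = 0 then 0 else a (j - 1) * jacobi_pow a b m k (j - 1)\<bar> \<le> C * (3 * C) ^ m"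
    using trm[of a "j - 1" "j - 1"] C by auto
  moreover have "\<bar>b j * jacobi_pow a b m k j\<bar> \<le> C * (3 * C) ^ m"
    using trm[of b j j] by simp
  moreover have "\<bar>a j * jacobi_pow a b m k (Suc j)\<bar> \<le> C * (3 * C) ^ m"
    using trm[of a j "Suc j"] by simp
  ultimately have "\<bar>jacobi_pow a b (Suc m) k j\<bar> \<le> C * (3 * C) ^ m + C * (3 * C) ^ m + C * (3 * C) ^ m"
    unfolding jacobi_pow.simps by linarith
  also have "\<dots> = (3 * C) ^ Suc m" by simp
  finally show ?case .
qed

text \<open>Multiplication by \<open>u\<close> acts on the vector of the \<open>R j\<close> as the
  Jacobi matrix. Cutting the sum at \<open>N\<close> is exact, since row \<open>k\<close> of the
  \<open>m\<close>-th power ends at column \<open>k + m\<close>.\<close>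

lemma jacobi_pow_expansion:
  fixes R :: "nat \<Rightarrow> real"
  assumes rec: "\<And>j. u * R j = a j * R (Suc j) + b j * R j + (if j = 0 then 0 else a (j - 1) * R (j - 1))"
  shows "k + m \<le> N \<Longrightarrow> u ^ m * R k = (\<Sum>j\<le>N. jacobi_pow a b m k j * R j)"
proof (induction m)
  case 0
  then show ?case by (simp add: if_distrib[of "\<lambda>t. t * _"] cong: if_cong)
next
  case (Suc m)
  define W where "W = jacobi_pow a b m k"
  obtain N' where N: "N = Suc N'" using Suc.prems by (cases N) auto
  \<comment> \<open>The row already vanishes at \<open>N\<close> and \<open>Suc N\<close>, so the
    two index shifts below lose nothing at the upper end.\<close>
  have W0: "W N = 0" "W (Suc N) = 0" using Suc.prems by (auto simp: W_def jacobi_pow_above)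
  have "u ^ Suc m * R k = u * (u ^ m * R k)" by (simp only: power_Suc mult.assoc)
  also have "\<dots> = u * (\<Sum>j\<le>N. W j * R j)"
    using Suc.IH Suc.prems unfolding W_def by (metis Suc_leD add_Suc_right)
  also have "\<dots> = (\<Sum>j\<le>N. W j * (u * R j))"
    by (simp add: sum_distrib_left mult_ac)
  also have "\<dots> = (\<Sum>j\<le>N. W j * (a j * R (Suc j))) + (\<Sum>j\<le>N. W j * (b j * R j)) +
      (\<Sum>j\<le>N. W j * (if j = 0 then 0 else a (j - 1) * R (j - 1)))"
    unfolding rec by (simp add: sum.distrib distrib_left)
  also have "(\<Sum>j\<le>N. W j * (a j * R (Suc j))) =
      (\<Sum>j\<le>N. (if j = 0 then 0 else a (j - 1) * W (j - 1)) * R j)"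
    unfolding N sum.atMost_Suc_shift[of "\<lambda>j. (if j = 0 then 0 else a (j - 1) * W (j - 1)) * R j"]
    using W0 by (simp add: N mult_ac)
  also have "(\<Sum>j\<le>N. W j * (if j = 0 then 0 else a (j - 1) * R (j - 1))) =
      (\<Sum>j\<le>N. a j * W (Suc j) * R j)"
    unfolding N sum.atMost_Suc_shift[of "\<lambda>j. W j * (if j = 0 then 0 else a (j - 1) * R (j - 1))"]
    using W0 by (simp add: N mult_ac)
  finally show ?case
    unfolding W_def by (simp add: sum.distrib[symmetric] algebra_simps)
qed

lemma has_sum_imp_infsetsum:
  fixes f :: "'a \<Rightarrow> real"
  assumes "(f has_sum s) A"
  shows "abs_convergent f A" and "infsetsum f A = s"
proof -
  have "f summable_on A" using assms by (auto simp: summable_on_def)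
  then have "(\<lambda>x. norm (f x)) summable_on A"
    by (rule summable_on_iff_abs_summable_on_real[THEN iffD1])
  then show *: "abs_convergent f A" by (rule abs_summable_equivalent[THEN iffD1])
  show "infsetsum f A = s"
    using infsetsum_infsum[OF *] infsumI[OF assms] by simp
qed

lemma poly_index_mono: "poly_index w k \<Longrightarrow> j \<le> k \<Longrightarrow> poly_index w j"
  by (auto simp: poly_index_def)

text \<open>
  Setting the recurrence coefficients and the functions \<open>r\<^sub>k\<close> to zero off \<^const>\<open>poly_index\<close> makes the
  recurrence hold on the support for all \<open>j\<close>, so weights with finite support need no separate treatment.
\<close>

lemma moment_inner_products:
  fixes \<nu> w :: "int \<Rightarrow> real" and p :: "nat \<Rightarrow> real poly" and \<alpha> \<beta> :: "nat \<Rightarrow> real"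
  defines "a \<equiv> \<lambda>j. if poly_index w (Suc j) then \<alpha> j else 0"
    and "b \<equiv> \<lambda>j. if poly_index w j then \<beta> j else 0"
  assumes on: "orthonormal_polys \<nu> w p" and rec: "recurrence_coeffs \<nu> w p \<alpha> \<beta>"
    and k: "poly_index w k" and l: "poly_index w l"
  shows "abs_convergent (\<lambda>y. poly (p k) (\<nu> y) * poly (p l) (\<nu> y) * (\<nu> y ^ m * w y)) UNIV"
    and "infsetsum (\<lambda>y. poly (p k) (\<nu> y) * poly (p l) (\<nu> y) * (\<nu> y ^ m * w y)) UNIV =
      jacobi_pow a b m k l"
    and "abs_convergent (\<lambda>y. poly (p k) (\<nu> y) * poly (p l) (\<nu> y) * ((\<nu> y ^ m)\<^sup>2 * w y)) UNIV"
    and "infsetsum (\<lambda>y. poly (p k) (\<nu> y) * poly (p k) (\<nu> y) * ((\<nu> y ^ m)\<^sup>2 * w y)) UNIV =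
      (\<Sum>j | j \<le> k + m \<and> poly_index w j. (jacobi_pow a b m k j)\<^sup>2)"
proof -
  define R where "R = (\<lambda>y j. if poly_index w j then poly (p j) (\<nu> y) else 0)"
  have on': "abs_convergent (\<lambda>y. R y i * R y j * w y) UNIV"
    "infsetsum (\<lambda>y. R y i * R y j * w y) UNIV = (if i = j \<and> poly_index w i then 1 else 0)" for i j
  proof -
    have "((\<lambda>y. R y i * R y j * w y) has_sum (if i = j \<and> poly_index w i then 1 else 0)) UNIV"
    proof (cases "poly_index w i \<and> poly_index w j")
      case True
      then show ?thesis using on by (simp add: R_def orthonormal_polys_def)
    next
      case False
      then show ?thesis by (auto simp: R_def intro!: has_sum_0)
    qed
    note this[THEN has_sum_imp_infsetsum(1)] this[THEN has_sum_imp_infsetsum(2)]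
    then show "abs_convergent (\<lambda>y. R y i * R y j * w y) UNIV"
    "infsetsum (\<lambda>y. R y i * R y j * w y) UNIV = (if i = j \<and> poly_index w i then 1 else 0)" by auto
  qed
  have isum: "infsetsum (\<lambda>y. \<Sum>j\<in>J. c j * (R y i * R y j * w y)) UNIV =
      (\<Sum>j\<in>J. c j * (if i = j \<and> poly_index w i then 1 else 0))" for i J and c :: "nat \<Rightarrow> real"
  proof -
    have "infsetsum (\<lambda>y. \<Sum>j\<in>J. c j * (R y i * R y j * w y)) UNIV =
      (\<Sum>j\<in>J. infsetsum (\<lambda>y. c j * (R y i * R y j * w y)) UNIV)"
      by (rule sum_infsetsum[symmetric]) (rule abs_summable_on_cmult_right, rule on'(1))
    also have "\<dots> = (\<Sum>j\<in>J. c j * (if i = j \<and> poly_index w i then 1 else 0))"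
      by (rule sum.cong[OF refl]) (subst infsetsum_cmult_right[OF on'(1)], simp only: on'(2))
    finally show ?thesis .
  qed
  have rec': "\<nu> y * R y j = a j * R y (Suc j) + b j * R y j + (if j = 0 then 0 else a (j - 1) * R y (j - 1))"
    if "y \<in> weight_supp w" for y j
  proof (cases "poly_index w j")
    case True
    then have *: "j \<noteq> 0 \<Longrightarrow> poly_index w (j - 1)" using poly_index_mono by (metis diff_le_self)
    show ?thesis
      using rec that True * unfolding recurrence_coeffs_def Let_def
      by (cases "poly_index w (Suc j)") (auto simp: R_def a_def b_def)
  next
    case False
    then have "\<not> poly_index w (Suc j)" using poly_index_mono by (metis le_SucI order_refl)
    with False show ?thesis by (auto simp: R_def a_def)
  qed
  define W where "W = jacobi_pow a b m"
  \<comment> \<open>The factor \<open>w y\<close> is kept on both sides: the recurrence is available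
    on the support only, and off it both sides are zero.\<close>
  have exp: "\<nu> y ^ m * R y i * w y = (\<Sum>j\<le>i + m. W i j * R y j) * w y" for y i
  proof (cases "y \<in> weight_supp w")
    case True
    show ?thesis
      unfolding W_def using jacobi_pow_expansion[OF rec'[OF True], of i m "i + m"] by simp
  next
    case False
    then show ?thesis by (simp add: weight_supp_def)
  qed
  have Rk: "poly (p k) (\<nu> y) = R y k" and Rl: "poly (p l) (\<nu> y) = R y l" for y
    using k l by (auto simp: R_def)
  have e1: "R y k * R y l * (\<nu> y ^ m * w y) = (\<Sum>j\<le>k + m. W k j * (R y l * R y j * w y))" for y
  proof -
    have "R y k * R y l * (\<nu> y ^ m * w y) = R y l * (\<nu> y ^ m * R y k * w y)" by (simp add: mult_ac)
    also have "\<dots> = (\<Sum>j\<le>k + m. W k j * (R y l * R y j * w y))"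
      unfolding exp by (simp add: sum_distrib_left sum_distrib_right mult_ac)
    finally show ?thesis .
  qed
  show "abs_convergent (\<lambda>y. poly (p k) (\<nu> y) * poly (p l) (\<nu> y) * (\<nu> y ^ m * w y)) UNIV"
    unfolding Rk Rl e1 by (intro abs_summable_sum abs_summable_on_cmult_right on')
  have "infsetsum (\<lambda>y. R y k * R y l * (\<nu> y ^ m * w y)) UNIV =
      (\<Sum>j\<le>k + m. W k j * (if l = j \<and> poly_index w l then 1 else 0))"
    unfolding e1 by (rule isum)
  also have "\<dots> = W k l"
    using l by (simp add: W_def jacobi_pow_above if_distrib[of "\<lambda>t. _ * t"] cong: if_cong)
  finally show "infsetsum (\<lambda>y. poly (p k) (\<nu> y) * poly (p l) (\<nu> y) * (\<nu> y ^ m * w y)) UNIV =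
      jacobi_pow a b m k l"
    unfolding Rk Rl W_def .
  \<comment> \<open>One factor \<open>\<nu> y ^ m\<close> is given to each polynomial.
    Orthonormality then yields the squared norm of a row, the form in which it can cancel against
    the leading block.\<close>
  have e2: "R y k * R y l * ((\<nu> y ^ m)\<^sup>2 * w y) =
     (\<Sum>i\<le>k + m. \<Sum>j\<le>l + m. W k i * W l j * (R y i * R y j * w y))" for y l
  proof -
    have "R y k * R y l * ((\<nu> y ^ m)\<^sup>2 * w y) = (\<nu> y ^ m * R y k) * (\<nu> y ^ m * R y l * w y)"
      by (simp add: mult_ac power2_eq_square)
    also have "\<dots> = (\<nu> y ^ m * R y k * w y) * (\<Sum>j\<le>l + m. W l j * R y j)"
      unfolding exp[of y l] by (simp only: mult_ac)
    also have "\<dots> = (\<Sum>i\<le>k + m. W k i * R y i) * (\<Sum>j\<le>l + m. W l j * R y j) * w y"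
      unfolding exp[of y k] by (simp only: mult_ac)
    also have "\<dots> = (\<Sum>i\<le>k + m. \<Sum>j\<le>l + m. W k i * W l j * (R y i * R y j * w y))"
      unfolding sum_product unfolding sum_distrib_right by (intro sum.cong refl) (simp add: mult_ac)
    finally show ?thesis .
  qed
  show "abs_convergent (\<lambda>y. poly (p k) (\<nu> y) * poly (p l) (\<nu> y) * ((\<nu> y ^ m)\<^sup>2 * w y)) UNIV"
    unfolding Rk Rl e2 by (intro abs_summable_sum abs_summable_on_cmult_right on')
  have "infsetsum (\<lambda>y. R y k * R y k * ((\<nu> y ^ m)\<^sup>2 * w y)) UNIV =
      (\<Sum>i\<le>k + m. infsetsum (\<lambda>y. \<Sum>j\<le>k + m. W k i * W k j * (R y i * R y j * w y)) UNIV)"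
    unfolding e2
    by (rule sum_infsetsum[symmetric]) (rule abs_summable_sum, rule abs_summable_on_cmult_right, rule on'(1))
  also have "\<dots> = (\<Sum>i\<le>k + m. \<Sum>j\<le>k + m. W k i * W k j * (if i = j \<and> poly_index w i then 1 else 0))"
    by (rule sum.cong[OF refl], rule isum)
  also have "\<dots> = (\<Sum>i\<le>k + m. if poly_index w i then (W k i)\<^sup>2 else 0)"
  proof (rule sum.cong[OF refl])
    fix i assume "i \<in> {..k + m}"
    moreover have "(\<Sum>j\<le>k + m. W k i * W k j * (if i = j \<and> poly_index w i then 1 else 0)) =
       (\<Sum>j\<le>k + m. if i = j then (if poly_index w i then (W k i)\<^sup>2 else 0) else 0)"
      by (intro sum.cong refl) (auto simp: power2_eq_square)
    ultimately show "(\<Sum>j\<le>k + m. W k i * W k j * (if i = j \<and> poly_index w i then 1 else 0)) =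
       (if poly_index w i then (W k i)\<^sup>2 else 0)" by simp
  qed
  also have "\<dots> = (\<Sum>j | j \<le> k + m \<and> poly_index w j. (W k j)\<^sup>2)"
  proof -
    have "{j. j \<le> k + m \<and> poly_index w j} = {j \<in> {..k + m}. poly_index w j}" by auto
    then show ?thesis by (simp only: sum.inter_filter[OF finite_atMost])
  qed
  finally show "infsetsum (\<lambda>y. poly (p k) (\<nu> y) * poly (p k) (\<nu> y) * ((\<nu> y ^ m)\<^sup>2 * w y)) UNIV =
      (\<Sum>j | j \<le> k + m \<and> poly_index w j. (jacobi_pow a b m k j)\<^sup>2)"
    unfolding Rk W_def .
qed

text \<open>
  In the variance all products of entries inside the leading \<open>n \<times> n\<close> block cancel, by Parseval. What
  remains are the entries \<open>(k, j)\<close> with \<open>k < n \<le> j\<close>: at most \<open>m\<^sup>2\<close> of them, as the matrix power is banded.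
\<close>

lemma power_sum_moments:
  fixes \<nu> w :: "int \<Rightarrow> real" and p :: "nat \<Rightarrow> real poly" and \<alpha> \<beta> :: "nat \<Rightarrow> real"
    and x :: "nat \<Rightarrow> 's \<Rightarrow> real" and n m :: nat and M :: "'s measure"
  defines "a \<equiv> \<lambda>j. if poly_index w (Suc j) then \<alpha> j else 0"
    and "b \<equiv> \<lambda>j. if poly_index w j then \<beta> j else 0"
    and "X \<equiv> lin_stat n x (rescale n (\<lambda>y. \<nu> y ^ m))"
  assumes M: "prob_space M" and ens: "polynomial_ensemble M \<nu> w n x" and n: "n \<ge> 1"
    and card: "infinite (weight_supp w) \<or> n \<le> card (weight_supp w)"
    and on: "orthonormal_polys \<nu> w p" and rec: "recurrence_coeffs \<nu> w p \<alpha> \<beta>"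
  shows "integrable M X"
    and "(LINT \<omega>|M. X \<omega>) = (\<Sum>k<n. jacobi_pow a b m k k)"
    and "integrable M (\<lambda>\<omega>. (X \<omega>)\<^sup>2)"
    and "(\<And>k j. k < n \<Longrightarrow> \<bar>jacobi_pow a b m k j\<bar> \<le> B) \<Longrightarrow>
      (LINT \<omega>|M. (X \<omega>)\<^sup>2) - (LINT \<omega>|M. X \<omega>)\<^sup>2 \<le> (real m * B)\<^sup>2"
proof -
  have pi: "poly_index w k" if "k < n" for k
    using card that by (auto simp: poly_index_def)
  note mi = moment_inner_products[OF on rec pi pi, folded a_def b_def]
  have dl: "degree (p k) = k" "lead_coeff (p k) > 0" if "k < n" for k
    using on pi[OF that] by (auto simp: orthonormal_polys_def)
  note E = polynomial_ensemble_moments[where h="\<lambda>y. \<nu> y ^ m" and \<nu>=\<nu> and p=p and w=w and n=n and x=x and M=M,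
     OF M ens n, folded X_def]
  have on0: "abs_convergent (\<lambda>y. poly (p k) (\<nu> y) * poly (p l) (\<nu> y) * w y) UNIV"
    "infsetsum (\<lambda>y. poly (p k) (\<nu> y) * poly (p l) (\<nu> y) * w y) UNIV = (if k = l then 1 else 0)"
    if "k < n" "l < n" for k l
    using mi(1,2)[OF that, of 0] by simp_all
  note Em = E[OF dl on0 mi(1) mi(3)]
  show "integrable M X" by (rule Em(1))
  have S1: "(\<Sum>k<n. infsetsum (\<lambda>y. poly (p k) (\<nu> y) * poly (p k) (\<nu> y) * (\<nu> y ^ m * w y)) UNIV) =
      (\<Sum>k<n. jacobi_pow a b m k k)"
    by (rule sum.cong[OF refl], rule mi(2)) auto
  show EX: "(LINT \<omega>|M. X \<omega>) = (\<Sum>k<n. jacobi_pow a b m k k)"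
    using Em(2) S1 by (rule trans)
  show "integrable M (\<lambda>\<omega>. (X \<omega>)\<^sup>2)" by (rule Em(3))
  assume B: "\<And>k j. k < n \<Longrightarrow> \<bar>jacobi_pow a b m k j\<bar> \<le> B"
  have B2: "(jacobi_pow a b m k j)\<^sup>2 \<le> B\<^sup>2" if "k < n" for k j
    using B[OF that, of j] by (metis abs_ge_zero order_trans power_mono power2_abs)
  have EX2: "(LINT \<omega>|M. (X \<omega>)\<^sup>2) =
      (\<Sum>k<n. \<Sum>j | j \<le> k + m \<and> poly_index w j. (jacobi_pow a b m k j)\<^sup>2) +
      (\<Sum>k<n. jacobi_pow a b m k k)\<^sup>2 - (\<Sum>k<n. \<Sum>l<n. (jacobi_pow a b m k l)\<^sup>2)"
  proof -
    have S2: "(\<Sum>k<n. infsetsum (\<lambda>y. poly (p k) (\<nu> y) * poly (p k) (\<nu> y) * ((\<nu> y ^ m)\<^sup>2 * w y)) UNIV) =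
      (\<Sum>k<n. \<Sum>j | j \<le> k + m \<and> poly_index w j. (jacobi_pow a b m k j)\<^sup>2)"
      by (rule sum.cong[OF refl], rule mi(4)) auto
    have S3: "(\<Sum>k<n. \<Sum>l<n. (infsetsum (\<lambda>y. poly (p k) (\<nu> y) * poly (p l) (\<nu> y) * (\<nu> y ^ m * w y)) UNIV)\<^sup>2) =
      (\<Sum>k<n. \<Sum>l<n. (jacobi_pow a b m k l)\<^sup>2)"
      by (rule sum.cong[OF refl], rule sum.cong[OF refl], subst mi(2)) auto
    show ?thesis using Em(4) unfolding S1 S2 S3 .
  qed
  \<comment> \<open>Columns below \<open>n\<close> cancel. The others satisfy
    \<open>n \<le> j \<le> k + m\<close>, which is possible only for \<open>k \<ge> n - m\<close>,
    and there are at most \<open>m\<close> of them because \<open>k < n\<close>. At most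
    \<open>m\<close> rows are affected; if \<open>m > n\<close>, the truncated difference is
    \<open>0\<close> and admits all \<open>n\<close> rows.\<close>
  have row: "(\<Sum>j | j \<le> k + m \<and> poly_index w j. (jacobi_pow a b m k j)\<^sup>2) - (\<Sum>l<n. (jacobi_pow a b m k l)\<^sup>2)
     \<le> (if n - m \<le> k then real m * B\<^sup>2 else 0)" if k: "k < n" for k
  proof -
    have "(\<Sum>j | j \<le> k + m \<and> poly_index w j. (jacobi_pow a b m k j)\<^sup>2) \<le>
       (\<Sum>j\<in>{..<n} \<union> {n..<Suc (k + m)}. (jacobi_pow a b m k j)\<^sup>2)"
      by (intro sum_mono2) auto
    also have "\<dots> = (\<Sum>l<n. (jacobi_pow a b m k l)\<^sup>2) + (\<Sum>j\<in>{n..<Suc (k + m)}. (jacobi_pow a b m k j)\<^sup>2)"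
      by (intro sum.union_disjoint) auto
    also have "(\<Sum>j\<in>{n..<Suc (k + m)}. (jacobi_pow a b m k j)\<^sup>2) \<le> real (card {n..<Suc (k + m)}) * B\<^sup>2"
      using B2[OF k] by (intro sum_bounded_above) auto
    also have "real (card {n..<Suc (k + m)}) * B\<^sup>2 \<le> (if n - m \<le> k then real m * B\<^sup>2 else 0)"
      using k by (auto intro!: mult_right_mono)
    finally show ?thesis by simp
  qed
  have "(LINT \<omega>|M. (X \<omega>)\<^sup>2) - (LINT \<omega>|M. X \<omega>)\<^sup>2 =
      (\<Sum>k<n. (\<Sum>j | j \<le> k + m \<and> poly_index w j. (jacobi_pow a b m k j)\<^sup>2) - (\<Sum>l<n. (jacobi_pow a b m k l)\<^sup>2))"
    unfolding EX EX2 by (simp add: sum_subtractf)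
  also have "\<dots> \<le> (\<Sum>k<n. if n - m \<le> k then real m * B\<^sup>2 else 0)"
    by (intro sum_mono row) auto
  also have "\<dots> = (\<Sum>k\<in>{n - m..<n}. real m * B\<^sup>2)"
    by (rule sum.mono_neutral_cong_right) auto
  also have "\<dots> = real (card {n - m..<n}) * (real m * B\<^sup>2)" by simp
  also have "\<dots> \<le> real m * (real m * B\<^sup>2)"
    by (intro mult_right_mono) auto
  finally show "(LINT \<omega>|M. (X \<omega>)\<^sup>2) - (LINT \<omega>|M. X \<omega>)\<^sup>2 \<le> (real m * B)\<^sup>2"
    by (simp add: power2_eq_square mult_ac)
qed

section \<open>The limit functional\<close>

abbreviation unif01 :: "real measure" where
  "unif01 \<equiv> uniform_measure lborel {0..1}"

abbreviation unifpi :: "real measure" where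
  "unifpi \<equiv> uniform_measure lborel {0..pi}"

lemma prob_space_unif: "prob_space unif01" "prob_space unifpi"
  by (auto intro!: prob_space_uniform_measure)

lemma integral_uniform_interval:
  fixes f :: "real \<Rightarrow> real"
  assumes ab: "a < b" and f: "f \<in> borel_measurable borel"
  shows "(LINT t|uniform_measure lborel {a..b}. f t) = (LINT t:{a..b}|lborel. f t) / (b - a)"
proof -
  have d: "uniform_measure lborel {a..b} = density lborel (\<lambda>t. ennreal (indicator {a..b} t / (b - a)))"
    unfolding uniform_measure_def
    by (rule density_cong) (use ab in \<open>auto simp: divide_ennreal ennreal_indicator[symmetric] split: split_indicator\<close>)
  have "(LINT t|uniform_measure lborel {a..b}. f t) = (LINT t|lborel. (indicator {a..b} t / (b - a)) *\<^sub>R f t)"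
    unfolding d using f ab by (intro integral_density) (auto intro!: divide_nonneg_nonneg)
  also have "\<dots> = (LINT t|lborel. (indicator {a..b} t *\<^sub>R f t) / (b - a))"
    by (intro Bochner_Integration.integral_cong) auto
  finally show ?thesis by (simp add: set_lebesgue_integral_def)
qed

lemma integrable_bounded_prob:
  fixes f :: "'a \<Rightarrow> real"
  assumes "prob_space M" "f \<in> borel_measurable M" "\<And>x. \<bar>f x\<bar> \<le> C"
  shows "integrable M f"
proof -
  interpret prob_space M by fact
  show ?thesis using assms by (intro integrable_const_bound[of _ C]) auto
qed

text \<open>With \<open>u = B - 2 * A * cos \<theta>\<close> the square root becomes
  \<open>2 * A * sin \<theta>\<close>, which is the derivative of the substitution, so the endpoint
  singularities cancel.\<close>

lemma arcsine_substitution: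
  fixes g :: "real \<Rightarrow> real"
  assumes A: "A > 0" and g: "g \<in> borel_measurable borel" and C: "\<And>u. \<bar>g u\<bar> \<le> C"
  shows "(LINT u:{B - 2 * A..B + 2 * A}|lborel. g u / sqrt (4 * A\<^sup>2 - (u - B)\<^sup>2)) =
    pi * (LINT \<theta>|unifpi. g (B - 2 * A * cos \<theta>))"
proof -
  define G where "G = (\<lambda>\<theta>. B - 2 * A * cos \<theta>)"
  define G' where "G' = (\<lambda>\<theta>. 2 * A * sin \<theta>)"
  define F where "F = (\<lambda>u. g u / sqrt (4 * A\<^sup>2 - (u - B)\<^sup>2))"
  have F: "F \<in> borel_measurable borel" unfolding F_def using g by measurable
  have G: "G 0 = B - 2 * A" "G pi = B + 2 * A" by (simp_all add: G_def)
  have deriv: "(G has_real_derivative G' t) (at t)" for t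
    unfolding G_def G'_def by (auto intro!: derivative_eq_intros)
  have contG': "continuous_on {0..pi} G'" unfolding G'_def by (intro continuous_intros)
  have G'0: "G' t \<ge> 0" if "t \<in> {0..pi}" for t
    using that A by (auto simp: G'_def sin_ge_zero)
  have FG: "F (G t) * G' t = g (G t)" if "t \<in> {0<..<pi}" for t
  proof -
    have s: "sin t > 0" using that by (auto intro: sin_gt_zero)
    have "4 * A\<^sup>2 - (G t - B)\<^sup>2 = 4 * A\<^sup>2 * (1 - (cos t)\<^sup>2)"
      by (simp add: G_def power_mult_distrib algebra_simps)
    also have "\<dots> = (G' t)\<^sup>2" by (simp add: G'_def power_mult_distrib sin_squared_eq)
    finally have "sqrt (4 * A\<^sup>2 - (G t - B)\<^sup>2) = G' t"
      using G'0 that by simp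
    moreover have "G' t \<noteq> 0" using s A by (simp add: G'_def)
    ultimately show ?thesis by (simp add: F_def)
  qed
  \<comment> \<open>The integrand may be unbounded at both endpoints, so its integrability has to be
    shown before the Bochner integral is substituted. The nonnegative integral can be transformed
    first, and the result is bounded by \<open>C\<close> almost everywhere.\<close>
  have nn: "(\<integral>\<^sup>+ u. ennreal \<bar>F u\<bar> * indicator {G 0..G pi} u \<partial>lborel) =
     (\<integral>\<^sup>+ t. ennreal (\<bar>F (G t)\<bar> * G' t) * indicator {0..pi} t \<partial>lborel)"
    using nn_integral_substitution[where a=0 and b=pi and g=G and f="\<lambda>u. \<bar>F u\<bar>" and g'=G'] deriv contG' G'0 F
    by (simp add: set_borel_measurable_def ennreal_mult'' nn_integral_set_ennreal) 
  have "(\<integral>\<^sup>+ t. ennreal (\<bar>F (G t)\<bar> * G' t) * indicator {0..pi} t \<partial>lborel) \<le>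
      (\<integral>\<^sup>+ t. ennreal C * indicator {0..pi} t \<partial>lborel)"
  proof (rule nn_integral_mono_AE)
    have "AE t in lborel. t \<noteq> 0 \<and> t \<noteq> pi"
      using AE_lborel_singleton[of 0] AE_lborel_singleton[of pi] by eventually_elim auto
    then show "AE t in lborel. ennreal (\<bar>F (G t)\<bar> * G' t) * indicator {0..pi} t \<le> ennreal C * indicator {0..pi} t"
    proof eventually_elim
      case (elim t)
      show ?case
      proof (cases "t \<in> {0..pi}")
        case True
        then have "\<bar>F (G t)\<bar> * G' t = \<bar>F (G t) * G' t\<bar>" using G'0 by (simp add: abs_mult)
        also have "\<dots> = \<bar>g (G t)\<bar>" using FG[of t] True elim by auto
        also have "\<dots> \<le> C" by (rule C)
        finally show ?thesis by (intro mult_right_mono ennreal_leI) auto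
      qed auto
    qed
  qed
  also have "\<dots> < \<infinity>"
    by (simp add: nn_integral_cmult_indicator ennreal_mult_less_top)
  finally have fin: "(\<integral>\<^sup>+ u. ennreal \<bar>F u\<bar> * indicator {G 0..G pi} u \<partial>lborel) < \<infinity>"
    unfolding nn .
  have int: "set_integrable lborel {G 0..G pi} F"
    unfolding set_integrable_def
  proof (rule integrableI_bounded)
    show "(\<lambda>u. indicator {G 0..G pi} u *\<^sub>R F u) \<in> borel_measurable lborel"
      using F by simp
    have "(\<integral>\<^sup>+ u. ennreal (norm (indicator {G 0..G pi} u *\<^sub>R F u)) \<partial>lborel) =
       (\<integral>\<^sup>+ u. ennreal \<bar>F u\<bar> * indicator {G 0..G pi} u \<partial>lborel)"
      by (intro nn_integral_cong) (auto split: split_indicator)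
    with fin show "(\<integral>\<^sup>+ u. ennreal (norm (indicator {G 0..G pi} u *\<^sub>R F u)) \<partial>lborel) < \<infinity>" by simp
  qed
  have "(LINT u:{B - 2 * A..B + 2 * A}|lborel. F u) = (LBINT u. F u * indicator {G 0..G pi} u)"
    unfolding set_lebesgue_integral_def G by (simp add: mult.commute)
  also have "\<dots> = (LBINT t. F (G t) * G' t * indicator {0..pi} t)"
    by (rule integral_substitution(2)[where g=G and a=0 and b=pi and f=F and g'=G', OF int]) (use deriv contG' G'0 in auto)
  also have "\<dots> = (LBINT t. indicator {0..pi} t *\<^sub>R g (G t))"
  proof (rule integral_cong_AE)
    have "AE t in lborel. t \<noteq> 0 \<and> t \<noteq> pi"
      using AE_lborel_singleton[of 0] AE_lborel_singleton[of pi] by eventually_elim auto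
    then show "AE t in lborel. F (G t) * G' t * indicator {0..pi} t = indicator {0..pi} t *\<^sub>R g (G t)"
    proof eventually_elim
      case (elim t)
      then show ?case using FG[of t] by (auto split: split_indicator)
    qed
  qed (use F g in \<open>simp_all add: G_def G'_def\<close>)
  also have "\<dots> = pi * (LINT \<theta>|unifpi. g (G \<theta>))"
    by (subst integral_uniform_interval) (use g in \<open>simp_all add: G_def set_lebesgue_integral_def\<close>)
  finally show ?thesis unfolding F_def G_def .
qed

text \<open>
  The limit measure after the substitution \<open>u = b - 2 a cos \<theta>\<close>, in which the points \<open>\<xi>\<close> with
  \<open>a \<xi> = 0\<close> need no separate term. The sign makes the substitution increasing.
\<close>

definition arc_functional :: "(real \<Rightarrow> real) \<Rightarrow> (real \<Rightarrow> real) \<Rightarrow> (real \<Rightarrow> real) \<Rightarrow> real" where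
  "arc_functional a b g = (LINT \<xi>|unif01. LINT \<theta>|unifpi. g (b \<xi> - 2 * a \<xi> * cos \<theta>))"

lemma borel_measurable_mean_unifpi [measurable (raw)]:
  fixes a b g :: "real \<Rightarrow> real"
  assumes [measurable]: "a \<in> borel_measurable borel" "b \<in> borel_measurable borel" "g \<in> borel_measurable borel"
  shows "(\<lambda>\<xi>. LINT \<theta>|unifpi. g (b \<xi> - 2 * a \<xi> * cos \<theta>)) \<in> borel_measurable borel"
proof -
  interpret prob_space unifpi by (rule prob_space_unif)
  show ?thesis by (rule borel_measurable_lebesgue_integral) measurable
qed

text \<open>The unit interval is split at the zero set \<open>Z\<close> of \<open>a\<close>. Off
  \<open>Z\<close> the inner integral is \<open>pi\<close> times the mean over \<theta>, cancelling
  the factor \<open>1 / pi\<close>; on \<open>Z\<close> that mean is the mean of the constant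
  \<open>g (b \<xi>)\<close>.\<close>

lemma limit_functional_eq_arc:
  fixes a b g :: "real \<Rightarrow> real"
  assumes a: "a \<in> borel_measurable borel" and b: "b \<in> borel_measurable borel"
    and a0: "\<And>\<xi>. \<xi> \<in> {0..1} \<Longrightarrow> a \<xi> \<ge> 0"
    and g: "g \<in> borel_measurable borel" and C: "\<And>u. \<bar>g u\<bar> \<le> C"
  shows "limit_functional a b g = arc_functional a b g"
proof -
  note [measurable] = a b g
  interpret V: prob_space unifpi by (rule prob_space_unif)
  define m where "m = (\<lambda>\<xi>. LINT \<theta>|unifpi. g (b \<xi> - 2 * a \<xi> * cos \<theta>))"
  define Z where "Z = {\<xi>\<in>{0..1}. a \<xi> = 0}"
  have Z[measurable]: "Z \<in> sets borel" unfolding Z_def by measurable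
  have m[measurable]: "m \<in> borel_measurable borel" unfolding m_def by measurable
  have gi: "integrable unifpi (\<lambda>\<theta>. g (b \<xi> - 2 * a \<xi> * cos \<theta>))" for \<xi>
    by (rule integrable_bounded_prob[OF prob_space_unif(2) _ C]) measurable
  have mC: "\<bar>m \<xi>\<bar> \<le> C" for \<xi>
  proof -
    have "\<bar>m \<xi>\<bar> \<le> (LINT \<theta>|unifpi. \<bar>g (b \<xi> - 2 * a \<xi> * cos \<theta>)\<bar>)"
      unfolding m_def by (rule integral_abs_bound)
    also have "\<dots> \<le> (LINT \<theta>|unifpi. C)"
      using gi C by (intro integral_mono) auto
    finally show ?thesis by (simp add: V.prob_space)
  qed
  have ii: "integrable lborel (\<lambda>\<xi>. indicator S \<xi> * m \<xi>)" if "S \<in> sets borel" "S \<subseteq> {0..1}" for S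
  proof (rule Bochner_Integration.integrable_bound[of _ "\<lambda>\<xi>. indicator {0..1} \<xi> * C"])
    show "integrable lborel (\<lambda>\<xi>. indicator {0..1::real} \<xi> * C)" by simp
    show "AE \<xi> in lborel. norm (indicator S \<xi> * m \<xi>) \<le> norm (indicator {0..1} \<xi> * C)"
      using that mC by (auto split: split_indicator intro!: AE_I2 order_trans[OF mC abs_ge_self])
  qed (use that in measurable)
  have 1: "(LINT \<xi>:{0..1}|lborel. (LINT u:{b \<xi> - 2 * a \<xi>..b \<xi> + 2 * a \<xi>}|lborel.
      g u / sqrt (4 * (a \<xi>)\<^sup>2 - (u - b \<xi>)\<^sup>2))) = (LINT \<xi>|lborel. pi * (indicator ({0..1} - Z) \<xi> * m \<xi>))"
    unfolding set_lebesgue_integral_def[of lborel "{0..1}"]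
  proof (rule Bochner_Integration.integral_cong[OF refl])
    fix \<xi>
    show "indicator {0..1} \<xi> *\<^sub>R (LINT u:{b \<xi> - 2 * a \<xi>..b \<xi> + 2 * a \<xi>}|lborel.
      g u / sqrt (4 * (a \<xi>)\<^sup>2 - (u - b \<xi>)\<^sup>2)) = pi * (indicator ({0..1} - Z) \<xi> * m \<xi>)"
    proof (cases "\<xi> \<in> {0..1}")
      case True
      show ?thesis
      proof (cases "a \<xi> = 0")
        case True': True
        \<comment> \<open>Here the interval of integration is the single point
          \<open>b \<xi>\<close>, a null set.\<close>
        have "AE u in lborel. indicator {b \<xi> - 2 * a \<xi>..b \<xi> + 2 * a \<xi>} u *\<^sub>R
          (g u / sqrt (4 * (a \<xi>)\<^sup>2 - (u - b \<xi>)\<^sup>2)) = 0"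
          using AE_lborel_singleton[of "b \<xi>"]
          by eventually_elim (simp add: True' split: split_indicator)
        then have "(LINT u:{b \<xi> - 2 * a \<xi>..b \<xi> + 2 * a \<xi>}|lborel.
          g u / sqrt (4 * (a \<xi>)\<^sup>2 - (u - b \<xi>)\<^sup>2)) = 0"
          unfolding set_lebesgue_integral_def by (rule integral_eq_zero_AE)
        with True True' show ?thesis by (simp add: Z_def)
      next
        case False
        then have "a \<xi> > 0" using a0[OF True] by simp
        from arcsine_substitution[OF this g C, of "b \<xi>"] True False show ?thesis
          by (simp add: m_def Z_def)
      qed
    qed (auto split: split_indicator)
  qed
  have 2: "(LINT \<xi>:Z|lborel. g (b \<xi>)) = (LINT \<xi>|lborel. indicator Z \<xi> * m \<xi>)"
  proof -
    have "g (b \<xi>) = m \<xi>" if "\<xi> \<in> Z" for \<xi>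
    proof -
      have "m \<xi> = (LINT \<theta>|unifpi. g (b \<xi>))" using that by (simp add: m_def Z_def)
      also have "\<dots> = g (b \<xi>)" unfolding lebesgue_integral_const V.prob_space by simp
      finally show ?thesis ..
    qed
    then have "(LINT \<xi>:Z|lborel. g (b \<xi>)) = (LINT \<xi>:Z|lborel. m \<xi>)"
      using Z by (intro set_lebesgue_integral_cong) auto
    then show ?thesis by (simp add: set_lebesgue_integral_def)
  qed
  have "limit_functional a b g = (LINT \<xi>|lborel. indicator ({0..1} - Z) \<xi> * m \<xi>) + (LINT \<xi>|lborel. indicator Z \<xi> * m \<xi>)"
    unfolding limit_functional_def 1 Z_def[symmetric] 2 by simp
  also have "\<dots> = (LINT \<xi>|lborel. indicator ({0..1} - Z) \<xi> * m \<xi> + indicator Z \<xi> * m \<xi>)"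
    by (rule Bochner_Integration.integral_add[symmetric]; rule ii) (auto simp: Z_def[symmetric], auto simp: Z_def)
  also have "\<dots> = (LINT \<xi>:{0..1}|lborel. m \<xi>)"
    unfolding set_lebesgue_integral_def
    by (rule Bochner_Integration.integral_cong[OF refl]) (auto simp: Z_def split: split_indicator)
  also have "\<dots> = arc_functional a b g"
    unfolding arc_functional_def by (subst integral_uniform_interval) (auto simp: m_def)
  finally show ?thesis .
qed

section \<open>Traces of powers of Jacobi matrices\<close>

text \<open>
  The coefficient of \<open>z\<^sup>i\<close> in \<open>(A z + B + A / z)\<^sup>m\<close>, as a Fourier coefficient at \<open>z = exp (\<i> (pi - \<theta>))\<close>.
  It is the entry on the \<open>i\<close>-th diagonal for a bi-infinite Jacobi matrix with constant coefficients.
\<close>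

definition arc_coeff :: "nat \<Rightarrow> real \<Rightarrow> real \<Rightarrow> int \<Rightarrow> real" where
  "arc_coeff m A B i = (LINT \<theta>|unifpi. (B - 2 * A * cos \<theta>) ^ m * cos (of_int i * (pi - \<theta>)))"

lemma arc_coeff_integrable:
  "integrable unifpi (\<lambda>\<theta>. (B - 2 * A * cos \<theta>) ^ m * cos (of_int i * (pi - \<theta>)))"
proof (rule integrable_bounded_prob[OF prob_space_unif(2)])
  fix \<theta>
  have "\<bar>2 * A * cos \<theta>\<bar> \<le> 2 * \<bar>A\<bar>"
    using mult_left_mono[OF abs_cos_le_one[of \<theta>], of "2 * \<bar>A\<bar>"] by (simp add: abs_mult)
  then have "\<bar>B - 2 * A * cos \<theta>\<bar> \<le> \<bar>B\<bar> + 2 * \<bar>A\<bar>" by linarith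
  then have "\<bar>(B - 2 * A * cos \<theta>) ^ m\<bar> \<le> (\<bar>B\<bar> + 2 * \<bar>A\<bar>) ^ m"
    unfolding power_abs by (intro power_mono) auto
  then show "\<bar>(B - 2 * A * cos \<theta>) ^ m * cos (of_int i * (pi - \<theta>))\<bar> \<le> (\<bar>B\<bar> + 2 * \<bar>A\<bar>) ^ m * 1"
    unfolding abs_mult by (intro mult_mono) auto
qed measurable

lemma arc_coeff_0: "arc_coeff 0 A B i = (if i = 0 then 1 else 0)"
proof (cases "i = 0")
  case True
  interpret prob_space unifpi by (rule prob_space_unif)
  show ?thesis using True by (simp add: arc_coeff_def prob_space)
next
  case False
  define F where "F = (\<lambda>\<theta>::real. - sin (of_int i * (pi - \<theta>)) / of_int i)"
  have "(LINT \<theta>:{0..pi}|lborel. cos (of_int i * (pi - \<theta>))) = F pi - F 0"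
    unfolding set_lebesgue_integral_def
  proof (rule integral_FTC_atLeastAtMost)
    fix t :: real
    have "(F has_real_derivative cos (of_int i * (pi - t))) (at t within {0..pi})"
      unfolding F_def using False by (auto intro!: derivative_eq_intros)
    then show "(F has_vector_derivative cos (of_int i * (pi - t))) (at t within {0..pi})"
      by (simp add: has_real_derivative_iff_has_vector_derivative)
  qed (auto intro!: continuous_intros)
  also have "\<dots> = 0"
    using sin_integer_2pi[of "of_int i / 2"] sin_zero_iff_int2[of "of_int i * pi"] by (auto simp: F_def)
  finally show ?thesis using False
    by (simp add: arc_coeff_def integral_uniform_interval)
qed

text \<open>With \<open>\<psi> = pi - \<theta>\<close> the new factor is
  \<open>B + 2 * A * cos \<psi>\<close>, and the product formula for cosines turns it into shifts of
  the index. This is the recursion of \<open>jacobi_pow\<close> with constant coefficients, indexed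
  by the offset from the diagonal.\<close>

lemma arc_coeff_Suc:
  "arc_coeff (Suc m) A B i = A * arc_coeff m A B (i - 1) + B * arc_coeff m A B i + A * arc_coeff m A B (i + 1)"
proof -
  have pt: "(B - 2 * A * cos \<theta>) * cos (of_int i * (pi - \<theta>)) =
     A * cos (of_int (i - 1) * (pi - \<theta>)) + B * cos (of_int i * (pi - \<theta>)) + A * cos (of_int (i + 1) * (pi - \<theta>))"
    for \<theta> :: real
  proof -
    define \<psi> where "\<psi> = pi - \<theta>"
    have c: "cos \<theta> = - cos \<psi>" by (simp add: \<psi>_def)
    have "cos (of_int (i - 1) * \<psi>) + cos (of_int (i + 1) * \<psi>) = 2 * cos \<psi> * cos (of_int i * \<psi>)"
      by (simp add: algebra_simps cos_add cos_diff)
    then have "A * cos (of_int (i - 1) * \<psi>) + A * cos (of_int (i + 1) * \<psi>) = A * (2 * cos \<psi> * cos (of_int i * \<psi>))"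
      by (metis distrib_left)
    then show ?thesis unfolding c \<psi>_def[symmetric] by (simp add: algebra_simps)
  qed
  have "arc_coeff (Suc m) A B i = (LINT \<theta>|unifpi.
      A * ((B - 2 * A * cos \<theta>) ^ m * cos (of_int (i - 1) * (pi - \<theta>))) +
      B * ((B - 2 * A * cos \<theta>) ^ m * cos (of_int i * (pi - \<theta>))) +
      A * ((B - 2 * A * cos \<theta>) ^ m * cos (of_int (i + 1) * (pi - \<theta>))))"
    unfolding arc_coeff_def
  proof (rule Bochner_Integration.integral_cong[OF refl])
    fix \<theta> :: real
    have "(B - 2 * A * cos \<theta>) ^ Suc m * cos (of_int i * (pi - \<theta>)) =
      (B - 2 * A * cos \<theta>) ^ m * ((B - 2 * A * cos \<theta>) * cos (of_int i * (pi - \<theta>)))" by simp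
    also have "\<dots> = A * ((B - 2 * A * cos \<theta>) ^ m * cos (of_int (i - 1) * (pi - \<theta>))) +
      B * ((B - 2 * A * cos \<theta>) ^ m * cos (of_int i * (pi - \<theta>))) +
      A * ((B - 2 * A * cos \<theta>) ^ m * cos (of_int (i + 1) * (pi - \<theta>)))"
      unfolding pt by (simp only: distrib_left mult.left_commute)
    finally show "(B - 2 * A * cos \<theta>) ^ Suc m * cos (of_int i * (pi - \<theta>)) = \<dots>" .
  qed
  also have "\<dots> = A * arc_coeff m A B (i - 1) + B * arc_coeff m A B i + A * arc_coeff m A B (i + 1)"
    unfolding arc_coeff_def
    by (simp only: Bochner_Integration.integral_add Bochner_Integration.integrable_add
        integrable_mult_right arc_coeff_integrable integral_mult_right_zero)
  finally show ?thesis .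
qed

text \<open>Finitely many coefficients at bounded distance from row \<open>K n\<close> enter, and
  all of them converge to \<open>A\<close> or \<open>B\<close>. As \<open>K n\<close> tends to
  infinity the corner of the matrix is not felt, so the two recursions agree in the limit.\<close>

lemma jacobi_pow_limit:
  fixes a b :: "nat \<Rightarrow> nat \<Rightarrow> real" and K :: "nat \<Rightarrow> nat"
  assumes K: "filterlim K at_top sequentially"
    and a: "\<And>i. (\<lambda>n. a n (nat (int (K n) + i))) \<longlonglongrightarrow> A"
    and b: "\<And>i. (\<lambda>n. b n (nat (int (K n) + i))) \<longlonglongrightarrow> B"
  shows "(\<lambda>n. jacobi_pow (a n) (b n) m (K n) (nat (int (K n) + i))) \<longlonglongrightarrow> arc_coeff m A B i"
proof (induction m arbitrary: i)
  case 0
  have "\<forall>\<^sub>F n in sequentially. nat \<bar>i\<bar> \<le> K n"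
    using K by (simp add: filterlim_at_top)
  then have "\<forall>\<^sub>F n in sequentially. jacobi_pow (a n) (b n) 0 (K n) (nat (int (K n) + i)) = arc_coeff 0 A B i"
    by eventually_elim (auto simp: arc_coeff_0)
  then show ?case by (rule tendsto_eventually)
next
  case (Suc m)
  define W where "W = (\<lambda>n i. jacobi_pow (a n) (b n) m (K n) (nat (int (K n) + i)))"
  \<comment> \<open>At this distance from the corner neither the truncation by \<open>nat\<close>
    nor the branch \<open>j = 0\<close> of \<open>jacobi_pow\<close> intervenes.\<close>
  have "\<forall>\<^sub>F n in sequentially. nat \<bar>i\<bar> + 2 \<le> K n"
    using K by (simp add: filterlim_at_top)
  then have "\<forall>\<^sub>F n in sequentially. a n (nat (int (K n) + (i - 1))) * W n (i - 1) +
      b n (nat (int (K n) + i)) * W n i + a n (nat (int (K n) + i)) * W n (i + 1) =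
      jacobi_pow (a n) (b n) (Suc m) (K n) (nat (int (K n) + i))"
  proof eventually_elim
    case (elim n)
    then have "nat (int (K n) + (i - 1)) = nat (int (K n) + i) - 1"
      "nat (int (K n) + (i + 1)) = Suc (nat (int (K n) + i))" "nat (int (K n) + i) \<noteq> 0" by auto
    then show ?case by (simp add: W_def)
  qed
  moreover have "(\<lambda>n. a n (nat (int (K n) + (i - 1))) * W n (i - 1) +
      b n (nat (int (K n) + i)) * W n i + a n (nat (int (K n) + i)) * W n (i + 1)) \<longlonglongrightarrow> arc_coeff (Suc m) A B i"
    unfolding arc_coeff_Suc W_def by (intro tendsto_intros a b Suc.IH)
  ultimately show ?case by (rule Lim_transform_eventually[rotated])
qed

text \<open>Evaluates the limit over pairs along a sequence of pairs; \<open>V\<close> marks the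
  indices for which the coefficient exists.\<close>

lemma ratio_at_sequence:
  assumes lim: "((\<lambda>(j, n). c n j) \<longlongrightarrow> l) (inf (ratio_at \<xi>) (principal {(j, n). V n j}))"
    and N: "filterlim N at_top sequentially" and J: "(\<lambda>k. real (J k) / real (N k)) \<longlonglongrightarrow> \<xi>"
    and V: "\<forall>\<^sub>F k in sequentially. V (N k) (J k)"
  shows "(\<lambda>k. c (N k) (J k)) \<longlonglongrightarrow> l"
proof -
  have "filterlim (\<lambda>k. (J k, N k)) (inf (ratio_at \<xi>) (principal {(j, n). V n j})) sequentially"
    unfolding ratio_at_def using N J V
    by (auto simp: filterlim_inf filterlim_filtercomap_iff filterlim_principal o_def)
  from filterlim_compose[OF lim this] show ?thesis by simp
qed

text \<open>By contradiction and compactness: pairs with values beyond every bound have ratios in a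
  compact interval, and along a subsequence these converge to a point of the unit interval, as an
  excess of at most \<open>m\<close> over \<open>n\<close> disappears in the ratio. There the
  coefficients converge, so they are bounded.\<close>

lemma ratio_limit_bounded:
  fixes c :: "nat \<Rightarrow> nat \<Rightarrow> real"
  assumes lim: "\<And>\<xi>. \<xi> \<in> {0..1} \<Longrightarrow>
      ((\<lambda>(j, n). c n j) \<longlongrightarrow> l \<xi>) (inf (ratio_at \<xi>) (principal {(j, n). V n j}))"
  shows "\<exists>C N. \<forall>n\<ge>N. \<forall>j\<le>n + m. V n j \<longrightarrow> \<bar>c n j\<bar> \<le> C"
proof (rule ccontr)
  assume neg: "\<not> ?thesis"
  have "\<exists>n j. n \<ge> Suc k \<and> j \<le> n + m \<and> V n j \<and> \<bar>c n j\<bar> > real k" for k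
  proof (rule ccontr)
    assume "\<not> ?thesis"
    then have "\<forall>n\<ge>Suc k. \<forall>j\<le>n + m. V n j \<longrightarrow> \<bar>c n j\<bar> \<le> real k" by (meson not_le)
    with neg show False by blast
  qed
  then obtain N J where NJ: "\<And>k. N k \<ge> Suc k" "\<And>k. J k \<le> N k + m" "\<And>k. V (N k) (J k)"
      "\<And>k. \<bar>c (N k) (J k)\<bar> > real k" by metis
  have ub: "real (J k) / real (N k) \<le> 1 + real m / real (N k)" for k
    using NJ(1)[of k] NJ(2)[of k] by (simp add: field_simps)
  have ub': "real m / real (N k) \<le> real m" for k
    using NJ(1)[of k] divide_left_mono[of 1 "real (N k)" "real m"] by simp
  have "real (J k) / real (N k) \<in> {0..1 + real m}" for k
    using ub[of k] ub'[of k] by auto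
  then obtain \<xi> r where r: "strict_mono r" and \<xi>: "(\<lambda>k. real (J (r k)) / real (N (r k))) \<longlonglongrightarrow> \<xi>"
    using compact_Icc[of 0 "1 + real m"] unfolding compact_def o_def by meson
  have Ntop: "filterlim N at_top sequentially"
    unfolding filterlim_at_top eventually_sequentially using NJ(1) by (meson Suc_leD order_trans)
  have Nr: "filterlim (\<lambda>k. N (r k)) at_top sequentially"
    using filterlim_compose[OF Ntop filterlim_subseq[OF r]] .
  have "(\<lambda>k. 1 + real m / real (N (r k))) \<longlonglongrightarrow> 1 + 0"
    by (intro tendsto_add tendsto_const real_tendsto_divide_at_top[OF tendsto_const]
        filterlim_compose[OF filterlim_real_sequentially Nr])
  then have "\<xi> \<le> 1" using LIMSEQ_le[OF \<xi>, of "\<lambda>k. 1 + real m / real (N (r k))"] ub by auto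
  moreover have "\<xi> \<ge> 0" by (rule LIMSEQ_le_const[OF \<xi>]) auto
  ultimately have "(\<lambda>k. c (N (r k)) (J (r k))) \<longlonglongrightarrow> l \<xi>"
    using NJ(3) by (intro ratio_at_sequence[OF lim Nr \<xi>]) auto
  then have "Bseq (\<lambda>k. c (N (r k)) (J (r k)))" by (rule convergentI[THEN convergent_imp_Bseq])
  then obtain D where D: "\<And>k. \<bar>c (N (r k)) (J (r k))\<bar> \<le> D" by (auto simp: Bseq_def)
  obtain k :: nat where "D \<le> real k" using real_arch_simple by blast
  moreover have "k \<le> r k" using r by (rule seq_suble)
  ultimately show False using NJ(4)[of "r k"] D[of k] by (smt (verit) of_nat_le_iff)
qed

text \<open>Writes an average as an integral over \<xi>, so that dominated convergence can replace a
  Riemann sum argument. The indicator of \<open>{0..<1}\<close> removes the point \<open>1\<close>,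
  where the index would be \<open>n\<close>.\<close>

lemma integral_step_function:
  fixes h :: "nat \<Rightarrow> real"
  assumes n: "n \<ge> 1"
  shows "(LINT \<xi>|unif01. indicator {0..<1} \<xi> * h (nat \<lfloor>real n * \<xi>\<rfloor>)) = (\<Sum>k<n. h k) / real n"
proof -
  define I where "I = (\<lambda>k. {real k / real n..<real (Suc k) / real n})"
  have mem: "\<xi> \<in> I k \<longleftrightarrow> nat \<lfloor>real n * \<xi>\<rfloor> = k \<and> 0 \<le> \<xi>" for \<xi> k
  proof -
    have "\<xi> \<in> I k \<longleftrightarrow> real k \<le> real n * \<xi> \<and> real n * \<xi> < real k + 1"
      using n by (auto simp: I_def field_simps)
    also have "\<dots> \<longleftrightarrow> \<lfloor>real n * \<xi>\<rfloor> = int k" by (simp add: floor_eq_iff)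
    also have "\<dots> \<longleftrightarrow> nat \<lfloor>real n * \<xi>\<rfloor> = k \<and> 0 \<le> \<xi>"
    proof -
      have "0 \<le> \<lfloor>real n * \<xi>\<rfloor> \<longleftrightarrow> 0 \<le> \<xi>" using n by (simp add: zero_le_mult_iff)
      moreover have "F = int k \<longleftrightarrow> nat F = k \<and> 0 \<le> F" for F by auto
      ultimately show ?thesis by metis
    qed
    finally show ?thesis .
  qed
  have lt: "nat \<lfloor>real n * \<xi>\<rfloor> < n \<longleftrightarrow> \<xi> < 1" if "0 \<le> \<xi>" for \<xi>
  proof -
    have "nat \<lfloor>real n * \<xi>\<rfloor> < n \<longleftrightarrow> real n * \<xi> < real n" using that n by (simp add: nat_less_iff floor_less_iff)
    then show ?thesis using n by simp
  qed
  have eq: "indicator {0..1} \<xi> * (indicator {0..<1} \<xi> * h (nat \<lfloor>real n * \<xi>\<rfloor>)) = (\<Sum>k<n. h k * indicator (I k) \<xi>)" for \<xi>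
  proof (cases "0 \<le> \<xi> \<and> \<xi> < 1")
    case True
    then have "(\<Sum>k<n. h k * indicator (I k) \<xi>) = (\<Sum>k<n. if k = nat \<lfloor>real n * \<xi>\<rfloor> then h k else 0)"
      by (intro sum.cong) (auto simp: mem indicator_def)
    also have "\<dots> = h (nat \<lfloor>real n * \<xi>\<rfloor>)" using lt True by simp
    finally show ?thesis using True by simp
  next
    case False
    then have "(\<Sum>k<n. h k * indicator (I k) \<xi>) = 0"
      using lt by (intro sum.neutral) (auto simp: mem indicator_def)
    then show ?thesis using False by (auto simp: indicator_def)
  qed
  have "(LINT \<xi>|unif01. indicator {0..<1} \<xi> * h (nat \<lfloor>real n * \<xi>\<rfloor>)) =
    (LINT \<xi>|lborel. (\<Sum>k<n. h k * indicator (I k) \<xi>))"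
    by (subst integral_uniform_interval) (auto simp: set_lebesgue_integral_def eq)
  also have "\<dots> = (\<Sum>k<n. LINT \<xi>|lborel. h k * indicator (I k) \<xi>)"
    by (intro Bochner_Integration.integral_sum) (auto simp: I_def divide_right_mono intro!: integrable_real_indicator)
  also have "\<dots> = (\<Sum>k<n. h k / real n)"
    using n by (intro sum.cong refl) (auto simp: I_def divide_right_mono diff_divide_distrib[symmetric])
  finally show ?thesis by (simp add: sum_divide_distrib)
qed

text \<open>Dominated convergence for the diagonal entry at row
  \<open>nat \<lfloor>real n * \<xi>\<rfloor>\<close>, with bound \<open>(3 * C) ^ m\<close>.
  Interior \<xi> suffice: \<xi> > 0 sends the row to infinity, and \<xi> < 1 keeps all neighbouring
  indices below \<open>n\<close>.\<close>

lemma jacobi_trace_limit: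
  fixes a b :: "real \<Rightarrow> real" and c d :: "nat \<Rightarrow> nat \<Rightarrow> real"
  assumes c: "\<And>\<xi>. \<xi> \<in> {0<..<1} \<Longrightarrow> ((\<lambda>(j, n). c n j) \<longlongrightarrow> a \<xi>) (inf (ratio_at \<xi>) (principal {(j, n). Suc j < n}))"
    and d: "\<And>\<xi>. \<xi> \<in> {0<..<1} \<Longrightarrow> ((\<lambda>(j, n). d n j) \<longlongrightarrow> b \<xi>) (inf (ratio_at \<xi>) (principal {(j, n). Suc j < n}))"
    and C: "\<And>n j. n \<ge> N \<Longrightarrow> j \<le> n + m \<Longrightarrow> \<bar>c n j\<bar> \<le> C" "\<And>n j. n \<ge> N \<Longrightarrow> j \<le> n + m \<Longrightarrow> \<bar>d n j\<bar> \<le> C"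
    and meas: "a \<in> borel_measurable borel" "b \<in> borel_measurable borel"
  shows "(\<lambda>n. (\<Sum>k<n. jacobi_pow (c n) (d n) m k k) / real n) \<longlonglongrightarrow> arc_functional a b (\<lambda>u. u ^ m)"
proof -
  define F where "F = (\<lambda>n \<xi>. indicator {0..<1} \<xi> * jacobi_pow (c n) (d n) m (nat \<lfloor>real n * \<xi>\<rfloor>) (nat \<lfloor>real n * \<xi>\<rfloor>))"
  define G where "G = (\<lambda>\<xi>. LINT \<theta>|unifpi. (b \<xi> - 2 * a \<xi> * cos \<theta>) ^ m)"
  have G: "G \<xi> = arc_coeff m (a \<xi>) (b \<xi>) 0" for \<xi> by (simp add: G_def arc_coeff_def)
  have lim: "(\<lambda>n. F n \<xi>) \<longlonglongrightarrow> G \<xi>" if \<xi>: "\<xi> \<in> {0<..<1}" for \<xi>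
  proof -
    define K where "K = (\<lambda>n. nat \<lfloor>real n * \<xi>\<rfloor>)"
    have Kr: "(\<lambda>n. real (K n) / real n) \<longlonglongrightarrow> \<xi>"
    proof (rule tendsto_sandwich)
      show "\<forall>\<^sub>F n in sequentially. \<xi> - 1 / real n \<le> real (K n) / real n"
        using eventually_gt_at_top[of 0]
      proof eventually_elim
        case (elim n)
        have "real n * \<xi> - 1 \<le> real (K n)" unfolding K_def using \<xi> by linarith
        then have "(real n * \<xi> - 1) / real n \<le> real (K n) / real n" by (rule divide_right_mono) simp
        then show ?case using elim by (simp add: diff_divide_distrib)
      qed
      show "\<forall>\<^sub>F n in sequentially. real (K n) / real n \<le> \<xi>"
        using eventually_gt_at_top[of 0]
      proof eventually_elim
        case (elim n)
        have "real (K n) \<le> real n * \<xi>" unfolding K_def using \<xi> by (simp add: of_nat_nat)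
        then show ?case using elim by (simp add: field_simps)
      qed
      show "(\<lambda>n. \<xi> - 1 / real n) \<longlonglongrightarrow> \<xi>"
        using tendsto_diff[OF tendsto_const lim_1_over_n] by simp
    qed simp
    have Kp: "(\<lambda>n. real (K n) / real n * real n) = (\<lambda>n. real (K n))"
      unfolding K_def by (rule ext) auto
    have Ktop: "filterlim K at_top sequentially"
    proof -
      have "filterlim (\<lambda>n. real (K n) / real n * real n) at_top sequentially"
        using \<xi> by (intro filterlim_tendsto_pos_mult_at_top[OF Kr] filterlim_real_sequentially) auto
      then show ?thesis unfolding Kp using filterlim_sequentially_iff_filterlim_real by blast
    qed
    have Ki: "(\<lambda>n. real (nat (int (K n) + i)) / real n) \<longlonglongrightarrow> \<xi>" for i
    proof -
      have "(\<lambda>n. real (K n) / real n + of_int i * (1 / real n)) \<longlonglongrightarrow> \<xi> + of_int i * 0"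
        by (intro tendsto_intros Kr lim_1_over_n)
      moreover have "\<forall>\<^sub>F n in sequentially. real (K n) / real n + of_int i * (1 / real n) = real (nat (int (K n) + i)) / real n"
        using Ktop[unfolded filterlim_at_top, rule_format, of "nat \<bar>i\<bar>"]
      proof eventually_elim
        case (elim n)
        then have "real (nat (int (K n) + i)) = real (K n) + of_int i" by auto
        then show ?case by (simp add: add_divide_distrib)
      qed
      ultimately show ?thesis using Lim_transform_eventually by fastforce
    qed
    have V: "\<forall>\<^sub>F n in sequentially. Suc (nat (int (K n) + i)) < n" for i
    proof -
      have "(\<lambda>n. real (nat (int (K n) + i)) / real n + 1 / real n) \<longlonglongrightarrow> \<xi> + 0"
        by (intro tendsto_intros Ki lim_1_over_n)
      then have "\<forall>\<^sub>F n in sequentially. real (nat (int (K n) + i)) / real n + 1 / real n < 1"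
        using \<xi> by (auto dest: order_tendstoD(2))
      then show ?thesis using eventually_gt_at_top[of 0]
      proof eventually_elim
        case (elim n)
        then have "real (nat (int (K n) + i)) + 1 < real n" by (simp add: field_simps)
        then show ?case by linarith
      qed
    qed
    have id: "filterlim (\<lambda>n. n) at_top sequentially" by (rule filterlim_ident)
    have "(\<lambda>n. jacobi_pow (c n) (d n) m (K n) (nat (int (K n) + 0))) \<longlonglongrightarrow> arc_coeff m (a \<xi>) (b \<xi>) 0"
      by (rule jacobi_pow_limit[OF Ktop])
        (use ratio_at_sequence[OF c[OF \<xi>] id Ki V] ratio_at_sequence[OF d[OF \<xi>] id Ki V] in auto)
    then show ?thesis using \<xi> by (simp add: F_def K_def G)
  qed
  interpret U: prob_space unif01 by (rule prob_space_unif)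
  have Fb: "\<bar>F n \<xi>\<bar> \<le> (3 * C) ^ m" if "n \<ge> N" for n \<xi>
  proof (cases "\<xi> \<in> {0..<1}")
    case True
    then have "real n * \<xi> \<le> real n" by (simp add: mult_left_le)
    then have "nat \<lfloor>real n * \<xi>\<rfloor> \<le> n" by linarith
    then have "\<bar>jacobi_pow (c n) (d n) m (nat \<lfloor>real n * \<xi>\<rfloor>) (nat \<lfloor>real n * \<xi>\<rfloor>)\<bar> \<le> (3 * C) ^ m"
      using C[OF that] by (intro jacobi_pow_bound) auto
    then show ?thesis using True by (simp add: F_def)
  next
    case False
    have "C \<ge> 0" using C(1)[OF that, of 0] by simp
    then show ?thesis using False by (simp add: F_def)
  qed
  have Fm: "F n \<in> borel_measurable unif01" for n
    unfolding F_def by measurable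
  have Gm: "G \<in> borel_measurable unif01" unfolding G_def using meas by simp
  \<comment> \<open>The dominating bound holds from \<open>N\<close> on only, hence the shift of the
    sequence.\<close>
  have "(\<lambda>n. LINT \<xi>|unif01. F (n + N) \<xi>) \<longlonglongrightarrow> (LINT \<xi>|unif01. G \<xi>)"
  proof (rule integral_dominated_convergence[where w="\<lambda>_. (3 * C) ^ m"])
    have "AE \<xi> in unif01. \<xi> \<in> {0<..<1}"
    proof (rule AE_uniform_measureI)
      show "AE \<xi> in lborel. \<xi> \<in> {0..1} \<longrightarrow> \<xi> \<in> {0<..<1::real}"
        using AE_lborel_singleton[of 0] AE_lborel_singleton[of 1] by eventually_elim auto
    qed simp
    then show "AE \<xi> in unif01. (\<lambda>n. F (n + N) \<xi>) \<longlonglongrightarrow> G \<xi>"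
      by eventually_elim (rule LIMSEQ_ignore_initial_segment[OF lim])
    show "AE \<xi> in unif01. norm (F (n + N) \<xi>) \<le> (3 * C) ^ m" for n
      using Fb by auto
  qed (use Fm Gm in auto)
  then have "(\<lambda>n. LINT \<xi>|unif01. F n \<xi>) \<longlonglongrightarrow> (LINT \<xi>|unif01. G \<xi>)" by (rule LIMSEQ_offset)
  then have L: "(\<lambda>n. LINT \<xi>|unif01. F n \<xi>) \<longlonglongrightarrow> arc_functional a b (\<lambda>u. u ^ m)"
    unfolding G_def arc_functional_def .
  have "\<forall>\<^sub>F n in sequentially. (LINT \<xi>|unif01. F n \<xi>) = (\<Sum>k<n. jacobi_pow (c n) (d n) m k k) / real n"
    using eventually_ge_at_top[of 1]
    by eventually_elim (unfold F_def, rule integral_step_function)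
  with L show ?thesis by (rule Lim_transform_eventually)
qed

section \<open>From powers to continuous test functions\<close>

context
  fixes a b :: "real \<Rightarrow> real" and R :: real
  assumes meas: "a \<in> borel_measurable borel" "b \<in> borel_measurable borel"
    and R: "\<And>\<xi>. \<bar>b \<xi>\<bar> + 2 * \<bar>a \<xi>\<bar> \<le> R"
begin

lemma arc_point_in_range: "b \<xi> - 2 * a \<xi> * cos \<theta> \<in> {-R..R}"
proof -
  have "\<bar>2 * a \<xi> * cos \<theta>\<bar> \<le> 2 * \<bar>a \<xi>\<bar>"
    using mult_left_mono[OF abs_cos_le_one[of \<theta>], of "2 * \<bar>a \<xi>\<bar>"] by (simp add: abs_mult)
  then show ?thesis using R[of \<xi>] by auto
qed

lemma arc_integrable:
  fixes g :: "real \<Rightarrow> real"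
  assumes g: "g \<in> borel_measurable borel" and C: "\<And>u. u \<in> {-R..R} \<Longrightarrow> \<bar>g u\<bar> \<le> C"
  shows "integrable unifpi (\<lambda>\<theta>. g (b \<xi> - 2 * a \<xi> * cos \<theta>))"
    and "integrable unif01 (\<lambda>\<xi>. LINT \<theta>|unifpi. g (b \<xi> - 2 * a \<xi> * cos \<theta>))"
    and "\<bar>arc_functional a b g\<bar> \<le> C"
proof -
  note [measurable] = meas g
  interpret U: prob_space unif01 by (rule prob_space_unif)
  interpret V: prob_space unifpi by (rule prob_space_unif)
  have i1: "integrable unifpi (\<lambda>\<theta>. g (b \<xi> - 2 * a \<xi> * cos \<theta>))" for \<xi>
    by (rule integrable_bounded_prob[OF prob_space_unif(2) _ C[OF arc_point_in_range]]) measurable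
  then show "integrable unifpi (\<lambda>\<theta>. g (b \<xi> - 2 * a \<xi> * cos \<theta>))" .
  have b1: "\<bar>LINT \<theta>|unifpi. g (b \<xi> - 2 * a \<xi> * cos \<theta>)\<bar> \<le> C" for \<xi>
  proof -
    have "\<bar>LINT \<theta>|unifpi. g (b \<xi> - 2 * a \<xi> * cos \<theta>)\<bar> \<le> (LINT \<theta>|unifpi. \<bar>g (b \<xi> - 2 * a \<xi> * cos \<theta>)\<bar>)"
      by (rule integral_abs_bound)
    also have "\<dots> \<le> C" by (rule V.integral_le_const) (use i1 C arc_point_in_range in auto)
    finally show ?thesis .
  qed
  show i2: "integrable unif01 (\<lambda>\<xi>. LINT \<theta>|unifpi. g (b \<xi> - 2 * a \<xi> * cos \<theta>))"
    by (rule integrable_bounded_prob[OF prob_space_unif(1) _ b1]) measurable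
  have "\<bar>arc_functional a b g\<bar> \<le> (LINT \<xi>|unif01. \<bar>LINT \<theta>|unifpi. g (b \<xi> - 2 * a \<xi> * cos \<theta>)\<bar>)"
    unfolding arc_functional_def by (rule integral_abs_bound)
  also have "\<dots> \<le> C" by (rule U.integral_le_const) (use i2 b1 in auto)
  finally show "\<bar>arc_functional a b g\<bar> \<le> C" .
qed

lemma continuous_bounded_range:
  fixes g :: "real \<Rightarrow> real"
  assumes "continuous_on UNIV g"
  obtains C where "\<And>u. u \<in> {-R..R} \<Longrightarrow> \<bar>g u\<bar> \<le> C"
proof -
  have "compact (g ` {-R..R})"
    using assms by (intro compact_continuous_image) (auto intro: continuous_on_subset)
  then have "bounded (g ` {-R..R})" by (rule compact_imp_bounded)
  then obtain C where "\<forall>u\<in>{-R..R}. \<bar>g u\<bar> \<le> C" by (auto simp: bounded_iff)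
  then show ?thesis by (intro that[of C]) auto
qed

lemma arc_functional_diff:
  fixes g h :: "real \<Rightarrow> real"
  assumes g: "continuous_on UNIV g" and h: "continuous_on UNIV h"
  shows "arc_functional a b g - arc_functional a b h = arc_functional a b (\<lambda>u. g u - h u)"
proof -
  obtain C where C: "\<And>u. u \<in> {-R..R} \<Longrightarrow> \<bar>g u\<bar> \<le> C" using continuous_bounded_range[OF g] by blast
  obtain D where D: "\<And>u. u \<in> {-R..R} \<Longrightarrow> \<bar>h u\<bar> \<le> D" using continuous_bounded_range[OF h] by blast
  note I = arc_integrable[OF borel_measurable_continuous_onI[OF g] C]
    arc_integrable[OF borel_measurable_continuous_onI[OF h] D]
  have "(LINT \<theta>|unifpi. g (b \<xi> - 2 * a \<xi> * cos \<theta>) - h (b \<xi> - 2 * a \<xi> * cos \<theta>)) =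
      (LINT \<theta>|unifpi. g (b \<xi> - 2 * a \<xi> * cos \<theta>)) - (LINT \<theta>|unifpi. h (b \<xi> - 2 * a \<xi> * cos \<theta>))" for \<xi>
    by (rule Bochner_Integration.integral_diff[OF I(1) I(4)])
  then show ?thesis
    unfolding arc_functional_def
    by (simp only: Bochner_Integration.integral_diff[OF I(2) I(5)])
qed

lemma arc_functional_sum:
  fixes h :: "nat \<Rightarrow> real \<Rightarrow> real" and c :: "nat \<Rightarrow> real"
  assumes h: "\<And>i. continuous_on UNIV (h i)"
  shows "arc_functional a b (\<lambda>u. \<Sum>i\<in>I. c i * h i u) = (\<Sum>i\<in>I. c i * arc_functional a b (h i))"
proof -
  have I: "integrable unifpi (\<lambda>\<theta>. h i (b \<xi> - 2 * a \<xi> * cos \<theta>))"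
    "integrable unif01 (\<lambda>\<xi>. LINT \<theta>|unifpi. h i (b \<xi> - 2 * a \<xi> * cos \<theta>))" for i \<xi>
  proof -
    obtain C where C: "\<And>u. u \<in> {-R..R} \<Longrightarrow> \<bar>h i u\<bar> \<le> C" using continuous_bounded_range[OF h] by blast
    note I = arc_integrable[OF borel_measurable_continuous_onI[OF h] C]
    show "integrable unifpi (\<lambda>\<theta>. h i (b \<xi> - 2 * a \<xi> * cos \<theta>))" by (rule I(1))
    show "integrable unif01 (\<lambda>\<xi>. LINT \<theta>|unifpi. h i (b \<xi> - 2 * a \<xi> * cos \<theta>))" by (rule I(2))
  qed
  have "(LINT \<theta>|unifpi. (\<Sum>i\<in>I. c i * h i (b \<xi> - 2 * a \<xi> * cos \<theta>))) =
      (\<Sum>i\<in>I. c i * (LINT \<theta>|unifpi. h i (b \<xi> - 2 * a \<xi> * cos \<theta>)))" for \<xi>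
    by (subst Bochner_Integration.integral_sum) (rule integrable_mult_right, rule I(1), simp only: integral_mult_right_zero)
  moreover have "(LINT \<xi>|unif01. (\<Sum>i\<in>I. c i * (LINT \<theta>|unifpi. h i (b \<xi> - 2 * a \<xi> * cos \<theta>)))) =
      (\<Sum>i\<in>I. c i * (LINT \<xi>|unif01. LINT \<theta>|unifpi. h i (b \<xi> - 2 * a \<xi> * cos \<theta>)))"
    by (subst Bochner_Integration.integral_sum) (rule integrable_mult_right, rule I(2), simp only: integral_mult_right_zero)
  ultimately show ?thesis
    unfolding arc_functional_def by (simp only:)
qed

text \<open>A nonnegative integrand with integral zero vanishes almost everywhere. Applied first in
  \<xi> and then in \<theta> to the distance from \<open>S\<close>, this puts almost every arc point
  into the closed set \<open>S\<close>.\<close>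

lemma arc_functional_eq_on_support:
  fixes g h :: "real \<Rightarrow> real"
  assumes S: "closed S" "S \<noteq> {}" and zero: "arc_functional a b (\<lambda>u. infdist u S) = 0"
    and g: "g \<in> borel_measurable borel" and h: "h \<in> borel_measurable borel"
    and eq: "\<And>u. u \<in> S \<Longrightarrow> g u = h u"
  shows "arc_functional a b g = arc_functional a b h"
proof -
  note [measurable] = meas g h
  have d: "continuous_on UNIV (\<lambda>u. infdist u S)" by (intro continuous_intros)
  obtain C where C: "\<And>u. u \<in> {-R..R} \<Longrightarrow> \<bar>infdist u S\<bar> \<le> C" using continuous_bounded_range[OF d] by blast
  note I = arc_integrable[OF borel_measurable_continuous_onI[OF d] C]
  have "AE \<xi> in unif01. (LINT \<theta>|unifpi. infdist (b \<xi> - 2 * a \<xi> * cos \<theta>) S) = 0"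
    using zero unfolding arc_functional_def
    by (subst (asm) integral_nonneg_eq_0_iff_AE[OF I(2)]) (auto intro!: integral_nonneg_AE infdist_nonneg)
  then have "AE \<xi> in unif01. (LINT \<theta>|unifpi. g (b \<xi> - 2 * a \<xi> * cos \<theta>)) = (LINT \<theta>|unifpi. h (b \<xi> - 2 * a \<xi> * cos \<theta>))"
  proof eventually_elim
    case (elim \<xi>)
    then have "AE \<theta> in unifpi. infdist (b \<xi> - 2 * a \<xi> * cos \<theta>) S = 0"
      by (subst (asm) integral_nonneg_eq_0_iff_AE[OF I(1)]) (auto intro!: infdist_nonneg)
    then have "AE \<theta> in unifpi. g (b \<xi> - 2 * a \<xi> * cos \<theta>) = h (b \<xi> - 2 * a \<xi> * cos \<theta>)"
      by eventually_elim (use in_closed_iff_infdist_zero[OF S] eq in auto)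
    then show ?case by (intro integral_cong_AE) measurable
  qed
  then show ?thesis
    unfolding arc_functional_def by (intro integral_cong_AE) measurable
qed

text \<open>A statement about one realisation \<open>X\<close>: the convergence of all powers and
  the vanishing of all outside moments are hypotheses. On \<open>K\<close>, \<open>f\<close> is
  compared with a polynomial \<open>Q\<close> in \<open>u n\<close>; outside \<open>K\<close> both
  \<open>f\<close> and \<open>Q\<close> are dominated by powers of \<open>u n\<close>.\<close>

lemma linear_statistic_limit_continuous:
  fixes \<nu> :: "nat \<Rightarrow> int \<Rightarrow> real" and X :: "nat \<Rightarrow> nat \<Rightarrow> real" and f g \<mu> :: "real \<Rightarrow> real"
  defines "u \<equiv> \<lambda>n. rescale n (\<nu> n)"
  assumes X: "\<And>n j. n \<ge> 1 \<Longrightarrow> j \<in> {1..n} \<Longrightarrow> X n j \<in> lattice_pts n"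
    and mom: "\<And>m. (\<lambda>n. (\<Sum>j\<in>{1..n}. u n (X n j) ^ m) / real n) \<longlonglongrightarrow> arc_functional a b (\<lambda>u. u ^ m)"
    and out: "\<And>k. (\<lambda>n. (\<Sum>j\<in>{1..n}. \<bar>u n (X n j)\<bar> ^ k * indicator (- K) (X n j)) / real n) \<longlonglongrightarrow> 0"
    and comp: "compact (\<mu> ` K)"
    and unif: "\<And>e. e > 0 \<Longrightarrow> \<forall>\<^sub>F n in sequentially. \<forall>t\<in>lattice_pts n \<inter> K. \<bar>u n t - \<mu> t\<bar> < e"
    and g: "continuous_on UNIV g" and fg: "\<And>t. t \<in> K \<Longrightarrow> f t = g (\<mu> t)"
    and growth: "poly_growth \<nu> K f"
  shows "(\<lambda>n. (\<Sum>j\<in>{1..n}. f (X n j)) / real n) \<longlonglongrightarrow> arc_functional a b g"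
proof (rule LIMSEQ_I)
  fix e :: real assume e: "e > 0"
  \<comment> \<open>Five errors: uniform continuity of \<open>g\<close> and polynomial approximation
    on \<open>K\<close>, the points outside \<open>K\<close>, the convergence of the average of
    \<open>Q\<close>, and the functional of \<open>Q\<close> against that of
    \<open>g\<close>.\<close>
  define \<delta> where "\<delta> = e / 5"
  have \<delta>: "\<delta> > 0" using e by (simp add: \<delta>_def)
  obtain R0 where R0: "\<And>t. t \<in> K \<Longrightarrow> \<bar>\<mu> t\<bar> \<le> R0"
    using compact_imp_bounded[OF comp] by (auto simp: bounded_iff)
  \<comment> \<open>The interval must contain all arc points, hence \<open>R\<close>, and the values
    of \<open>u n\<close> on \<open>K\<close>, which eventually lie within \<open>1\<close> of the
    image of \<open>K\<close> under \<mu>.\<close>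
  define R1 where "R1 = max R (R0 + 1)"
  have "uniformly_continuous_on {-R1..R1} g"
    using g by (intro compact_uniformly_continuous) (auto intro: continuous_on_subset)
  then obtain \<eta> where \<eta>: "\<eta> > 0" "\<And>s t. s \<in> {-R1..R1} \<Longrightarrow> t \<in> {-R1..R1} \<Longrightarrow> \<bar>s - t\<bar> < \<eta> \<Longrightarrow> \<bar>g s - g t\<bar> < \<delta>"
    using \<delta> unfolding uniformly_continuous_on_def dist_real_def by metis
  obtain Q where Qp: "real_polynomial_function Q" and Qg: "\<And>t. t \<in> {-R1..R1} \<Longrightarrow> \<bar>g t - Q t\<bar> < \<delta>"
    using Stone_Weierstrass_real_polynomial_function[of "{-R1..R1}" g \<delta>] g \<delta>
    by (metis compact_Icc continuous_on_subset top_greatest)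
  obtain c d where Q: "Q = (\<lambda>t. \<Sum>i\<le>d. c i * t ^ i)"
    using Qp unfolding real_polynomial_function_iff_sum by blast
  have Qcont: "continuous_on UNIV Q" unfolding Q by (intro continuous_intros)
  have \<Lambda>: "arc_functional a b Q = (\<Sum>i\<le>d. c i * arc_functional a b (\<lambda>u. u ^ i))"
    unfolding Q by (rule arc_functional_sum) (intro continuous_intros)
  have close: "\<bar>arc_functional a b Q - arc_functional a b g\<bar> \<le> \<delta>"
    unfolding arc_functional_diff[OF Qcont g]
  proof (rule arc_integrable(3))
    show "(\<lambda>u. Q u - g u) \<in> borel_measurable borel"
      using Qcont g by (intro borel_measurable_continuous_onI continuous_intros)
    fix t assume "t \<in> {-R..R}"
    then have "t \<in> {-R1..R1}" by (auto simp: R1_def)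
    from Qg[OF this] show "\<bar>Q t - g t\<bar> \<le> \<delta>" by linarith
  qed
  have Qlim: "(\<lambda>n. (\<Sum>j\<in>{1..n}. Q (u n (X n j))) / real n) \<longlonglongrightarrow> arc_functional a b Q"
  proof -
    have "(\<lambda>n. \<Sum>i\<le>d. c i * ((\<Sum>j\<in>{1..n}. u n (X n j) ^ i) / real n)) \<longlonglongrightarrow> arc_functional a b Q"
      unfolding \<Lambda> by (intro tendsto_intros mom)
    moreover have "(\<Sum>i\<le>d. c i * ((\<Sum>j\<in>{1..n}. u n (X n j) ^ i) / real n)) =
       (\<Sum>j\<in>{1..n}. Q (u n (X n j))) / real n" for n
      unfolding Q by (subst sum.swap) (simp add: sum_distrib_left sum_divide_distrib)
    ultimately show ?thesis by simp
  qed
  obtain C k where C: "\<forall>\<^sub>F n in sequentially. \<forall>t\<in>lattice_pts n - K. \<bar>f t\<bar> \<le> C * (1 + \<bar>u n t\<bar> ^ k)"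
    using growth unfolding poly_growth_def u_def by blast
  define O1 where "O1 = (\<lambda>k n. (\<Sum>j\<in>{1..n}. \<bar>u n (X n j)\<bar> ^ k * indicator (- K) (X n j)) / real n)"
  \<comment> \<open>Bounds the outside contribution: the terms with \<open>C\<close> control
    \<open>f\<close> by the growth condition, the sum controls \<open>Q\<close> coefficient by
    coefficient.\<close>
  define rest where "rest = (\<lambda>n. \<bar>C\<bar> * O1 0 n + \<bar>C\<bar> * O1 k n + (\<Sum>i\<le>d. \<bar>c i\<bar> * O1 i n))"
  have "rest \<longlonglongrightarrow> \<bar>C\<bar> * 0 + \<bar>C\<bar> * 0 + (\<Sum>i\<le>d. \<bar>c i\<bar> * 0)"
    unfolding rest_def O1_def by (intro tendsto_intros out)
  then have rest: "\<forall>\<^sub>F n in sequentially. rest n < \<delta>"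
    using order_tendstoD(2)[of rest 0 sequentially \<delta>] \<delta> by simp
  have near: "\<forall>\<^sub>F n in sequentially. \<bar>(\<Sum>j\<in>{1..n}. Q (u n (X n j))) / real n - arc_functional a b Q\<bar> < \<delta>"
    using Qlim \<delta> by (auto dest: tendstoD simp: dist_real_def)
  have "\<forall>\<^sub>F n in sequentially. \<forall>t\<in>lattice_pts n \<inter> K. \<bar>u n t - \<mu> t\<bar> < min \<eta> 1"
    by (rule unif) (use \<eta>(1) in auto)
  then have "\<forall>\<^sub>F n in sequentially. \<bar>(\<Sum>j\<in>{1..n}. f (X n j)) / real n - arc_functional a b g\<bar> < e"
    using C rest near eventually_ge_at_top[of 1]
  proof eventually_elim
    case (elim n)
    define h where "h = (\<lambda>t. indicator (- K) t * (\<bar>C\<bar> * (1 + \<bar>u n t\<bar> ^ k) + (\<Sum>i\<le>d. \<bar>c i\<bar> * \<bar>u n t\<bar> ^ i)))"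
    have pt: "\<bar>f t - Q (u n t)\<bar> \<le> 2 * \<delta> + h t" if t: "t \<in> lattice_pts n" for t
    proof (cases "t \<in> K")
      case True
      then have n: "\<bar>u n t - \<mu> t\<bar> < \<eta>" "\<bar>u n t - \<mu> t\<bar> < 1" using elim(1) t by auto
      then have r: "u n t \<in> {-R1..R1}" "\<mu> t \<in> {-R1..R1}" using R0[OF True] by (auto simp: R1_def)
      have "\<bar>g (\<mu> t) - g (u n t)\<bar> < \<delta>" using \<eta>(2)[OF r(2,1)] n(1) by (simp add: abs_minus_commute)
      then show ?thesis using Qg[OF r(1)] fg[OF True] True by (simp add: h_def)
    next
      case False
      have "\<bar>f t\<bar> \<le> C * (1 + \<bar>u n t\<bar> ^ k)" using elim(2) t False by blast
      also have "\<dots> \<le> \<bar>C\<bar> * (1 + \<bar>u n t\<bar> ^ k)" by (intro mult_right_mono) auto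
      finally have 1: "\<bar>f t\<bar> \<le> \<bar>C\<bar> * (1 + \<bar>u n t\<bar> ^ k)" .
      have "\<bar>Q (u n t)\<bar> \<le> (\<Sum>i\<le>d. \<bar>c i * u n t ^ i\<bar>)" unfolding Q by (rule sum_abs)
      also have "\<dots> = (\<Sum>i\<le>d. \<bar>c i\<bar> * \<bar>u n t\<bar> ^ i)" by (simp add: abs_mult power_abs)
      finally show ?thesis using 1 False \<delta> by (simp add: h_def)
    qed
    have "\<bar>(\<Sum>j\<in>{1..n}. f (X n j)) / real n - (\<Sum>j\<in>{1..n}. Q (u n (X n j))) / real n\<bar> =
       \<bar>\<Sum>j\<in>{1..n}. f (X n j) - Q (u n (X n j))\<bar> / real n"
      by (simp add: sum_subtractf diff_divide_distrib[symmetric])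
    also have "\<dots> \<le> (\<Sum>j\<in>{1..n}. 2 * \<delta> + h (X n j)) / real n"
      by (intro divide_right_mono order_trans[OF sum_abs] sum_mono pt X) (use elim in auto)
    also have "\<dots> = 2 * \<delta> + (\<Sum>j\<in>{1..n}. h (X n j)) / real n"
      using elim by (simp add: sum.distrib add_divide_distrib)
    also have "(\<Sum>j\<in>{1..n}. h (X n j)) / real n = rest n"
    proof -
      define S where "S = (\<lambda>i. \<Sum>j\<in>{1..n}. \<bar>u n (X n j)\<bar> ^ i * indicator (- K) (X n j))"
      have "(\<Sum>j\<in>{1..n}. h (X n j)) = (\<Sum>j\<in>{1..n}. \<bar>C\<bar> * (\<bar>u n (X n j)\<bar> ^ 0 * indicator (- K) (X n j)) +
         \<bar>C\<bar> * (\<bar>u n (X n j)\<bar> ^ k * indicator (- K) (X n j)) +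
         (\<Sum>i\<le>d. \<bar>c i\<bar> * (\<bar>u n (X n j)\<bar> ^ i * indicator (- K) (X n j))))"
        unfolding h_def by (intro sum.cong refl) (simp add: algebra_simps sum_distrib_left)
      also have "\<dots> = \<bar>C\<bar> * (\<Sum>j\<in>{1..n}. \<bar>u n (X n j)\<bar> ^ 0 * indicator (- K) (X n j)) +
         \<bar>C\<bar> * (\<Sum>j\<in>{1..n}. \<bar>u n (X n j)\<bar> ^ k * indicator (- K) (X n j)) +
         (\<Sum>i\<le>d. \<bar>c i\<bar> * (\<Sum>j\<in>{1..n}. \<bar>u n (X n j)\<bar> ^ i * indicator (- K) (X n j)))"
        unfolding sum.distrib sum_distrib_left by (intro arg_cong2[where f="(+)"] refl sum.swap)
      finally have "(\<Sum>j\<in>{1..n}. h (X n j)) / real n = (\<bar>C\<bar> * S 0 + \<bar>C\<bar> * S k + (\<Sum>i\<le>d. \<bar>c i\<bar> * S i)) / real n"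
        unfolding S_def by (rule arg_cong)
      also have "\<dots> = \<bar>C\<bar> * (S 0 / real n) + \<bar>C\<bar> * (S k / real n) + (\<Sum>i\<le>d. \<bar>c i\<bar> * (S i / real n))"
        by (simp add: add_divide_distrib sum_divide_distrib)
      also have "\<dots> = rest n"
        by (simp only: rest_def O1_def S_def)
      finally show ?thesis .
    qed
    finally have "\<bar>(\<Sum>j\<in>{1..n}. f (X n j)) / real n - (\<Sum>j\<in>{1..n}. Q (u n (X n j))) / real n\<bar> \<le> 2 * \<delta> + rest n" .
    moreover have "e = 5 * \<delta>" by (simp add: \<delta>_def)
    ultimately show ?case using elim(3,4) close by linarith
  qed
  then show "\<exists>no. \<forall>n\<ge>no. norm ((\<Sum>j\<in>{1..n}. f (X n j)) / real n - arc_functional a b g) < e"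
    by (simp add: eventually_sequentially)
qed

text \<open>
  On \<open>K\<close> the function \<open>0\<close> is the composition of \<open>infdist _ (\<mu> ` K)\<close> with \<open>\<mu>\<close>, so the limit functional vanishes
  on the distance to \<open>\<mu> ` K\<close>. Hence \<open>g\<close> may be replaced by a continuous extension from there.
\<close>

lemma linear_statistic_limit:
  fixes \<nu> :: "nat \<Rightarrow> int \<Rightarrow> real" and X :: "nat \<Rightarrow> nat \<Rightarrow> real" and f \<mu> g :: "real \<Rightarrow> real"
  defines "u \<equiv> \<lambda>n. rescale n (\<nu> n)"
  assumes X: "\<And>n j. n \<ge> 1 \<Longrightarrow> j \<in> {1..n} \<Longrightarrow> X n j \<in> lattice_pts n"
    and mom: "\<And>m. (\<lambda>n. (\<Sum>j\<in>{1..n}. u n (X n j) ^ m) / real n) \<longlonglongrightarrow> arc_functional a b (\<lambda>u. u ^ m)"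
    and out: "\<And>k. (\<lambda>n. (\<Sum>j\<in>{1..n}. \<bar>u n (X n j)\<bar> ^ k * indicator (- K) (X n j)) / real n) \<longlonglongrightarrow> 0"
    and comp: "compact (\<mu> ` K)"
    and unif: "\<And>e. e > 0 \<Longrightarrow> \<forall>\<^sub>F n in sequentially. \<forall>t\<in>lattice_pts n \<inter> K. \<bar>u n t - \<mu> t\<bar> < e"
    and g: "continuous_on (\<mu> ` K) g" "g \<in> borel_measurable borel"
    and fg: "\<And>t. t \<in> K \<Longrightarrow> f t = g (\<mu> t)"
    and growth: "poly_growth \<nu> K f"
  shows "(\<lambda>n. (\<Sum>j\<in>{1..n}. f (X n j)) / real n) \<longlonglongrightarrow> arc_functional a b g"
proof -
  have lim: "(\<lambda>n. (\<Sum>j\<in>{1..n}. f' (X n j)) / real n) \<longlonglongrightarrow> arc_functional a b g'"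
    if "continuous_on UNIV g'" "\<And>t. t \<in> K \<Longrightarrow> f' t = g' (\<mu> t)" "poly_growth \<nu> K f'" for f' g'
  proof (rule linear_statistic_limit_continuous[where \<nu>=\<nu> and X=X and \<mu>=\<mu> and K=K])
  qed (rule X mom[unfolded u_def] out[unfolded u_def] comp unif[unfolded u_def] that; assumption)+
  \<comment> \<open>If \<open>K\<close> were empty, all points would lie outside and the zeroth
    outside moment would be \<open>1\<close>. Nonemptiness makes vanishing of \<open>infdist\<close>
    characterise membership in the closed set.\<close>
  have "\<mu> ` K \<noteq> {}"
  proof
    assume "\<mu> ` K = {}"
    then have "(\<Sum>j\<in>{1..n}. \<bar>u n (X n j)\<bar> ^ 0 * indicator (- K) (X n j)) / real n = 1" if "n \<ge> 1" for n
      using that by simp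
    then have "\<forall>\<^sub>F n in sequentially. (\<Sum>j\<in>{1..n}. \<bar>u n (X n j)\<bar> ^ 0 * indicator (- K) (X n j)) / real n = 1"
      by (rule eventually_mono[OF eventually_ge_at_top[of 1]])
    then have "(\<lambda>n. (\<Sum>j\<in>{1..n}. \<bar>u n (X n j)\<bar> ^ 0 * indicator (- K) (X n j)) / real n) \<longlonglongrightarrow> 1"
      by (rule tendsto_eventually)
    from LIMSEQ_unique[OF this out[of 0]] show False by simp
  qed
  note S = compact_imp_closed[OF comp] this
  have "(\<lambda>n. (\<Sum>j\<in>{1..n}. 0) / real n) \<longlonglongrightarrow> arc_functional a b (\<lambda>u. infdist u (\<mu> ` K))"
  proof (rule lim)
    show "poly_growth \<nu> K (\<lambda>_. 0)" unfolding poly_growth_def by (intro exI[of _ 0]) simp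
  qed (auto intro!: continuous_intros)
  then have zero: "arc_functional a b (\<lambda>u. infdist u (\<mu> ` K)) = 0"
    using LIMSEQ_unique[OF _ tendsto_const[of 0]] by fastforce
  obtain h where h: "continuous_on UNIV h" "\<And>t. t \<in> \<mu> ` K \<Longrightarrow> h t = g t"
    using Tietze_unbounded[OF g(1), of UNIV] S(1) by auto
  have "(\<lambda>n. (\<Sum>j\<in>{1..n}. f (X n j)) / real n) \<longlonglongrightarrow> arc_functional a b h"
    by (rule lim[OF h(1) _ growth]) (use fg h(2) in auto)
  also have "arc_functional a b h = arc_functional a b g"
    by (rule arc_functional_eq_on_support[OF S zero borel_measurable_continuous_onI[OF h(1)] g(2) h(2)])
  finally show ?thesis .
qed

end

section \<open>Almost sure convergence\<close>

text \<open>The series of the \<open>Z n\<close> has finite expectation, hence converges almost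
  everywhere and its terms tend to zero. No independence enters; this is the form in which
  Borel-Cantelli is applied.\<close>

lemma AE_tendsto_0_of_summable:
  fixes Z :: "nat \<Rightarrow> 'a \<Rightarrow> real"
  assumes int: "\<And>n. integrable M (Z n)" and nonneg: "\<And>n \<omega>. 0 \<le> Z n \<omega>"
    and sm: "summable (\<lambda>n. LINT \<omega>|M. Z n \<omega>)"
  shows "AE \<omega> in M. (\<lambda>n. Z n \<omega>) \<longlonglongrightarrow> 0"
proof -
  have [measurable]: "Z n \<in> borel_measurable M" for n
    using borel_measurable_integrable[OF int] .
  have m: "(\<lambda>\<omega>. ennreal (Z n \<omega>)) \<in> borel_measurable M" for n
    by measurable
  have "(\<integral>\<^sup>+ \<omega>. (\<Sum>n. ennreal (Z n \<omega>)) \<partial>M) = (\<Sum>n. \<integral>\<^sup>+ \<omega>. ennreal (Z n \<omega>) \<partial>M)"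
    by (rule nn_integral_suminf[OF m])
  also have "\<dots> = (\<Sum>n. ennreal (LINT \<omega>|M. Z n \<omega>))"
    using int nonneg by (simp add: nn_integral_eq_integral)
  also have "\<dots> \<noteq> \<infinity>"
    using sm nonneg by (simp add: suminf_ennreal2)
  finally have "AE \<omega> in M. (\<Sum>n. ennreal (Z n \<omega>)) \<noteq> \<infinity>"
    by (intro nn_integral_noteq_infinite) measurable
  then show ?thesis
  proof eventually_elim
    case (elim \<omega>)
    then have "summable (\<lambda>n. Z n \<omega>)"
      using nonneg by (intro summable_suminf_not_top) auto
    then show ?case by (rule summable_LIMSEQ_zero)
  qed
qed

text \<open>The squared normalised deviation has expectation at most \<open>D\<close> over the
  square of \<open>n\<close>, which is summable, so second moments suffice along the full
  sequence.\<close>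

lemma (in prob_space) AE_average_tendsto:
  fixes X :: "nat \<Rightarrow> 'a \<Rightarrow> real"
  assumes int: "\<And>n. integrable M (X n)" "\<And>n. integrable M (\<lambda>\<omega>. (X n \<omega>)\<^sup>2)"
    and lim: "(\<lambda>n. expectation (X n) / real n) \<longlonglongrightarrow> L"
    and var: "\<forall>\<^sub>F n in sequentially. variance (X n) \<le> D"
  shows "AE \<omega> in M. (\<lambda>n. X n \<omega> / real n) \<longlonglongrightarrow> L"
proof -
  define Z where "Z = (\<lambda>n \<omega>. ((X n \<omega> - expectation (X n)) / real n)\<^sup>2)"
  have i: "integrable M (\<lambda>\<omega>. (X n \<omega> - expectation (X n))\<^sup>2)" for n
    unfolding power2_diff using int by (intro Bochner_Integration.integrable_add Bochner_Integration.integrable_diff) auto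
  have Z: "Z n = (\<lambda>\<omega>. (X n \<omega> - expectation (X n))\<^sup>2 / (real n)\<^sup>2)" for n
    by (simp add: Z_def power_divide)
  have EZ: "expectation (Z n) = variance (X n) / (real n)\<^sup>2" for n
    unfolding Z by simp
  have "AE \<omega> in M. (\<lambda>n. Z n \<omega>) \<longlonglongrightarrow> 0"
  proof (rule AE_tendsto_0_of_summable)
    show "integrable M (Z n)" for n unfolding Z using i by simp
    show "0 \<le> Z n \<omega>" for n \<omega> by (simp add: Z_def)
    show "summable (\<lambda>n. expectation (Z n))"
    proof (rule summable_comparison_test_ev)
      show "summable (\<lambda>n. D * inverse (real n ^ 2))"
        by (intro summable_mult inverse_power_summable) simp
      show "\<forall>\<^sub>F n in sequentially. norm (expectation (Z n)) \<le> D * inverse (real n ^ 2)"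
        using var
      proof eventually_elim
        case (elim n)
        have "0 \<le> variance (X n)" by (rule Bochner_Integration.integral_nonneg) simp
        with elim show ?case unfolding EZ by (simp add: divide_inverse mult_right_mono)
      qed
    qed
  qed
  then show ?thesis
  proof eventually_elim
    case (elim \<omega>)
    from tendsto_real_sqrt[OF this]
    have "(\<lambda>n. \<bar>(X n \<omega> - expectation (X n)) / real n\<bar>) \<longlonglongrightarrow> 0" by (simp add: Z_def)
    then have "(\<lambda>n. (X n \<omega> - expectation (X n)) / real n) \<longlonglongrightarrow> 0"
      by (rule tendsto_rabs_zero_cancel)
    from tendsto_add[OF this lim] show ?case by (simp add: add_divide_distrib[symmetric])
  qed
qed

lemma AE_combine:
  assumes "AE x in M. P x" "AE x in M. Q x" "\<And>x. x \<in> space M \<Longrightarrow> P x \<Longrightarrow> Q x \<Longrightarrow> S x"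
  shows "AE x in M. S x"
  using AE_space[of M] assms(1,2) by eventually_elim (rule assms(3))

text \<open>The points are measurable into a discrete space, on which every real function is
  measurable.\<close>

lemma ensemble_point_measurable:
  fixes F :: "real \<Rightarrow> real"
  assumes "polynomial_ensemble M \<nu> w n x" and "j \<in> {1..n}"
  shows "(\<lambda>\<omega>. F (x j \<omega>)) \<in> borel_measurable M"
proof -
  have "x j \<in> M \<rightarrow>\<^sub>M count_space (lattice_pts n)"
    using assms unfolding polynomial_ensemble_def by blast
  then show ?thesis by (rule measurable_compose) simp
qed

theorem theorem2p2:
  fixes M :: "'s measure"
    and \<nu> w :: "nat \<Rightarrow> int \<Rightarrow> real"
    and x :: "nat \<Rightarrow> nat \<Rightarrow> 's \<Rightarrow> real"
    and p :: "nat \<Rightarrow> nat \<Rightarrow> real poly"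
    and \<alpha> \<beta> :: "nat \<Rightarrow> nat \<Rightarrow> real"
    and a b \<mu> f :: "real \<Rightarrow> real"
    and K :: "real set"
    and \<epsilon> :: real
  assumes "prob_space M"
    and "\<And>n. n \<ge> 1 \<Longrightarrow> strictly_monotone_on UNIV (\<nu> n)"
    and "\<And>n y. n \<ge> 1 \<Longrightarrow> w n y \<ge> 0"
    and "\<And>n k. n \<ge> 1 \<Longrightarrow> (\<lambda>y. \<bar>\<nu> n y\<bar> ^ k * w n y) summable_on UNIV"
    and "\<And>n. n \<ge> 1 \<Longrightarrow> infinite (weight_supp (w n)) \<or> n \<le> card (weight_supp (w n))"
    and "\<And>n. n \<ge> 1 \<Longrightarrow> polynomial_ensemble M (\<nu> n) (w n) n (x n)"
    and "\<And>n. n \<ge> 1 \<Longrightarrow> orthonormal_polys (\<nu> n) (w n) (p n)"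
    and "\<And>n. n \<ge> 1 \<Longrightarrow> recurrence_coeffs (\<nu> n) (w n) (p n) (\<alpha> n) (\<beta> n)"
    and "continuous_on {0..1} a" and "continuous_on {0..1} b"
    and "\<forall>\<xi>\<in>{0..1}. a \<xi> \<ge> 0" and "\<exists>\<xi>\<in>{0..1}. a \<xi> \<noteq> 0"
    and "\<And>\<xi>. \<xi> \<in> {0..1} \<Longrightarrow>
      ((\<lambda>(j, n). \<alpha> n j) \<longlongrightarrow> a \<xi>) (inf (ratio_at \<xi>) (principal {(j, n). poly_index (w n) (Suc j)}))"
    and "\<And>\<xi>. \<xi> \<in> {0..1} \<Longrightarrow>
      ((\<lambda>(j, n). \<beta> n j) \<longlongrightarrow> b \<xi>) (inf (ratio_at \<xi>) (principal {(j, n). poly_index (w n) j}))"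
    and "bounded K" and "compact (\<mu> ` K)" and "\<epsilon> > 0"
    and "\<And>k. (\<lambda>n. prob_space.expectation M
          (lin_stat n (x n) (\<lambda>t. \<bar>rescale n (\<nu> n) t\<bar> ^ k * indicator (- K) t)))
        \<in> O(\<lambda>n. real n powr (- \<epsilon>))"
    and "\<And>e. e > 0 \<Longrightarrow>
      \<forall>\<^sub>F n in sequentially. \<forall>t\<in>lattice_pts n \<inter> K. \<bar>rescale n (\<nu> n) t - \<mu> t\<bar> < e"
    and "strictly_monotone_on K \<mu>"
    and "continuous_on (\<mu> ` K) (f \<circ> inv_into K \<mu>)"
    and "poly_growth \<nu> K f"
  shows "AE \<omega> in M. (\<lambda>n. 1 / real n * lin_stat n (x n) f \<omega>)
           \<longlonglongrightarrow> limit_functional a b (f \<circ> inv_into K \<mu>)"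

proof -
  interpret prob_space M by (rule assms(1))
  note ens = assms(6)

  \<comment> \<open>Recurrence coefficients: extension, limits and bounds\<close>
  define aa where "aa = (\<lambda>\<xi>. indicator {0..1} \<xi> * a \<xi>)"
  define bb where "bb = (\<lambda>\<xi>. indicator {0..1} \<xi> * b \<xi>)"
  have aa1: "aa \<xi> = a \<xi>" and bb1: "bb \<xi> = b \<xi>" if "\<xi> \<in> {0..1}" for \<xi>
    using that by (auto simp: aa_def bb_def)
  \<comment> \<open>\<open>a\<close> and \<open>b\<close> are controlled on the unit interval only;
    extended by zero they are Borel and, by compactness, bounded on the whole line.\<close>
  have meas: "aa \<in> borel_measurable borel" "bb \<in> borel_measurable borel"
    using borel_measurable_continuous_on_indicator[OF _ assms(9)]
      borel_measurable_continuous_on_indicator[OF _ assms(10)]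
    by (simp_all add: aa_def bb_def)
  obtain Ra Rb where Ra: "\<forall>\<xi>\<in>{0..1}. \<bar>a \<xi>\<bar> \<le> Ra" and Rb: "\<forall>\<xi>\<in>{0..1}. \<bar>b \<xi>\<bar> \<le> Rb"
    using compact_imp_bounded[OF compact_continuous_image[OF assms(9) compact_Icc]]
      compact_imp_bounded[OF compact_continuous_image[OF assms(10) compact_Icc]]
    by (auto simp: bounded_iff)
  have R: "\<bar>bb \<xi>\<bar> + 2 * \<bar>aa \<xi>\<bar> \<le> \<bar>Rb\<bar> + 2 * \<bar>Ra\<bar>" for \<xi>
  proof (cases "\<xi> \<in> {0..1}")
    case True
    with Ra Rb have "\<bar>a \<xi>\<bar> \<le> Ra" "\<bar>b \<xi>\<bar> \<le> Rb" by blast+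
    with True show ?thesis by (simp add: aa_def bb_def)
  qed (auto simp: aa_def bb_def)
  define c where "c = (\<lambda>n j. if poly_index (w n) (Suc j) then \<alpha> n j else 0)"
  define d where "d = (\<lambda>n j. if poly_index (w n) j then \<beta> n j else 0)"
  have pi: "poly_index (w n) k" if "k < n" for n k
    using assms(5)[of n] that by (auto simp: poly_index_def)
  \<comment> \<open>For \<open>Suc j < n\<close> the support condition guarantees that the
    coefficients exist, so setting them to zero elsewhere does not disturb limits restricted to
    these pairs.\<close>
  have trunc: "((\<lambda>(j, n). (if V n j then g n j else 0)) \<longlongrightarrow> l) (inf F (principal {(j, n). Suc j < n}))"
    if "((\<lambda>(j, n). g n j) \<longlongrightarrow> l) (inf F (principal {(j, n). V n j}))" "\<And>n j. Suc j < n \<Longrightarrow> V n j"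
    for V and g :: "nat \<Rightarrow> nat \<Rightarrow> real" and l F
  proof -
    have "((\<lambda>(j, n). g n j) \<longlongrightarrow> l) (inf F (principal {(j, n). Suc j < n}))"
      using that by (intro tendsto_mono[OF _ that(1)] inf_mono order_refl) auto
    moreover have "\<forall>\<^sub>F z in inf F (principal {(j, n). Suc j < n}).
        (case z of (j, n) \<Rightarrow> g n j) = (case z of (j, n) \<Rightarrow> if V n j then g n j else 0)"
      using that(2) unfolding eventually_inf_principal by (auto intro!: always_eventually)
    ultimately show ?thesis by (rule Lim_transform_eventually)
  qed
  have climit: "((\<lambda>(j, n). c n j) \<longlongrightarrow> aa \<xi>) (inf (ratio_at \<xi>) (principal {(j, n). Suc j < n}))"
    and dlimit: "((\<lambda>(j, n). d n j) \<longlongrightarrow> bb \<xi>) (inf (ratio_at \<xi>) (principal {(j, n). Suc j < n}))"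
    if "\<xi> \<in> {0<..<1}" for \<xi>
  proof -
    have \<xi>: "\<xi> \<in> {0..1}" using that by auto
    show "((\<lambda>(j, n). c n j) \<longlongrightarrow> aa \<xi>) (inf (ratio_at \<xi>) (principal {(j, n). Suc j < n}))"
      unfolding c_def aa1[OF \<xi>] by (rule trunc[OF assms(13)[OF \<xi>]]) (rule pi)
    show "((\<lambda>(j, n). d n j) \<longlongrightarrow> bb \<xi>) (inf (ratio_at \<xi>) (principal {(j, n). Suc j < n}))"
      unfolding d_def bb1[OF \<xi>] by (rule trunc[OF assms(14)[OF \<xi>]]) (rule pi, simp)
  qed
  \<comment> \<open>Needed up to \<open>n + m\<close>, because the variance involves entries beyond
    the leading block; coefficients that do not exist there count as zero.\<close>
  have bound: "\<exists>C N. C \<ge> 0 \<and> (\<forall>n\<ge>N. \<forall>j\<le>n + m. \<bar>c n j\<bar> \<le> C \<and> \<bar>d n j\<bar> \<le> C)" for m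
  proof -
    obtain C1 N1 where 1: "\<forall>n\<ge>N1. \<forall>j\<le>n + m. poly_index (w n) (Suc j) \<longrightarrow> \<bar>\<alpha> n j\<bar> \<le> C1"
      using ratio_limit_bounded[OF assms(13)] by blast
    obtain C2 N2 where 2: "\<forall>n\<ge>N2. \<forall>j\<le>n + m. poly_index (w n) j \<longrightarrow> \<bar>\<beta> n j\<bar> \<le> C2"
      using ratio_limit_bounded[OF assms(14)] by blast
    show ?thesis
      using 1 2 by (intro exI[of _ "max 0 (max C1 C2)"] exI[of _ "max N1 N2"]) (auto simp: c_def d_def le_max_iff_disj)
  qed

  \<comment> \<open>Almost sure limits of the power sums\<close>
  define X where "X = (\<lambda>m n. lin_stat n (x n) (rescale n (\<lambda>y. \<nu> n y ^ m)))"
  \<comment> \<open>The hypotheses start at \<open>n = 1\<close>; the empty ensemble is treated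
    separately so that the sequence lemmas apply to all \<open>n\<close>.\<close>
  have X0: "X m 0 = (\<lambda>_. 0)" for m by (auto simp: X_def lin_stat_def)
  have ps: "integrable M (X m n)" "expectation (X m n) = (\<Sum>k<n. jacobi_pow (c n) (d n) m k k)"
    "integrable M (\<lambda>\<omega>. (X m n \<omega>)\<^sup>2)" if n: "n \<ge> 1" for m n
  proof -
    note P = power_sum_moments[where m=m, OF assms(1) ens[OF n] n assms(5)[OF n] assms(7)[OF n] assms(8)[OF n]]
    show "integrable M (X m n)" unfolding X_def by (rule P(1))
    show "expectation (X m n) = (\<Sum>k<n. jacobi_pow (c n) (d n) m k k)"
      unfolding X_def c_def d_def by (rule P(2))
    show "integrable M (\<lambda>\<omega>. (X m n \<omega>)\<^sup>2)" unfolding X_def by (rule P(3))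
  qed
  have Xint: "integrable M (X m n)" "integrable M (\<lambda>\<omega>. (X m n \<omega>)\<^sup>2)" for m n
    using ps[of n m] by (cases "n = 0"; simp add: X0)+
  have EX: "expectation (X m n) = (\<Sum>k<n. jacobi_pow (c n) (d n) m k k)" for m n
    using ps(2)[of n m] by (cases "n = 0") (simp_all add: X0)
  have AE_mom: "AE \<omega> in M. (\<lambda>n. X m n \<omega> / real n) \<longlonglongrightarrow> arc_functional aa bb (\<lambda>u. u ^ m)" for m
  proof -
    obtain C N where C: "C \<ge> 0" "\<forall>n\<ge>N. \<forall>j\<le>n + m. \<bar>c n j\<bar> \<le> C \<and> \<bar>d n j\<bar> \<le> C"
      using bound by blast
    show ?thesis
    proof (rule AE_average_tendsto[OF Xint])
      show "(\<lambda>n. expectation (X m n) / real n) \<longlonglongrightarrow> arc_functional aa bb (\<lambda>u. u ^ m)"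
        unfolding EX by (rule jacobi_trace_limit[OF climit dlimit _ _ meas, where N=N and C=C]) (use C in auto)
      have "expectation (\<lambda>\<omega>. (X m n \<omega>)\<^sup>2) - (expectation (X m n))\<^sup>2 \<le> (real m * (3 * C) ^ m)\<^sup>2"
        if n: "n \<ge> max N 1" for n
      proof -
        have n1: "n \<ge> 1" using n by simp
        show ?thesis
        unfolding X_def
      proof (rule power_sum_moments(4)[where m=m, OF assms(1) ens[OF n1] n1 assms(5)[OF n1] assms(7)[OF n1] assms(8)[OF n1]])
        fix k j assume "k < n"
        then show "\<bar>jacobi_pow (\<lambda>j. if poly_index (w n) (Suc j) then \<alpha> n j else 0)
            (\<lambda>j. if poly_index (w n) j then \<beta> n j else 0) m k j\<bar> \<le> (3 * C) ^ m"
          using C(2) n by (intro jacobi_pow_bound) (auto simp: c_def d_def)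
        qed
      qed
      then show "\<forall>\<^sub>F n in sequentially. variance (X m n) \<le> (real m * (3 * C) ^ m)\<^sup>2"
        unfolding variance_eq[OF Xint] by (rule eventually_mono[OF eventually_ge_at_top])
    qed
  qed

  \<comment> \<open>Negligibility of the points outside \<open>K\<close>\<close>
  define O1 where "O1 = (\<lambda>k n. lin_stat n (x n) (\<lambda>t. \<bar>rescale n (\<nu> n) t\<bar> ^ k * indicator (- K) t))"
  have AE_out: "AE \<omega> in M. (\<lambda>n. O1 k n \<omega> / real n) \<longlonglongrightarrow> 0" for k
  proof (rule AE_tendsto_0_of_summable)
    fix n
    have "integrable M (O1 k n)"
    proof (cases "n = 0")
      case True
      then have "{1..n} = {}" by simp
      then have "O1 k n = (\<lambda>_. 0)" by (intro ext) (simp only: O1_def lin_stat_def sum.empty)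
      then show ?thesis by simp
    next
      case False
      then have n: "n \<ge> 1" by simp
      show ?thesis
      \<comment> \<open>With \<open>t\<close> the \<open>k\<close>-th power of the absolute value,
        \<open>t \<le> 1 + t\<^sup>2\<close> dominates the outside statistic by the power sums of
        orders \<open>0\<close> and \<open>2 * k\<close>, already known to be integrable.\<close>
      proof (rule Bochner_Integration.integrable_bound[of _ "\<lambda>\<omega>. X 0 n \<omega> + X (2 * k) n \<omega>"])
        show "integrable M (\<lambda>\<omega>. X 0 n \<omega> + X (2 * k) n \<omega>)" using Xint by simp
        show "O1 k n \<in> borel_measurable M"
          unfolding O1_def lin_stat_def[abs_def]
          by (intro borel_measurable_sum ensemble_point_measurable[OF ens[OF n]])
        have "\<bar>O1 k n \<omega>\<bar> \<le> X 0 n \<omega> + X (2 * k) n \<omega>" for \<omega>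
        proof -
          have "\<bar>O1 k n \<omega>\<bar> \<le> (\<Sum>j\<in>{1..n}. \<bar>\<bar>rescale n (\<nu> n) (x n j \<omega>)\<bar> ^ k * indicator (- K) (x n j \<omega>)\<bar>)"
            unfolding O1_def lin_stat_def by (rule sum_abs)
          also have "\<dots> \<le> (\<Sum>j\<in>{1..n}. 1 + rescale n (\<nu> n) (x n j \<omega>) ^ (2 * k))"
          proof (rule sum_mono)
            fix j
            define t where "t = \<bar>rescale n (\<nu> n) (x n j \<omega>)\<bar> ^ k"
            have "0 \<le> t" by (simp add: t_def)
            have "t \<le> 1 + t\<^sup>2" using sum_power2_ge_zero[of "t - 1/2" 0] by (simp add: power2_eq_square algebra_simps)
            moreover have "t\<^sup>2 = rescale n (\<nu> n) (x n j \<omega>) ^ (2 * k)"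
              unfolding t_def by (simp add: power_mult[symmetric] mult.commute power_even_abs)
            ultimately show "\<bar>\<bar>rescale n (\<nu> n) (x n j \<omega>)\<bar> ^ k * indicator (- K) (x n j \<omega>)\<bar> \<le>
                1 + rescale n (\<nu> n) (x n j \<omega>) ^ (2 * k)"
              unfolding t_def[symmetric] using \<open>0 \<le> t\<close> by (auto split: split_indicator)
          qed
          also have "\<dots> = X 0 n \<omega> + X (2 * k) n \<omega>"
            by (simp add: X_def lin_stat_def rescale_def sum.distrib)
          finally show ?thesis .
        qed
        then show "AE \<omega> in M. norm (O1 k n \<omega>) \<le> norm (X 0 n \<omega> + X (2 * k) n \<omega>)"
          by (auto intro!: AE_I2 intro: order_trans[OF _ abs_ge_self])
      qed
    qed
    then show "integrable M (\<lambda>\<omega>. O1 k n \<omega> / real n)" by simp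
    show "0 \<le> O1 k n \<omega> / real n" for \<omega>
      unfolding O1_def lin_stat_def by (intro divide_nonneg_nonneg sum_nonneg) auto
  next
    obtain C where C: "\<forall>\<^sub>F n in sequentially. norm (expectation (O1 k n)) \<le> C * norm (real n powr - \<epsilon>)"
      using landau_o.bigE[OF assms(18)[of k]] unfolding O1_def by blast
    show "summable (\<lambda>n. LINT \<omega>|M. O1 k n \<omega> / real n)"
    proof (rule summable_comparison_test_ev)
      \<comment> \<open>The rate in hypothesis (1) gains one power from the division by
        \<open>n\<close>; positivity of \<epsilon> puts the exponent below
        \<open>-1\<close>.\<close>
      show "summable (\<lambda>n. C * real n powr (- \<epsilon> - 1))"
        using assms(17) by (intro summable_mult) (simp add: summable_real_powr_iff)
      show "\<forall>\<^sub>F n in sequentially. norm (LINT \<omega>|M. O1 k n \<omega> / real n) \<le> C * real n powr (- \<epsilon> - 1)"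
        using C eventually_gt_at_top[of 0]
      proof eventually_elim
        case (elim n)
        have "norm (LINT \<omega>|M. O1 k n \<omega> / real n) = norm (expectation (O1 k n)) / real n" by simp
        also have "\<dots> \<le> C * real n powr - \<epsilon> / real n"
          using elim by (intro divide_right_mono) auto
        also have "\<dots> = C * real n powr (- \<epsilon> - 1)"
          using elim by (simp add: powr_diff)
        finally show ?case .
      qed
    qed
  qed

  \<comment> \<open>The test function in the limit functional\<close>
  have inj: "inj_on \<mu> K"
    using assms(20) unfolding strictly_monotone_on_def
    by (auto simp: inj_on_def monotone_on_def) (metis less_irrefl linorder_less_linear)+
  define g where "g = f \<circ> inv_into K \<mu>"
  \<comment> \<open>Off the image of \<open>K\<close>, \<open>inv_into\<close> chooses from an empty
    set, always with the same unspecified result. So \<open>g\<close> is constant there, which makes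
    it Borel and bounded on the whole line.\<close>
  have g0: "g u = f (SOME t. False)" if "u \<notin> \<mu> ` K" for u
  proof -
    have "(\<lambda>t. t \<in> K \<and> \<mu> t = u) = (\<lambda>_. False)" using that by auto
    then show ?thesis by (simp add: g_def inv_into_def)
  qed
  have gcont: "continuous_on (\<mu> ` K) g" using assms(21) by (simp add: g_def)
  have gm: "g \<in> borel_measurable borel"
  proof -
    have "(\<lambda>u. if u \<in> \<mu> ` K then g u else f (SOME t. False)) \<in> borel_measurable borel"
      using compact_imp_closed[OF assms(16)] gcont
      by (intro borel_measurable_continuous_on_if borel_closed) auto
    also have "(\<lambda>u. if u \<in> \<mu> ` K then g u else f (SOME t. False)) = g"
      using g0 by auto
    finally show ?thesis .
  qed
  obtain Cg where Cg: "\<And>u. \<bar>g u\<bar> \<le> Cg"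
  proof -
    obtain C where C: "\<forall>u\<in>\<mu> ` K. \<bar>g u\<bar> \<le> C"
      using compact_imp_bounded[OF compact_continuous_image[OF gcont assms(16)]] by (auto simp: bounded_iff)
    have "\<bar>g u\<bar> \<le> max C \<bar>f (SOME t. False)\<bar>" for u
      using C g0[of u] by (cases "u \<in> \<mu> ` K") (auto simp: le_max_iff_disj)
    then show ?thesis by (rule that)
  qed
  have "limit_functional a b g = limit_functional aa bb g"
  proof -
    have A: "(LINT \<xi>:{0..1}|lborel. (LINT u:{b \<xi> - 2 * a \<xi>..b \<xi> + 2 * a \<xi>}|lborel. g u / sqrt (4 * (a \<xi>)\<^sup>2 - (u - b \<xi>)\<^sup>2))) =
      (LINT \<xi>:{0..1}|lborel. (LINT u:{bb \<xi> - 2 * aa \<xi>..bb \<xi> + 2 * aa \<xi>}|lborel. g u / sqrt (4 * (aa \<xi>)\<^sup>2 - (u - bb \<xi>)\<^sup>2)))"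
      by (rule set_lebesgue_integral_cong) (simp_all add: aa1 bb1)
    have "{\<xi>\<in>{0..1}. a \<xi> = 0} = {\<xi>\<in>{0..1}. aa \<xi> = 0}" by (auto simp: aa1)
    moreover have "{\<xi>\<in>{0..1}. aa \<xi> = 0} \<in> sets lborel" using meas by measurable
    ultimately have B: "(LINT \<xi>:{\<xi>\<in>{0..1}. a \<xi> = 0}|lborel. g (b \<xi>)) = (LINT \<xi>:{\<xi>\<in>{0..1}. aa \<xi> = 0}|lborel. g (bb \<xi>))"
      by (simp only:, intro set_lebesgue_integral_cong) (auto simp: bb1)
    show ?thesis unfolding limit_functional_def A B ..
  qed
  also have "\<dots> = arc_functional aa bb g"
    by (rule limit_functional_eq_arc[OF meas _ gm Cg]) (use assms(11) aa1 in auto)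
  finally have lf: "limit_functional a b g = arc_functional aa bb g" .
  \<comment> \<open>Countably many null sets are discarded, one for each power here and one for each
    outside moment below; the resulting null set does not depend on \<open>f\<close>.\<close>
  have "AE \<omega> in M. \<forall>m. (\<lambda>n. X m n \<omega> / real n) \<longlonglongrightarrow> arc_functional aa bb (\<lambda>u. u ^ m)"
    unfolding AE_all_countable by (rule allI) (rule AE_mom)
  moreover have "AE \<omega> in M. \<forall>k. (\<lambda>n. O1 k n \<omega> / real n) \<longlonglongrightarrow> 0"
    unfolding AE_all_countable by (rule allI) (rule AE_out)
  moreover have "(\<lambda>n. 1 / real n * lin_stat n (x n) f \<omega>) \<longlonglongrightarrow> limit_functional a b g"
    if \<omega>: "\<omega> \<in> space M"
      and mom: "\<forall>m. (\<lambda>n. X m n \<omega> / real n) \<longlonglongrightarrow> arc_functional aa bb (\<lambda>u. u ^ m)"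
      and out: "\<forall>k. (\<lambda>n. O1 k n \<omega> / real n) \<longlonglongrightarrow> 0" for \<omega>
  proof -
    have h1: "x n j \<omega> \<in> lattice_pts n" if "n \<ge> 1" "j \<in> {1..n}" for n j
    proof -
      have "x n j \<in> M \<rightarrow>\<^sub>M count_space (lattice_pts n)"
        using ens[OF that(1)] that(2) unfolding polynomial_ensemble_def by blast
      from measurable_space[OF this \<omega>] show ?thesis by simp
    qed
    have h2: "(\<lambda>n. (\<Sum>j\<in>{1..n}. rescale n (\<nu> n) (x n j \<omega>) ^ m) / real n) \<longlonglongrightarrow> arc_functional aa bb (\<lambda>u. u ^ m)" for m
      using mom unfolding X_def lin_stat_def rescale_def by blast
    have h3: "(\<lambda>n. (\<Sum>j\<in>{1..n}. \<bar>rescale n (\<nu> n) (x n j \<omega>)\<bar> ^ k * indicator (- K) (x n j \<omega>)) / real n) \<longlonglongrightarrow> 0" for k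
      using out unfolding O1_def lin_stat_def by blast
    have h4: "f t = g (\<mu> t)" if "t \<in> K" for t
      using inv_into_f_f[OF inj that] by (simp add: g_def)
    have "(\<lambda>n. (\<Sum>j\<in>{1..n}. f (x n j \<omega>)) / real n) \<longlonglongrightarrow> arc_functional aa bb g"
    proof (rule linear_statistic_limit[where a=aa and b=bb and R="\<bar>Rb\<bar> + 2 * \<bar>Ra\<bar>" and \<nu>=\<nu> and \<mu>=\<mu>
          and K=K and X="\<lambda>n j. x n j \<omega>" and f=f and g=g])
    qed (rule meas R h1 h2 h3 assms(16) assms(19) gcont gm h4 assms(22); assumption)+
    then show ?thesis by (simp add: lin_stat_def lf)
  qed
  ultimately have "AE \<omega> in M. (\<lambda>n. 1 / real n * lin_stat n (x n) f \<omega>) \<longlonglongrightarrow> limit_functional a b g"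
    by (rule AE_combine)
  then show ?thesis unfolding g_def .
qed

end
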